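(* A Hubbard tree $(T,f)$ can be embedded into the plane so that $f$ respects the cyclic order of the local arms at all branch points if and only if $(T,f)$ has no evil orbits.
   Context: Trees. A tree $T$ is a finite connected (topological) graph without loops. For $x\in T$, the (global) arms of $x$ are the connected components of $T\setminus\{x\}$; a local arm at $x$ is the intersection of a global arm with a sufficiently small neighborhood of $x$. The point $x$ is an endpoint if it has only one arm, a branch point if it has at least three arms. $[x,y]$ is the unique closed arc connecting $x$ and $y$. Hubbard trees. A Hubbard tree is an (abstract) tree $T$ with a map $f\colon T\to T$ and a distinguished point, the critical point, such that: (1) $f$ is continuous and surjective; (2) every point has at most two inverse images under $f$; (3) at every point other than the critical point, $f$ is a local homeomorphism onto its image; (4) all endpoints of $T$ are on the critical orbit; (5) the critical point is periodic or preperiodic, but not fixed; (6) (expansivity) if $x\neq y$ are branch points or points on the critical orbit, then there is $n\ge 0$ such that $f^{\circ n}([x,y])$ contains the critical point. The critical point is never a branch point; hence at every branch point $x$, $f$ induces an injective map from the local arms at $x$ to the local arms at $f(x)$, and $f(x)$ is again a branch point. An embedding of $T$ into the plane gives a cyclic order of the local arms at each branch point; "$f$ respects the cyclic order at $x$" means that the induced injection from local arms at $x$ to local arms at $f(x)$ preserves the cyclic order. Tame and evil. A periodic orbit of branch points (which never contains the critical point) is called tame if all its local arms are on the same cycle under the map induced by $f$ on local arms, and evil otherwise. *)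

theory Defs
  imports "HOL-Analysis.Analysis"
begin

section \<open>Trees\<close>

text \<open>Edges are parametrised by arcs, so a loop edge has to be subdivided. A finite union
  of arcs in a Hausdorff space carries the topology of the abstract graph, so every abstract
  finite graph occurs as such a subset \<^term>\<open>T\<close> of some Hausdorff type.\<close>

definition finite_topological_graph :: "'a::t2_space set \<Rightarrow> bool" where
  "finite_topological_graph T \<longleftrightarrow>
    (\<exists>V E. finite V \<and> finite E \<and> T = V \<union> (\<Union>g\<in>E. path_image g) \<and>
       (\<forall>g\<in>E. arc g \<and> path_image g \<inter> V = {pathstart g, pathfinish g}) \<and>
       (\<forall>g\<in>E. \<forall>h\<in>E. g \<noteq> h \<longrightarrow> path_image g \<inter> path_image h \<subseteq> V))"

definition tree :: "'a::t2_space set \<Rightarrow> bool" where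
  "tree T \<longleftrightarrow> T \<noteq> {} \<and> connected T \<and> finite_topological_graph T \<and>
    \<not> (\<exists>g. simple_path g \<and> pathfinish g = pathstart g \<and> path_image g \<subseteq> T)"

definition arms :: "'a::t2_space set \<Rightarrow> 'a \<Rightarrow> 'a set set" where
  "arms T x = components (T - {x})"

text \<open>A local arm is a germ: the trace of a global arm on arbitrarily small neighbourhoods
  of \<^term>\<open>x\<close>, represented by the filter \<^term>\<open>at x within A\<close>. Since this filter
  converges to \<^term>\<open>x\<close>, local arms at different points are different. If \<^term>\<open>f\<close> is a
  local homeomorphism onto its image at \<^term>\<open>x\<close>, the induced map on local arms is
  \<^term>\<open>filtermap f\<close>.\<close>

definition local_arms :: "'a::t2_space set \<Rightarrow> 'a \<Rightarrow> 'a filter set" where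
  "local_arms T x = (\<lambda>A. at x within A) ` arms T x"

definition endpoint :: "'a::t2_space set \<Rightarrow> 'a \<Rightarrow> bool" where
  "endpoint T x \<longleftrightarrow> x \<in> T \<and> card (arms T x) = 1"

definition branch_point :: "'a::t2_space set \<Rightarrow> 'a \<Rightarrow> bool" where
  "branch_point T x \<longleftrightarrow> x \<in> T \<and> card (arms T x) \<ge> 3"

text \<open>The closed arc $[x,y]$; only meaningful for distinct points of a tree.\<close>

definition tree_arc :: "'a::t2_space set \<Rightarrow> 'a \<Rightarrow> 'a \<Rightarrow> 'a set" where
  "tree_arc T x y = (THE S. S \<subseteq> T \<and>
     (\<exists>g. arc g \<and> pathstart g = x \<and> pathfinish g = y \<and> path_image g = S))"


section \<open>Hubbard trees\<close>

definition forward_orbit :: "('a \<Rightarrow> 'a) \<Rightarrow> 'a \<Rightarrow> 'a set" where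
  "forward_orbit f x = {(f ^^ n) x | n. True}"

text \<open>In the local homeomorphism condition, the image of the neighbourhood \<^term>\<open>U\<close>
  need not be open in \<^term>\<open>T\<close>: an endpoint may be mapped to a point that is not an
  endpoint.\<close>

definition hubbard_tree :: "'a::t2_space set \<Rightarrow> ('a \<Rightarrow> 'a) \<Rightarrow> 'a \<Rightarrow> bool" where
  "hubbard_tree T f c \<longleftrightarrow> tree T \<and> c \<in> T \<and>
     continuous_on T f \<and> f ` T = T \<and>
     (\<forall>y\<in>T. finite {x\<in>T. f x = y} \<and> card {x\<in>T. f x = y} \<le> 2) \<and>
     (\<forall>x\<in>T - {c}. \<exists>U g. openin (top_of_set T) U \<and> x \<in> U \<and> homeomorphism U (f ` U) f g) \<and>
     (\<forall>x. endpoint T x \<longrightarrow> x \<in> forward_orbit f c) \<and>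
     f c \<noteq> c \<and> (\<exists>m n. m < n \<and> (f ^^ m) c = (f ^^ n) c) \<and>
     (\<forall>x y. x \<noteq> y \<and> (branch_point T x \<or> x \<in> forward_orbit f c) \<and>
             (branch_point T y \<or> y \<in> forward_orbit f c) \<longrightarrow>
        (\<exists>n. c \<in> (f ^^ n) ` tree_arc T x y))"


section \<open>Tame and evil orbits\<close>

definition periodic_branch_orbit :: "'a::t2_space set \<Rightarrow> ('a \<Rightarrow> 'a) \<Rightarrow> 'a set \<Rightarrow> bool" where
  "periodic_branch_orbit T f Q \<longleftrightarrow>
     (\<exists>x n. 0 < n \<and> (f ^^ n) x = x \<and> Q = forward_orbit f x) \<and> (\<forall>x\<in>Q. branch_point T x)"

definition tame_orbit :: "'a::t2_space set \<Rightarrow> ('a \<Rightarrow> 'a) \<Rightarrow> 'a set \<Rightarrow> bool" where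
  "tame_orbit T f Q \<longleftrightarrow> periodic_branch_orbit T f Q \<and>
     (\<forall>a \<in> (\<Union>x\<in>Q. local_arms T x). \<forall>b \<in> (\<Union>x\<in>Q. local_arms T x).
        \<exists>k. (filtermap f ^^ k) a = b)"

definition evil_orbit :: "'a::t2_space set \<Rightarrow> ('a \<Rightarrow> 'a) \<Rightarrow> 'a set \<Rightarrow> bool" where
  "evil_orbit T f Q \<longleftrightarrow> periodic_branch_orbit T f Q \<and> \<not> tame_orbit T f Q"


section \<open>Cyclic order of local arms in the plane\<close>

text \<open>Under an embedding \<^term>\<open>e\<close>, the point \<^term>\<open>u\<close> is where the local arm
  \<^term>\<open>a\<close>, followed outwards from \<^term>\<open>x\<close>, first meets the circle of radius
  \<^term>\<open>r\<close> about \<^term>\<open>e x\<close>. A topologically embedded arm may meet this circle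
  several times, so taking the first hit is essential.\<close>

definition first_exit ::
    "('a::t2_space \<Rightarrow> complex) \<Rightarrow> 'a set \<Rightarrow> 'a \<Rightarrow> real \<Rightarrow> 'a filter \<Rightarrow> 'a \<Rightarrow> bool" where
  "first_exit e T x r a u \<longleftrightarrow>
     (\<exists>A\<in>arms T x. a = at x within A \<and> u \<in> A) \<and>
     dist (e x) (e u) = r \<and> (\<forall>z \<in> tree_arc T x u - {u}. dist (e x) (e z) < r)"

text \<open>Three local arms are in counterclockwise order if their first hits on all sufficiently
  small circles are (the cyclic order of the hits does not depend on the small circle).\<close>

definition arms_ccw ::
    "('a::t2_space \<Rightarrow> complex) \<Rightarrow> 'a set \<Rightarrow> 'a \<Rightarrow> 'a filter \<Rightarrow> 'a filter \<Rightarrow> 'a filter \<Rightarrow> bool" where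
  "arms_ccw e T x a b d \<longleftrightarrow>
     (\<forall>\<^sub>F r in at_right 0. \<exists>u v w \<alpha> \<beta> \<gamma>.
        first_exit e T x r a u \<and> first_exit e T x r b v \<and> first_exit e T x r d w \<and>
        e u = e x + rcis r \<alpha> \<and> e v = e x + rcis r \<beta> \<and> e w = e x + rcis r \<gamma> \<and>
        \<alpha> < \<beta> \<and> \<beta> < \<gamma> \<and> \<gamma> < \<alpha> + 2 * pi)"

definition respects_cyclic_order ::
    "('a::t2_space \<Rightarrow> complex) \<Rightarrow> 'a set \<Rightarrow> ('a \<Rightarrow> 'a) \<Rightarrow> 'a \<Rightarrow> bool" where
  "respects_cyclic_order e T f x \<longleftrightarrow>
     (\<forall>a\<in>local_arms T x. \<forall>b\<in>local_arms T x. \<forall>d\<in>local_arms T x.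
        arms_ccw e T x a b d \<longrightarrow>
        arms_ccw e T (f x) (filtermap f a) (filtermap f b) (filtermap f d))"

end

theory Submission
  imports Defs
begin

text \<open>
  Suppose an embedding respects the cyclic orders. On a periodic orbit of branch points let
  \<open>z\<close> be the characteristic point: it separates the critical value from the critical point
  \<open>c\<close> and from the rest of the orbit. By expansivity every local arm over the orbit
  eventually passes through the arm at \<open>z\<close> towards \<open>c\<close> or the one towards the critical
  value. If these lie on different cycles, the return map fixes the arm towards \<open>c\<close>; a map that
  preserves a cyclic order and fixes an arm is the identity, which leaves no cycle for a third arm.

  Conversely, if all cycles are tame, the local arms over a periodic orbit form one cycle and are
  placed equidistantly on a circle in the order of that cycle; the orders at the remaining branch
  points are pulled back along the injective maps on local arms. Any choice of cyclic orders at the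
  vertices is realised by attaching the edges one by one as short straight segments.

  Both directions need that for an arbitrary topological embedding the cyclic order of first hits
  does not depend on the radius of the small circle. This follows from a continuous choice of the
  argument of the difference of two arcs.
\<close>

section \<open>Arcs in Hausdorff spaces\<close>

text \<open>The dynamics is controlled by one rule: if \<open>c\<close> is not an interior point of
  \<open>seg x p\<close>, then \<open>f\<close> is injective on this arc, since a locally injective
  path in a space without simple loops is injective, and \<tau> turns the direction from
  \<open>x\<close> to \<open>p\<close> into the direction from \<open>f x\<close> to
  \<open>f p\<close>. If \<open>c\<close> does lie strictly between, the direction is also the one
  towards \<open>c\<close>, which goes to the direction towards \<open>f c\<close>. So only the
  positions of \<open>c\<close> and \<open>f c\<close> relative to the orbit matter. That
  \<open>f c\<close> is an endpoint and \<open>c\<close> is not a branch point is derived from the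
  number of arms, which can drop only at \<open>c\<close>, and from the bound on fibres. In the
  plane an arm need not have a tangent and may spiral. Angles are therefore attached to first hits
  only and lifted to continuous functions counted in full turns; the cyclic order then depends only
  on the integer parts of differences of lifts. When an edge is drawn, its far end already receives
  one direction. Directions at a vertex can thus be prescribed only up to a common rotation, which
  does not affect a cyclic order; hence a rotation is carried along for each vertex.\<close>

definition joins :: "'a::t2_space set \<Rightarrow> 'a \<Rightarrow> 'a \<Rightarrow> bool" where
  "joins S a b \<longleftrightarrow> (\<exists>g. arc g \<and> pathstart g = a \<and> pathfinish g = b \<and> path_image g = S)"

lemma arc_restrict:
  fixes g :: "real \<Rightarrow> 'a::t2_space"
  assumes "arc g" "0 \<le> u" "u < v" "v \<le> 1"
  shows "arc (\<lambda>t. g (u + (v - u) * t))" "path_image (\<lambda>t. g (u + (v - u) * t)) = g ` {u..v}"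
proof -
  have *: "(\<lambda>t. u + (v - u) * t) ` {0..1} = {u..v}"
    using image_affinity_atLeastAtMost[of "v - u" u 0 1] assms by (simp add: add.commute)
  then have sub: "(\<lambda>t. u + (v - u) * t) ` {0..1} \<subseteq> {0..1}" using assms by auto
  have cg: "continuous_on {0..1} g" and inj: "inj_on g {0..1}"
    using assms(1) by (auto simp: arc_def path_def)
  have "continuous_on {0..1} (\<lambda>t. g (u + (v - u) * t))"
    by (rule continuous_on_compose2[OF cg _ sub]) (intro continuous_intros)
  moreover have "inj_on (\<lambda>t. g (u + (v - u) * t)) {0..1}"
  proof (rule inj_onI)
    fix s t :: real assume st: "s \<in> {0..1}" "t \<in> {0..1}" "g (u + (v - u) * s) = g (u + (v - u) * t)"
    then have "u + (v - u) * s = u + (v - u) * t" using inj sub by (meson image_subset_iff inj_onD)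
    then show "s = t" using assms by simp
  qed
  ultimately show "arc (\<lambda>t. g (u + (v - u) * t))" by (simp add: arc_def path_def)
  show "path_image (\<lambda>t. g (u + (v - u) * t)) = g ` {u..v}"
    unfolding path_image_def using * by (metis image_image)
qed

lemma arc_interior_point:
  fixes g :: "real \<Rightarrow> 'a::t2_space"
  assumes "arc g" obtains z where "z \<in> path_image g" "z \<noteq> pathstart g" "z \<noteq> pathfinish g"
proof -
  have inj: "inj_on g {0..1}" using assms by (simp add: arc_def)
  have "g (1/2) \<noteq> g 0" "g (1/2) \<noteq> g 1" by (auto dest: inj_onD[OF inj])
  then show ?thesis using that[of "g (1/2)"] by (simp add: path_image_def pathstart_def pathfinish_def)
qed

lemma joins_subarc:
  fixes g :: "real \<Rightarrow> 'a::t2_space"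
  assumes "arc g" "0 \<le> u" "u < v" "v \<le> 1"
  shows "joins (g ` {u..v}) (g u) (g v)"
  unfolding joins_def using arc_restrict[OF assms]
  by (intro exI[of _ "\<lambda>t. g (u + (v - u) * t)"]) (auto simp: pathstart_def pathfinish_def)

lemma joinsE:
  assumes "joins S a b"
  obtains g where "arc g" "g 0 = a" "g 1 = b" "S = g ` {0..1}"
  using assms by (auto simp: joins_def pathstart_def pathfinish_def path_image_def)

lemma joins_sym: "joins S a b \<Longrightarrow> joins S b a"
  unfolding joins_def
  by (metis arc_reversepath path_image_reversepath pathfinish_reversepath pathstart_reversepath)

lemma joins_neq: "joins S a b \<Longrightarrow> a \<noteq> b"
  unfolding joins_def by (metis arc_distinct_ends)

lemma joins_ends: "joins S a b \<Longrightarrow> a \<in> S" "joins S a b \<Longrightarrow> b \<in> S"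
  unfolding joins_def by auto

lemma joins_compact: "joins S a b \<Longrightarrow> compact S"
  unfolding joins_def by (auto simp: compact_arc_image)

lemma joins_connected: "joins S a b \<Longrightarrow> connected S"
  unfolding joins_def by (auto simp: connected_arc_image)

lemma joins_closed: "joins S a b \<Longrightarrow> closed S"
  using joins_compact compact_imp_closed by blast

lemma joins_split:
  assumes "joins S a b" "z \<in> S" "z \<noteq> a" "z \<noteq> b"
  obtains S1 S2 where "joins S1 a z" "joins S2 z b" "S = S1 \<union> S2" "S1 \<inter> S2 = {z}"
proof -
  obtain g where g: "arc g" "g 0 = a" "g 1 = b" "S = g ` {0..1}" using joinsE[OF assms(1)] .
  then obtain t where t: "t \<in> {0..1}" "z = g t" using assms(2) by auto
  then have t01: "0 < t" "t < 1" using assms g by (auto simp: less_le)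
  have inj: "inj_on g {0..1}" using g(1) by (simp add: arc_def)
  show ?thesis
  proof
    show "joins (g ` {0..t}) a z" "joins (g ` {t..1}) z b"
      using joins_subarc[OF g(1), of 0 t] joins_subarc[OF g(1), of t 1] t01 t g by auto
    have "{0..1} = {0..t} \<union> {t..1}" using t01 by auto
    then show "S = g ` {0..t} \<union> g ` {t..1}" using g(4) by (simp add: image_Un)
    have "g ` {0..t} \<inter> g ` {t..1} = g ` ({0..t} \<inter> {t..1})"
      using t01 by (intro inj_on_image_Int[OF inj, symmetric]) auto
    also have "{0..t} \<inter> {t..1} = {t}" using t01 by auto
    finally show "g ` {0..t} \<inter> g ` {t..1} = {z}" using t by simp
  qed
qed

lemma joins_between:
  assumes "joins S a b" "p \<in> S" "q \<in> S" "p \<noteq> q"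
  obtains R where "R \<subseteq> S" "joins R p q"
proof -
  obtain g where g: "arc g" "g 0 = a" "g 1 = b" "S = g ` {0..1}" using joinsE[OF assms(1)] .
  then obtain s t where st: "s \<in> {0..1}" "p = g s" "t \<in> {0..1}" "q = g t" using assms by auto
  have "s < t \<or> t < s" using st assms(4) by (metis linorder_neqE_linordered_idom)
  then show ?thesis
  proof
    assume "s < t"
    then show ?thesis using that[of "g ` {s..t}"] joins_subarc[OF g(1), of s t] st g by force
  next
    assume "t < s"
    then show ?thesis using that[of "g ` {t..s}"] joins_subarc[OF g(1), of t s] st g
      by (force dest: joins_sym)
  qed
qed

lemma joins_concat:
  assumes "joins S1 a b" "joins S2 b d" "S1 \<inter> S2 = {b}"
  shows "joins (S1 \<union> S2) a d"
proof -
  obtain g where g: "arc g" "pathstart g = a" "pathfinish g = b" "path_image g = S1"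
    using assms(1) by (auto simp: joins_def)
  obtain h where h: "arc h" "pathstart h = b" "pathfinish h = d" "path_image h = S2"
    using assms(2) by (auto simp: joins_def)
  have "arc (g +++ h)" using g h assms(3) by (intro arc_join) auto
  moreover have "path_image (g +++ h) = S1 \<union> S2" using g h by (simp add: path_image_join)
  ultimately show ?thesis
    unfolding joins_def using g h by (metis pathfinish_join pathstart_join)
qed

text \<open>Cutting at the first hit leaves a piece that meets \<open>K\<close> in its last point
  only, which is what concatenation with an arc inside \<open>K\<close> requires. The first hit
  exists because the parameters mapped into \<open>K\<close> form a compact set.\<close>

lemma joins_first_hit:
  assumes "joins S a b" "closed K" "a \<notin> K" "S \<inter> K \<noteq> {}"
  obtains p S1 where "p \<in> S \<inter> K" "S1 \<subseteq> S" "joins S1 a p" "S1 \<inter> K = {p}"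
proof -
  obtain g where g: "arc g" "g 0 = a" "g 1 = b" "S = g ` {0..1}" using joinsE[OF assms(1)] .
  have cg: "continuous_on {0..1} g" and inj: "inj_on g {0..1}"
    using g(1) by (auto simp: arc_def path_def)
  define W where "W = {0..1} \<inter> g -` K"
  have "closed W" unfolding W_def using continuous_on_closed_vimage[of "{0..1}" g] cg assms(2) by (auto simp: Int_commute)
  then have "compact W" unfolding W_def by (metis Int_lower1 bounded_subset bounded_closed_interval compact_eq_bounded_closed)
  moreover have "W \<noteq> {}" using assms(4) g by (auto simp: W_def)
  ultimately obtain t where t: "t \<in> W" "\<And>s. s \<in> W \<Longrightarrow> t \<le> s" using compact_attains_inf by metis
  have t01: "0 < t" "t \<le> 1" using t(1) assms(3) g by (auto simp: W_def less_le)
  show ?thesis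
  proof
    show "g t \<in> S \<inter> K" using t g by (auto simp: W_def)
    show "g ` {0..t} \<subseteq> S" using t01 g by auto
    show "joins (g ` {0..t}) a (g t)" using joins_subarc[OF g(1), of 0 t] t01 g by auto
    show "g ` {0..t} \<inter> K = {g t}"
    proof
      show "g ` {0..t} \<inter> K \<subseteq> {g t}"
      proof
        fix y assume "y \<in> g ` {0..t} \<inter> K"
        then obtain s where "s \<in> {0..t}" "y = g s" "g s \<in> K" by auto
        then have "s \<in> W" using t01 by (auto simp: W_def)
        then show "y \<in> {g t}" using t(2) \<open>s \<in> {0..t}\<close> \<open>y = g s\<close> by force
      qed
      show "{g t} \<subseteq> g ` {0..t} \<inter> K" using t t01 by (auto simp: W_def)
    qed
  qed
qed

text \<open>Follow the first arc up to its first hit with the second and continue along the second;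
  the two pieces share only the point where they are glued.\<close>

lemma joins_trans:
  assumes "joins S1 a b" "joins S2 b d" "a \<noteq> d"
  obtains S where "S \<subseteq> S1 \<union> S2" "joins S a d"
proof (cases "a \<in> S2")
  case True
  then show ?thesis using joins_between[OF assms(2), of a d] joins_ends(2)[OF assms(2)] assms(3) that
    by (metis le_supI2)
next
  case False
  have "S1 \<inter> S2 \<noteq> {}" using joins_ends assms by fast
  then obtain p P where p: "p \<in> S1 \<inter> S2" "P \<subseteq> S1" "joins P a p" "P \<inter> S2 = {p}"
    using joins_first_hit[OF assms(1) joins_closed[OF assms(2)] False] by metis
  show ?thesis
  proof (cases "p = d")
    case True
    then show ?thesis using p that[of P] by blast
  next
    case False
    then obtain R where R: "R \<subseteq> S2" "joins R p d"
      using joins_between[OF assms(2), of p d] p joins_ends(2)[OF assms(2)] by blast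
    then have "P \<inter> R = {p}" using p joins_ends(1)[OF R(2)] by auto
    then show ?thesis using joins_concat[OF p(3) R(2)] that[of "P \<union> R"] p R by blast
  qed
qed

lemma joins_loop:
  assumes "joins S a b" "joins S' a b" "S \<inter> S' = {a, b}"
  obtains g where "simple_path g" "pathfinish g = pathstart g" "path_image g = S \<union> S'"
proof -
  obtain g where g: "arc g" "pathstart g = a" "pathfinish g = b" "path_image g = S"
    using assms(1) by (auto simp: joins_def)
  obtain h where h: "arc h" "pathstart h = b" "pathfinish h = a" "path_image h = S'"
    using joins_sym[OF assms(2)] by (auto simp: joins_def)
  have "simple_path (g +++ h)" using g h assms(3) by (intro simple_path_join_loop) auto
  moreover have "path_image (g +++ h) = S \<union> S'" using g h by (simp add: path_image_join)
  ultimately show ?thesis using that[of "g +++ h"] g h by auto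
qed

text \<open>A point \<open>z\<close> of \<open>S\<close> outside \<open>S'\<close> would lie on a
  simple loop: walk along \<open>S\<close> from \<open>z\<close> in both directions up to the first
  hits \<open>p\<close> and \<open>q\<close> with \<open>S'\<close>, then close up along
  \<open>S'\<close>.\<close>

lemma joins_subset_if_no_loop:
  fixes T :: "'a::t2_space set"
  assumes noloop: "\<not> (\<exists>g. simple_path g \<and> pathfinish g = pathstart g \<and> path_image g \<subseteq> T)"
    and S: "joins S a b" "S \<subseteq> T" and S': "joins S' a b" "S' \<subseteq> T"
  shows "S \<subseteq> S'"
proof
  fix z assume zS: "z \<in> S"
  show "z \<in> S'"
  proof (rule ccontr)
    assume z: "z \<notin> S'"
    then have "z \<noteq> a" "z \<noteq> b" using joins_ends[OF S'(1)] by auto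
    then obtain S1 S2 where sp: "joins S1 a z" "joins S2 z b" "S = S1 \<union> S2" "S1 \<inter> S2 = {z}"
      using joins_split[OF S(1) zS] by metis
    note cl = joins_closed[OF S'(1)]
    have "S1 \<inter> S' \<noteq> {}" "S2 \<inter> S' \<noteq> {}"
      using joins_ends[OF S'(1)] joins_ends[OF sp(1)] joins_ends[OF sp(2)] by auto
    then obtain p P q Q where P: "p \<in> S1 \<inter> S'" "P \<subseteq> S1" "joins P z p" "P \<inter> S' = {p}"
      and Q: "q \<in> S2 \<inter> S'" "Q \<subseteq> S2" "joins Q z q" "Q \<inter> S' = {q}"
      using joins_first_hit[OF joins_sym[OF sp(1)] cl z] joins_first_hit[OF sp(2) cl z] by metis
    have "P \<inter> Q = {z}" using P(2) Q(2) sp(4) joins_ends[OF P(3)] joins_ends[OF Q(3)] by auto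
    then have PQ: "joins (P \<union> Q) p q" using joins_concat[OF joins_sym[OF P(3)] Q(3)] by simp
    obtain R where R: "R \<subseteq> S'" "joins R p q"
      using joins_between[OF S'(1), of p q] P Q joins_neq[OF PQ] by blast
    have "(P \<union> Q) \<inter> R = {p, q}" using P(4) Q(4) R(1) joins_ends[OF R(2)] by auto
    then obtain g where "simple_path g" "pathfinish g = pathstart g" "path_image g = (P \<union> Q) \<union> R"
      using joins_loop[OF PQ R(2)] by metis
    moreover have "(P \<union> Q) \<union> R \<subseteq> T" using P(2) Q(2) R(1) sp(3) S(2) S'(2) by auto
    ultimately show False using noloop by metis
  qed
qed

lemma joins_near_start:
  assumes "joins S a b" "open N" "a \<in> N"
  obtains z R where "z \<in> S" "z \<noteq> a" "R \<subseteq> S \<inter> N" "joins R a z"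
proof -
  obtain g where g: "arc g" "g 0 = a" "g 1 = b" "S = g ` {0..1}" using joinsE[OF assms(1)] .
  have cg: "continuous_on {0..1} g" using g(1) by (auto simp: arc_def path_def)
  obtain A where A: "open A" "A \<inter> {0..1} = g -` N \<inter> {0..1}"
    using mp[OF spec[OF cg[unfolded continuous_on_open_invariant]] assms(2)] by (elim exE conjE)
  have "0 \<in> g -` N \<inter> {0..1}" using g(2) assms(3) by simp
  then have "0 \<in> A" using A(2) by blast
  then obtain d where d: "0 < d" "ball 0 d \<subseteq> A" using A(1) by (auto simp: open_contains_ball)
  define t where "t = min 1 (d / 2)"
  have t: "0 < t" "t \<le> 1" "t < d" using d by (auto simp: t_def)
  have "{0..t} \<subseteq> A \<inter> {0..1}" using d(2) t by (force simp: dist_real_def)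
  then have "g ` {0..t} \<subseteq> S \<inter> N" using A(2) g(4) t by auto
  moreover have "joins (g ` {0..t}) a (g t)" using joins_subarc[OF g(1), of 0 t] t g by simp
  moreover have "g t \<in> S" using g t by auto
  ultimately show ?thesis using that joins_neq by metis
qed

lemma joins_image:
  fixes f :: "'a::t2_space \<Rightarrow> 'b::t2_space"
  assumes "joins S a b" "continuous_on S f" "inj_on f S"
  shows "joins (f ` S) (f a) (f b)"
proof -
  obtain g where g: "arc g" "pathstart g = a" "pathfinish g = b" "path_image g = S"
    using assms(1) by (auto simp: joins_def)
  have "arc (f \<circ> g)"
    using g assms(2,3) unfolding arc_def
    by (auto simp: path_continuous_image path_image_def intro: comp_inj_on)
  then show ?thesis
    using g unfolding joins_def by (metis pathfinish_compose pathstart_compose path_image_compose)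
qed

text \<open>On a compact set a continuous injection into a Hausdorff space is a homeomorphism onto
  its image, so germs along the set are transported faithfully.\<close>

lemma filtermap_at_within_compact:
  fixes f :: "'a::t2_space \<Rightarrow> 'b::t2_space"
  assumes S: "compact S" "x \<in> S" and f: "continuous_on S f" "inj_on f S"
  shows "filtermap f (at x within S) = at (f x) within f ` S"
  unfolding filter_eq_iff eventually_filtermap eventually_at_topological
proof (intro allI iffI; elim exE conjE)
  fix P U assume U: "open U" "x \<in> U" "\<forall>y\<in>U. y \<noteq> x \<longrightarrow> y \<in> S \<longrightarrow> P (f y)"
  have "compact (S - U)" using S(1) U(1) by (simp add: compact_diff)
  then have "compact (f ` (S - U))" using f(1) by (meson Diff_subset compact_continuous_image continuous_on_subset)
  then have "open (- f ` (S - U))" using compact_imp_closed by blast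
  moreover have "f x \<in> - f ` (S - U)" using S(2) U(2) f(2) by (auto dest: inj_onD)
  ultimately show "\<exists>W. open W \<and> f x \<in> W \<and> (\<forall>w\<in>W. w \<noteq> f x \<longrightarrow> w \<in> f ` S \<longrightarrow> P w)"
    using U(3) by (intro exI[of _ "- f ` (S - U)"]) auto
next
  fix P W assume W: "open W" "f x \<in> W" "\<forall>w\<in>W. w \<noteq> f x \<longrightarrow> w \<in> f ` S \<longrightarrow> P w"
  obtain A where A: "open A" "A \<inter> S = f -` W \<inter> S"
    using mp[OF spec[OF f(1)[unfolded continuous_on_open_invariant]] W(1)] by (elim exE conjE)
  have "x \<in> A" using A W(2) S(2) by auto
  moreover have "\<forall>y\<in>A. y \<noteq> x \<longrightarrow> y \<in> S \<longrightarrow> P (f y)"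
    using A(2) W(3) f(2) S(2) by (auto dest: inj_onD)
  ultimately show "\<exists>U. open U \<and> x \<in> U \<and> (\<forall>y\<in>U. y \<noteq> x \<longrightarrow> y \<in> S \<longrightarrow> P (f y))"
    using A(1) by blast
qed

section \<open>Trees are uniquely arcwise connected\<close>

text \<open>The definite description \<open>tree_arc\<close> has no meaning for equal ends. Fixing
  the degenerate value to a singleton lets the splitting, triangle and symmetry laws hold for all
  points of the tree.\<close>

definition tree_seg :: "'a::t2_space set \<Rightarrow> 'a \<Rightarrow> 'a \<Rightarrow> 'a set" where
  "tree_seg T x y = (if x = y then {x} else tree_arc T x y)"

text \<open>Membership in an arm is expressed by separation, which is easier to compute with than
  connectedness; \<open>component_arm\<close> identifies the two.\<close>

definition arm_of :: "'a::t2_space set \<Rightarrow> 'a \<Rightarrow> 'a \<Rightarrow> 'a set" where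
  "arm_of T x p = {q \<in> T - {x}. x \<notin> tree_seg T p q}"

definition dir_of :: "'a::t2_space set \<Rightarrow> 'a \<Rightarrow> 'a \<Rightarrow> 'a filter" where
  "dir_of T x p = at x within arm_of T x p"

locale graph_tree =
  fixes T V :: "'a::t2_space set" and E :: "(real \<Rightarrow> 'a) set"
  assumes finV: "finite V" and finE: "finite E"
    and T_eq: "T = V \<union> (\<Union>g\<in>E. path_image g)"
    and edge_arc: "\<And>g. g \<in> E \<Longrightarrow> arc g"
    and edge_V: "\<And>g. g \<in> E \<Longrightarrow> path_image g \<inter> V = {pathstart g, pathfinish g}"
    and edge_edge: "\<And>g h. g \<in> E \<Longrightarrow> h \<in> E \<Longrightarrow> g \<noteq> h \<Longrightarrow> path_image g \<inter> path_image h \<subseteq> V"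
    and T_nonempty: "T \<noteq> {}" and T_connected: "connected T"
    and no_loop: "\<not> (\<exists>g. simple_path g \<and> pathfinish g = pathstart g \<and> path_image g \<subseteq> T)"

lemma tree_graph_tree:
  assumes "tree T" obtains V E where "graph_tree T V E"
proof -
  obtain V E where h: "finite V" "finite E" "T = V \<union> (\<Union>g\<in>E. path_image g)"
       "\<forall>g\<in>E. arc g \<and> path_image g \<inter> V = {pathstart g, pathfinish g}"
       "\<forall>g\<in>E. \<forall>h\<in>E. g \<noteq> h \<longrightarrow> path_image g \<inter> path_image h \<subseteq> V"
    using assms unfolding tree_def finite_topological_graph_def by (elim conjE exE)
  have "graph_tree T V E"
  proof
    show "T \<noteq> {}" "connected T"
      "\<not> (\<exists>g. simple_path g \<and> pathfinish g = pathstart g \<and> path_image g \<subseteq> T)"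
      using assms by (simp_all add: tree_def)
  qed (use h in \<open>simp_all\<close>)
  then show ?thesis using that by blast
qed

context graph_tree
begin

abbreviation "seg \<equiv> tree_seg T"
abbreviation "arm \<equiv> arm_of T"
abbreviation "dir \<equiv> dir_of T"

lemma edge_joins: "g \<in> E \<Longrightarrow> joins (path_image g) (pathstart g) (pathfinish g)"
  using edge_arc unfolding joins_def by blast

lemma edge_closed: "g \<in> E \<Longrightarrow> closed (path_image g)"
  using edge_joins joins_closed by blast

lemma edge_subset: "g \<in> E \<Longrightarrow> path_image g \<subseteq> T"
  using T_eq by auto

lemma V_subset: "V \<subseteq> T"
  using T_eq by auto

lemma edge_ends: "g \<in> E \<Longrightarrow> pathstart g \<in> V" "g \<in> E \<Longrightarrow> pathfinish g \<in> V"
  using edge_V by blast+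

lemma T_compact: "compact T"
proof -
  have "compact (\<Union>g\<in>E. path_image g)"
    using finE edge_arc by (intro compact_UN) (auto simp: compact_arc_image)
  then show ?thesis using T_eq finite_imp_compact[OF finV] by (metis compact_Un)
qed

text \<open>Every edge is either contained in the set \<open>J\<close> of points reachable from
  \<open>x\<close> or disjoint from it. Hence \<open>J\<close> and its complement in
  \<open>T\<close> are finite unions of vertices and closed edges, and connectedness of
  \<open>T\<close> leaves no room for the complement.\<close>

lemma arcwise_connected:
  assumes x: "x \<in> T" and y: "y \<in> T" and "x \<noteq> y"
  shows "\<exists>S\<subseteq>T. joins S x y"
proof -
  define J where "J = {y. y = x \<or> (\<exists>S\<subseteq>T. joins S x y)}"
  have step: "q \<in> J" if h: "p \<in> J" "joins R p q" "R \<subseteq> T" for p q R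
  proof (cases "q = x \<or> p = x")
    case True
    then show ?thesis using h by (auto simp: J_def)
  next
    case False
    then obtain S where "S \<subseteq> T" "joins S x p" using h(1) by (auto simp: J_def)
    then obtain S' where "S' \<subseteq> S \<union> R" "joins S' x q" using joins_trans[of S x p R q] h(2) False by metis
    then show ?thesis using \<open>S \<subseteq> T\<close> h(3) unfolding J_def by blast
  qed
  have edge: "path_image g \<subseteq> J \<or> path_image g \<inter> J = {}" if "g \<in> E" for g
  proof -
    have "q \<in> J" if pq: "p \<in> path_image g" "p \<in> J" "q \<in> path_image g" for p q
    proof (cases "p = q")
      case False
      then obtain R where "R \<subseteq> path_image g" "joins R p q"
        using joins_between[OF edge_joins[OF \<open>g \<in> E\<close>] pq(1,3)] by metis
      then show ?thesis using step[OF pq(2)] edge_subset[OF \<open>g \<in> E\<close>] by blast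
    qed (use pq in simp)
    then show ?thesis by blast
  qed
  define K1 where "K1 = (V \<inter> J) \<union> (\<Union>g\<in>{g\<in>E. path_image g \<subseteq> J}. path_image g)"
  define K2 where "K2 = (V - J) \<union> (\<Union>g\<in>{g\<in>E. path_image g \<inter> J = {}}. path_image g)"
  have "closed K1" "closed K2"
    unfolding K1_def K2_def
    by (rule closed_Un[OF finite_imp_closed closed_UN]; simp add: finV finE edge_closed)+
  moreover have "T \<subseteq> K1 \<union> K2"
  proof
    fix q assume "q \<in> T"
    then consider "q \<in> V" | g where "g \<in> E" "q \<in> path_image g" using T_eq by blast
    then show "q \<in> K1 \<union> K2"
    proof cases
      case 2
      from edge[OF 2(1)] show ?thesis
      proof
        assume "path_image g \<subseteq> J"
        then have "q \<in> K1" using 2 unfolding K1_def by blast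
        then show ?thesis ..
      next
        assume "path_image g \<inter> J = {}"
        then have "q \<in> K2" using 2 unfolding K2_def by blast
        then show ?thesis ..
      qed
    qed (auto simp: K1_def K2_def)
  qed
  moreover have K: "K1 \<subseteq> J" "K2 \<inter> J = {}" by (auto simp: K1_def K2_def)
  then have "K1 \<inter> K2 \<inter> T = {}" by blast
  ultimately have "K1 \<inter> T = {} \<or> K2 \<inter> T = {}"
    using connected_closedD[OF T_connected] by simp
  moreover have "x \<in> J" by (simp add: J_def)
  ultimately have "y \<in> J" using \<open>T \<subseteq> K1 \<union> K2\<close> K x y by blast
  then show ?thesis using assms(3) by (auto simp: J_def)
qed

lemma joins_unique: "joins S a b \<Longrightarrow> S \<subseteq> T \<Longrightarrow> joins S' a b \<Longrightarrow> S' \<subseteq> T \<Longrightarrow> S = S'"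
  using joins_subset_if_no_loop[OF no_loop] by (metis subset_antisym)

section \<open>Calculus of segments in a uniquely arcwise connected space\<close>

lemma seg_eqI:
  assumes "joins S x y" "S \<subseteq> T"
  shows "seg x y = S"
proof -
  have "tree_arc T x y = (THE S. S \<subseteq> T \<and> joins S x y)"
    unfolding tree_arc_def joins_def by (simp add: conj_assoc)
  also have "\<dots> = S" using assms joins_unique by (intro the_equality) blast+
  finally show ?thesis using joins_neq[OF assms(1)] by (simp add: tree_seg_def)
qed

lemma seg_joins:
  assumes "x \<in> T" "y \<in> T" "x \<noteq> y" shows "joins (seg x y) x y"
proof -
  obtain S where S: "S \<subseteq> T" "joins S x y" using arcwise_connected[OF assms] by blast
  show ?thesis using seg_eqI[OF S(2,1)] S(2) by simp
qed

lemma seg_self [simp]: "seg x x = {x}"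
  by (simp add: tree_seg_def)

lemma seg_subset:
  assumes "x \<in> T" "y \<in> T" shows "seg x y \<subseteq> T"
proof (cases "x = y")
  case False
  obtain S where S: "S \<subseteq> T" "joins S x y" using arcwise_connected[OF assms False] by blast
  show ?thesis using seg_eqI[OF S(2,1)] S(1) by simp
qed (use assms in simp)

lemma seg_sym:
  assumes "x \<in> T" "y \<in> T" shows "seg y x = seg x y"
proof (cases "x = y")
  case False
  then show ?thesis using seg_eqI[OF joins_sym[OF seg_joins] seg_subset] assms by metis
qed simp

lemma seg_ends [simp]: "x \<in> T \<Longrightarrow> y \<in> T \<Longrightarrow> x \<in> seg x y" "x \<in> T \<Longrightarrow> y \<in> T \<Longrightarrow> y \<in> seg x y"
  using joins_ends[OF seg_joins[of x y]] by (cases "x = y"; simp)+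

lemma seg_compact: "x \<in> T \<Longrightarrow> y \<in> T \<Longrightarrow> compact (seg x y)"
  using joins_compact[OF seg_joins[of x y]] by (cases "x = y") simp_all

lemma seg_closed: "x \<in> T \<Longrightarrow> y \<in> T \<Longrightarrow> closed (seg x y)"
  using seg_compact compact_imp_closed by blast

lemma seg_connected: "x \<in> T \<Longrightarrow> y \<in> T \<Longrightarrow> connected (seg x y)"
  using joins_connected[OF seg_joins[of x y]] by (cases "x = y") simp_all

lemma seg_subset_seg:
  assumes "x \<in> T" "y \<in> T" "p \<in> seg x y" "q \<in> seg x y"
  shows "seg p q \<subseteq> seg x y"
proof (cases "p = q")
  case False
  then have "x \<noteq> y" using assms by auto
  then obtain R where "R \<subseteq> seg x y" "joins R p q"
    using joins_between[OF seg_joins[OF assms(1,2)] assms(3,4) False] by blast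
  then show ?thesis using seg_eqI seg_subset[OF assms(1,2)] by blast
qed (use assms in simp)

lemma seg_split:
  assumes "x \<in> T" "y \<in> T" "z \<in> seg x y"
  shows "seg x y = seg x z \<union> seg z y" "seg x z \<inter> seg z y = {z}"
proof -
  have "seg x y = seg x z \<union> seg z y \<and> seg x z \<inter> seg z y = {z}"
  proof (cases "z = x \<or> z = y")
    case True
    then show ?thesis using assms(1-2) by (elim disjE) (simp_all add: insert_absorb)
  next
    case False
    then have "x \<noteq> y" using assms by auto
    then obtain S1 S2 where S: "joins S1 x z" "joins S2 z y" "seg x y = S1 \<union> S2" "S1 \<inter> S2 = {z}"
      using joins_split[OF seg_joins[OF assms(1,2)] assms(3)] False by metis
    moreover have "S1 \<subseteq> T" "S2 \<subseteq> T" using S(3) seg_subset[OF assms(1,2)] by auto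
    ultimately show ?thesis using seg_eqI by metis
  qed
  then show "seg x y = seg x z \<union> seg z y" "seg x z \<inter> seg z y = {z}" by auto
qed

lemma seg_triangle:
  assumes "x \<in> T" "y \<in> T" "z \<in> T"
  shows "seg x z \<subseteq> seg x y \<union> seg y z"
proof (cases "x = y \<or> y = z \<or> x = z")
  case True
  then show ?thesis using assms(1-3) by (elim disjE) (simp_all add: subset_insertI)
next
  case False
  then obtain S where "S \<subseteq> seg x y \<union> seg y z" "joins S x z"
    using joins_trans[OF seg_joins[of x y] seg_joins[of y z]] assms by metis
  moreover from this have "S \<subseteq> T" using seg_subset assms by blast
  ultimately show ?thesis using seg_eqI by simp
qed

text \<open>The relation \<open>v \<in> seg x w\<close> is the tree order with root
  \<open>x\<close>. Its antisymmetry turns counting arguments along arcs into the existence of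
  outermost points.\<close>

lemma seg_antisym:
  assumes "x \<in> T" "v \<in> T" "w \<in> T" "v \<in> seg x w" "w \<in> seg x v"
  shows "v = w"
proof -
  have "v \<in> seg w v" using assms by simp
  moreover have "v \<in> seg x w" by fact
  ultimately have "v \<in> seg x w \<inter> seg w v" by blast
  then show ?thesis using seg_split(2)[OF assms(1,2,5)] by blast
qed

lemma seg_concat:
  assumes "x \<in> T" "y \<in> T" "z \<in> T" "seg x y \<inter> seg y z = {y}"
  shows "seg x z = seg x y \<union> seg y z"
proof (cases "x = y \<or> y = z")
  case True
  then show ?thesis using assms(1-3) by (elim disjE) (simp_all add: insert_absorb)
next
  case False
  then have "joins (seg x y \<union> seg y z) x z"
    using joins_concat[OF seg_joins[of x y] seg_joins[of y z]] assms by simp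
  then show ?thesis using seg_eqI seg_subset assms by simp
qed

lemma edge_seg: "g \<in> E \<Longrightarrow> path_image g = seg (pathstart g) (pathfinish g)"
  using seg_eqI[OF edge_joins edge_subset] by simp

text \<open>An edge through \<open>q\<close> is covered by the two arcs that join its ends to
  \<open>x\<close>. So finitely many closed arcs from \<open>x\<close>, one for each vertex, cover
  \<open>T\<close>.\<close>

lemma T_covered:
  assumes "x \<in> T" "q \<in> T"
  obtains v where "v \<in> V" "q \<in> seg x v"
proof (cases "q \<in> V")
  case True
  then show ?thesis using that assms by simp
next
  case False
  then obtain g where g: "g \<in> E" "q \<in> path_image g" using assms T_eq by auto
  note e = edge_ends[OF g(1)] subsetD[OF V_subset]
  have "q \<in> seg (pathstart g) x \<union> seg x (pathfinish g)"
    using edge_seg[OF g(1)] g(2) seg_triangle[of "pathstart g" x "pathfinish g"] e assms by auto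
  then show ?thesis using that e seg_sym assms by (metis Un_iff)
qed

section \<open>Arms\<close>

lemma arm_iff: "q \<in> arm x p \<longleftrightarrow> q \<in> T \<and> q \<noteq> x \<and> x \<notin> seg p q"
  by (auto simp: arm_of_def)

lemma arm_refl: "p \<in> T \<Longrightarrow> p \<noteq> x \<Longrightarrow> p \<in> arm x p"
  by (simp add: arm_iff)

lemma arm_sym: "p \<in> T \<Longrightarrow> p \<noteq> x \<Longrightarrow> q \<in> arm x p \<Longrightarrow> p \<in> arm x q"
  using seg_sym by (auto simp: arm_iff)

lemma arm_trans: "p \<in> T \<Longrightarrow> q \<in> arm x p \<Longrightarrow> r \<in> arm x q \<Longrightarrow> r \<in> arm x p"
  using seg_triangle by (auto simp: arm_iff)

lemma arm_eq: "p \<in> T \<Longrightarrow> p \<noteq> x \<Longrightarrow> q \<in> arm x p \<Longrightarrow> arm x q = arm x p"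
  by (metis arm_iff arm_sym arm_trans subset_antisym subsetI)

lemma arm_disjoint: "p \<in> T \<Longrightarrow> p \<noteq> x \<Longrightarrow> q \<in> T \<Longrightarrow> q \<noteq> x \<Longrightarrow> q \<notin> arm x p \<Longrightarrow> arm x p \<inter> arm x q = {}"
  using arm_eq[of p x] arm_eq[of q x] arm_refl[of q x] by blast

lemma seg_arm:
  assumes "x \<in> T" "p \<in> T" "q \<in> seg x p" "q \<noteq> x"
  shows "q \<in> arm x p"
proof -
  have "q \<in> T" using assms seg_subset by blast
  then show ?thesis
    using seg_split(2)[OF assms(1-3)] assms seg_sym[of q p] by (auto simp: arm_iff)
qed

lemma seg_within_arm:
  assumes "p \<in> T" "p \<noteq> x" "q \<in> arm x p"
  shows "seg p q \<subseteq> arm x p"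
proof
  fix r assume r: "r \<in> seg p q"
  have q: "q \<in> T" "x \<notin> seg p q" using assms by (auto simp: arm_iff)
  have "seg p r \<subseteq> seg p q" using seg_subset_seg[OF assms(1) q(1) _ r] assms(1) q by simp
  then show "r \<in> arm x p" using q r seg_subset[OF assms(1) q(1)] by (auto simp: arm_iff)
qed

lemma arm_connected:
  assumes "p \<in> T" "p \<noteq> x" shows "connected (arm x p)"
proof -
  have q: "q \<in> T" if "q \<in> arm x p" for q using that by (simp add: arm_iff)
  have "arm x p = (\<Union>q\<in>arm x p. seg p q)"
    using seg_within_arm[OF assms] seg_ends(2)[OF assms(1)] q by blast
  moreover have "connected (\<Union>q\<in>arm x p. seg p q)"
  proof (rule connected_Union)
    show "\<And>S. S \<in> seg p ` arm x p \<Longrightarrow> connected S" using seg_connected[OF assms(1)] q by auto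
    have "p \<in> \<Inter> (seg p ` arm x p)" using seg_ends(1)[OF assms(1)] q by auto
    then show "\<Inter> (seg p ` arm x p) \<noteq> {}" by blast
  qed
  ultimately show ?thesis by simp
qed

lemma arm_vertex:
  assumes "x \<in> T" "q \<in> T" "q \<noteq> x"
  obtains v where "v \<in> V" "v \<noteq> x" "q \<in> seg x v" "v \<in> arm x q"
proof -
  obtain v where v: "v \<in> V" "q \<in> seg x v" using T_covered assms by blast
  then have "v \<in> T" "v \<noteq> x" using V_subset assms by auto
  then show ?thesis using that[of v] v seg_arm arm_sym assms by metis
qed

lemma component_arm:
  assumes "x \<in> T" "p \<in> T" "p \<noteq> x"
  shows "connected_component_set (T - {x}) p = arm x p"
proof (rule connected_component_unique)
  show "p \<in> arm x p" "arm x p \<subseteq> T - {x}" "connected (arm x p)"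
    using arm_refl arm_connected assms by (auto simp: arm_iff)
  fix C assume C: "p \<in> C" "C \<subseteq> T - {x}" "connected C"
  define K1 where "K1 = (\<Union>v\<in>V \<inter> arm x p. seg x v)"
  define K2 where "K2 = (\<Union>v\<in>V - arm x p. seg x v)"
  have VT: "\<And>v. v \<in> V \<Longrightarrow> v \<in> T" using V_subset by auto
  have cl: "closed K1" "closed K2"
    unfolding K1_def K2_def using finV seg_closed[OF assms(1)] VT by (intro closed_UN; auto)+
  have K1: "K1 - {x} \<subseteq> arm x p"
  proof
    fix q assume "q \<in> K1 - {x}"
    then obtain v where v: "v \<in> V" "v \<in> arm x p" "q \<in> seg x v" "q \<noteq> x" by (auto simp: K1_def)
    then have "q \<in> arm x v" using seg_arm[OF assms(1) VT] by blast
    then show "q \<in> arm x p" using arm_trans assms(2) v(2) by blast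
  qed
  have K2: "K2 \<inter> arm x p = {}"
  proof (rule ccontr)
    assume "K2 \<inter> arm x p \<noteq> {}"
    then obtain v q where v: "v \<in> V" "v \<notin> arm x p" "q \<in> seg x v" "q \<in> arm x p" by (auto simp: K2_def)
    then have "q \<noteq> x" by (simp add: arm_iff)
    then have "v \<noteq> x" using v assms by auto
    have "q \<in> arm x v" using seg_arm[OF assms(1) VT] v \<open>q \<noteq> x\<close> by blast
    then have "v \<in> arm x q" using arm_sym VT v(1) \<open>v \<noteq> x\<close> by blast
    then show False using arm_trans[OF assms(2) v(4)] v(2) by blast
  qed
  have cov: "T \<subseteq> K1 \<union> K2"
  proof
    fix q assume "q \<in> T"
    then obtain v where "v \<in> V" "q \<in> seg x v" using T_covered[OF assms(1)] by blast
    then show "q \<in> K1 \<union> K2" by (cases "v \<in> arm x p") (auto simp: K1_def K2_def)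
  qed
  then have "C \<subseteq> K1 \<union> K2" using C by auto
  moreover have "K1 \<inter> K2 \<inter> C = {}" using K1 K2 C by blast
  ultimately have "K1 \<inter> C = {} \<or> K2 \<inter> C = {}"
    using connected_closedD[OF C(3)] cl by simp
  moreover have "p \<in> K1" using cov K2 assms arm_refl by blast
  ultimately have "K2 \<inter> C = {}" using C by blast
  then show "C \<subseteq> arm x p" using \<open>C \<subseteq> K1 \<union> K2\<close> K1 C by blast
qed

lemma arms_eq: "x \<in> T \<Longrightarrow> arms T x = arm x ` (T - {x})"
  unfolding arms_def components_def using component_arm by auto

lemma finite_arms: "x \<in> T \<Longrightarrow> finite (arms T x)"
proof -
  assume x: "x \<in> T"
  have "arms T x \<subseteq> arm x ` V"
  proof
    fix A assume "A \<in> arms T x"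
    then obtain p where p: "p \<in> T" "p \<noteq> x" "A = arm x p" using arms_eq[OF x] by auto
    then obtain v where "v \<in> V" "v \<in> arm x p" using arm_vertex[OF x] by metis
    then show "A \<in> arm x ` V" using arm_eq p by blast
  qed
  then show ?thesis using finV finite_subset by blast
qed

text \<open>Among the vertices of the arm take \<open>v\<close> with the most vertices on
  \<open>seg x v\<close>. If an arc from \<open>x\<close> could be continued beyond
  \<open>v\<close>, it would run on to a vertex with a larger count; so all other points lie in one
  arm at \<open>v\<close>. In a Hubbard tree this puts a point of the critical orbit into every
  arm.\<close>

lemma arm_has_endpoint:
  assumes "x \<in> T" "p \<in> T" "p \<noteq> x"
  obtains v where "v \<in> arm x p" "endpoint T v"
proof -
  have VT: "\<And>v. v \<in> V \<Longrightarrow> v \<in> T" using V_subset by auto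
  have "V \<inter> arm x p \<noteq> {}" using arm_vertex[OF assms] by blast
  define F where "F w = card (seg x w \<inter> V)" for w
  have fin: "finite (F ` (V \<inter> arm x p))" using finV by blast
  have "Max (F ` (V \<inter> arm x p)) \<in> F ` (V \<inter> arm x p)"
    using Max_in[OF fin] \<open>V \<inter> arm x p \<noteq> {}\<close> by blast
  then obtain v where v: "v \<in> V" "v \<in> arm x p" "Max (F ` (V \<inter> arm x p)) = F v" by blast
  then have max: "F w \<le> F v" if "w \<in> V \<inter> arm x p" for w
    using Max_ge[OF fin imageI[OF that]] by simp
  have vT: "v \<in> T" "v \<noteq> x" using v by (auto simp: arm_iff)
  have "v \<notin> seg x q" if q: "q \<in> T" "q \<noteq> v" for q
  proof
    assume vq: "v \<in> seg x q"
    obtain w where w: "w \<in> V" "q \<in> seg x w" using T_covered[OF assms(1) q(1)] .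
    have wT: "w \<in> T" using VT w by blast
    have vw: "v \<in> seg x w" using seg_subset_seg[OF assms(1) wT seg_ends(1)[OF assms(1) wT] w(2)] vq by blast
    have "v \<noteq> w" using seg_antisym[OF assms(1) q(1) vT(1)] w vq q by blast
    then have wv: "w \<notin> seg x v" using seg_antisym[OF assms(1) vT(1) wT vw] by blast
    have "v \<in> arm x w" using seg_arm[OF assms(1) wT vw] vT by blast
    moreover have "w \<noteq> x" using vw vT by auto
    ultimately have "w \<in> arm x p" using arm_sym[OF wT] arm_trans[OF assms(2) v(2)] by blast
    moreover have "seg x v \<subset> seg x w"
      using seg_subset_seg[OF assms(1) wT seg_ends(1)[OF assms(1) wT] vw] seg_ends(2)[OF assms(1) wT] wv
      by blast
    then have "card (seg x v \<inter> V) < card (seg x w \<inter> V)"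
      using wv w(1) finV assms(1) wT by (intro psubset_card_mono) auto
    ultimately show False using max[of w] w(1) by (simp add: F_def)
  qed
  then have "arm v q = arm v x" if "q \<in> T - {v}" for q
    using that arm_eq[of x v q] assms(1) vT by (simp add: arm_iff)
  then have "arm v ` (T - {v}) = (\<lambda>q. arm v x) ` (T - {v})" by (rule image_cong[OF refl])
  also have "\<dots> = {arm v x}" using assms(1) vT by (intro image_constant[of x]) simp
  finally have "arms T v = {arm v x}" using arms_eq[OF vT(1)] by simp
  then show ?thesis using that[OF v(2)] vT(1) by (simp add: endpoint_def)
qed

text \<open>The first hit of the arc with the vertices and the other edges is still in
  \<open>g\<close>: up to that point the arc runs inside \<open>g\<close>, and connectedness
  prevents it from jumping off. A common point of \<open>g\<close> with the vertices or the other
  edges is an end of \<open>g\<close>.\<close>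

lemma seg_meets_edge_end:
  assumes "p \<in> T" "x \<notin> V" "x \<in> path_image g" "g \<in> E" "p \<in> V"
  shows "pathstart g \<in> seg x p \<or> pathfinish g \<in> seg x p"
proof -
  have xT: "x \<in> T" using assms edge_subset by blast
  have "x \<noteq> p" using assms by blast
  define K where "K = V \<union> (\<Union>h\<in>E - {g}. path_image h)"
  have clK: "closed K"
    unfolding K_def
    by (rule closed_Un[OF finite_imp_closed closed_UN]) (simp_all add: finV finE edge_closed)
  have inV: "y \<in> V" if y: "y \<in> K" "y \<in> path_image g" for y
  proof (rule ccontr)
    assume "y \<notin> V"
    then obtain h where "h \<in> E" "h \<noteq> g" "y \<in> path_image h" using y(1) by (auto simp: K_def)
    then show False using edge_edge[OF assms(4), of h] y(2) \<open>y \<notin> V\<close> by blast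
  qed
  have xK: "x \<notin> K" using inV assms(2,3) by blast
  have "p \<in> seg x p \<inter> K" using assms xT by (simp add: K_def)
  then have "seg x p \<inter> K \<noteq> {}" by blast
  then obtain z P where z: "z \<in> seg x p \<inter> K" "P \<subseteq> seg x p" "joins P x z" "P \<inter> K = {z}"
    using joins_first_hit[OF seg_joins[OF xT assms(1) \<open>x \<noteq> p\<close>] clK xK] by metis
  have "P \<subseteq> path_image g \<union> K" using z(2) seg_subset[OF xT assms(1)] T_eq by (auto simp: K_def)
  then have cov: "P \<subseteq> path_image g \<union> {z}" using z(4) by blast
  have "z \<in> path_image g"
  proof (rule ccontr)
    assume "z \<notin> path_image g"
    then have "path_image g \<inter> {z} \<inter> P = {}" by auto
    then have "path_image g \<inter> P = {} \<or> {z} \<inter> P = {}"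
      using connected_closedD[OF joins_connected[OF z(3)] _ cov edge_closed[OF assms(4)]] by simp
    then show False using joins_ends[OF z(3)] assms(3) by auto
  qed
  then have "z \<in> V" using z(1) inV by blast
  then have "z \<in> {pathstart g, pathfinish g}" using edge_V[OF assms(4)] \<open>z \<in> path_image g\<close> by blast
  then show ?thesis using z(1) by auto
qed

text \<open>From a point inside an edge every vertex is reached through one of the two ends of this
  edge, which leaves at most two arms.\<close>

lemma branch_point_vertex:
  assumes "branch_point T x" shows "x \<in> V"
proof (rule ccontr)
  assume xV: "x \<notin> V"
  have xT: "x \<in> T" using assms by (simp add: branch_point_def)
  then obtain g where g: "g \<in> E" "x \<in> path_image g" using xV T_eq by auto
  note gV = edge_ends[OF g(1)]
  have "arms T x \<subseteq> {arm x (pathstart g), arm x (pathfinish g)}"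
  proof
    fix A assume "A \<in> arms T x"
    then obtain p where p: "p \<in> T" "p \<noteq> x" "A = arm x p" using arms_eq[OF xT] by auto
    obtain v where v: "v \<in> V" "v \<in> arm x p" by (rule arm_vertex[OF xT p(1,2)])
    then have vT: "v \<in> T" "v \<noteq> x" by (auto simp: arm_iff)
    have "pathstart g \<noteq> x" "pathfinish g \<noteq> x" using gV xV by auto
    then have "pathstart g \<in> arm x v \<or> pathfinish g \<in> arm x v"
      using seg_meets_edge_end[OF vT(1) xV g(2,1) v(1)] seg_arm[OF xT vT(1)] by blast
    then have "A = arm x (pathstart g) \<or> A = arm x (pathfinish g)"
      using arm_eq[OF p(1,2) v(2)] arm_eq[OF vT] p(3) by blast
    then show "A \<in> {arm x (pathstart g), arm x (pathfinish g)}" by blast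
  qed
  then have "card (arms T x) \<le> card {arm x (pathstart g), arm x (pathfinish g)}"
    by (intro card_mono) auto
  also have "\<dots> \<le> 2" by (simp add: card_insert_if)
  finally show False using assms by (simp add: branch_point_def)
qed

lemma finite_branch_points: "finite {x. branch_point T x}"
  by (rule finite_subset[OF _ finV]) (use branch_point_vertex in blast)

section \<open>Local arms\<close>

text \<open>The part of the arm off \<open>seg x p\<close> is covered by the arcs from
  \<open>p\<close> to the finitely many vertices of the arm. These are closed and miss
  \<open>x\<close>, so near \<open>x\<close> the arm is just the arc, and its germ is the germ of
  any arc that leads into it.\<close>

lemma arm_local:
  assumes "x \<in> T" "p \<in> T" "p \<noteq> x"
  obtains N where "open N" "x \<in> N" "N \<inter> arm x p \<subseteq> seg x p"
proof
  have VT: "\<And>v. v \<in> V \<Longrightarrow> v \<in> T" using V_subset by auto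
  define K where "K = (\<Union>v\<in>V \<inter> arm x p. seg p v)"
  have "closed K" unfolding K_def using finV seg_closed[OF assms(2)] VT by (intro closed_UN) auto
  then show "open (- K)" by blast
  show "x \<in> - K" by (auto simp: K_def arm_iff)
  show "- K \<inter> arm x p \<subseteq> seg x p"
  proof
    fix q assume q: "q \<in> - K \<inter> arm x p"
    then have "q \<in> T" "q \<noteq> x" by (auto simp: arm_iff)
    then obtain v where v: "v \<in> V" "q \<in> seg x v" "v \<in> arm x q" using arm_vertex[OF assms(1)] by metis
    then have "v \<in> arm x p" using q arm_trans[OF assms(2)] by blast
    then have "q \<notin> seg p v" using q v by (auto simp: K_def)
    then show "q \<in> seg x p" using v seg_triangle[OF assms(1,2) VT[OF v(1)]] by blast
  qed
qed

lemma seg_near: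
  assumes "x \<in> T" "p \<in> T" "p \<noteq> x" "open N" "x \<in> N"
  obtains z where "z \<in> seg x p" "z \<noteq> x" "seg x z \<subseteq> N"
proof -
  obtain z R where z: "z \<in> seg x p" "z \<noteq> x" "R \<subseteq> seg x p \<inter> N" "joins R x z"
    using joins_near_start[OF seg_joins[OF assms(1,2)] assms(4,5)] assms(3) by metis
  then have "seg x z = R" using seg_eqI seg_subset[OF assms(1,2)] by blast
  then show ?thesis using that z by auto
qed

lemma dir_eq_at_seg:
  assumes "x \<in> T" "p \<in> T" "p \<noteq> x"
  shows "dir x p = at x within seg x p"
proof -
  obtain N where N: "open N" "x \<in> N" "N \<inter> arm x p \<subseteq> seg x p" using arm_local[OF assms] .
  have "arm x p \<inter> N - {x} = seg x p \<inter> N - {x}" using N(3) seg_arm[OF assms(1,2)] by blast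
  then show ?thesis unfolding dir_of_def using at_within_nhd N by metis
qed

lemma dir_nontrivial:
  assumes "x \<in> T" "p \<in> T" "p \<noteq> x" shows "dir x p \<noteq> bot"
proof
  assume "dir x p = bot"
  then have "eventually (\<lambda>_. False) (at x within seg x p)"
    using dir_eq_at_seg[OF assms] by simp
  then obtain N where N: "open N" "x \<in> N" "\<And>y. y \<in> N \<Longrightarrow> y \<noteq> x \<Longrightarrow> y \<notin> seg x p"
    unfolding eventually_at_topological by blast
  then obtain z where "z \<in> seg x p" "z \<noteq> x" "seg x z \<subseteq> N" using seg_near[OF assms N(1,2)] by blast
  moreover have "z \<in> T" using \<open>z \<in> seg x p\<close> seg_subset[OF assms(1,2)] by blast
  ultimately show False using N(3)[of z] seg_ends(2)[OF assms(1)] by blast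
qed

lemma eventually_in_arm:
  assumes "x \<in> T" "p \<in> T" "p \<noteq> x" shows "eventually (\<lambda>y. y \<in> arm x p) (dir x p)"
  unfolding dir_of_def by (auto simp: eventually_at_filter)

text \<open>A germ determines its arm: two different arms are disjoint, and a nontrivial filter
  cannot eventually lie in both.\<close>

lemma dir_eq_iff:
  assumes "x \<in> T" "p \<in> T" "p \<noteq> x" "q \<in> T" "q \<noteq> x"
  shows "dir x p = dir x q \<longleftrightarrow> q \<in> arm x p"
proof
  assume eq: "dir x p = dir x q"
  have "eventually (\<lambda>y. y \<in> arm x p \<inter> arm x q) (dir x p)"
    using eventually_in_arm[OF assms(1-3)] eventually_in_arm[OF assms(1,4,5)] eq
    by (auto intro: eventually_conj)
  then have "arm x p \<inter> arm x q \<noteq> {}"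
    using dir_nontrivial[OF assms(1-3)] by (metis empty_iff eventually_False eventually_mono)
  then show "q \<in> arm x p" using arm_disjoint assms by blast
next
  assume "q \<in> arm x p"
  then show "dir x p = dir x q" using arm_eq[OF assms(2,3)] by (simp add: dir_of_def)
qed

lemma dir_inj_point:
  assumes "x \<in> T" "p \<in> T" "p \<noteq> x" "dir x p = dir y q"
  shows "x = y"
proof -
  have "((\<lambda>z. z) \<longlongrightarrow> x) (dir x p)" "((\<lambda>z. z) \<longlongrightarrow> y) (dir y q)"
    unfolding dir_of_def by (auto intro: tendsto_ident_at)
  then show ?thesis using tendsto_unique[OF dir_nontrivial[OF assms(1-3)]] assms(4) by metis
qed

lemma local_arms_eq: "x \<in> T \<Longrightarrow> local_arms T x = dir x ` (T - {x})"
  by (auto simp: local_arms_def arms_eq dir_of_def)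

lemma finite_local_arms: "x \<in> T \<Longrightarrow> finite (local_arms T x)"
  using finite_arms by (simp add: local_arms_def)

lemma card_local_arms:
  assumes "x \<in> T" shows "card (local_arms T x) = card (arms T x)"
proof -
  have "inj_on (\<lambda>A. at x within A) (arms T x)"
  proof (rule inj_onI)
    fix A B assume AB: "A \<in> arms T x" "B \<in> arms T x" "at x within A = at x within B"
    then obtain p q where p: "p \<in> T" "p \<noteq> x" "A = arm x p" "q \<in> T" "q \<noteq> x" "B = arm x q"
      using arms_eq[OF assms] by auto
    then have "dir x p = dir x q" using AB by (simp add: dir_of_def)
    then show "A = B" using dir_eq_iff assms p arm_eq by metis
  qed
  then show ?thesis by (simp add: local_arms_def card_image)
qed

lemma seg_image:
  assumes "continuous_on T f" "f ` T \<subseteq> T" "x \<in> T" "p \<in> T" "inj_on f (seg x p)"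
  shows "seg (f x) (f p) = f ` seg x p"
proof (cases "x = p")
  case False
  have "joins (f ` seg x p) (f x) (f p)"
    using joins_image[OF seg_joins[OF assms(3,4) False] _ assms(5)] continuous_on_subset[OF assms(1)]
      seg_subset[OF assms(3,4)] by blast
  then show ?thesis using seg_eqI assms(2) seg_subset[OF assms(3,4)] by blast
qed simp

lemma filtermap_dir:
  assumes "continuous_on T f" "f ` T \<subseteq> T" "x \<in> T" "p \<in> T" "p \<noteq> x" "inj_on f (seg x p)"
  shows "filtermap f (dir x p) = dir (f x) (f p)" "f p \<noteq> f x"
proof -
  show ne: "f p \<noteq> f x" using assms(3-6) by (metis inj_onD seg_ends)
  have "filtermap f (at x within seg x p) = at (f x) within f ` seg x p"
    using filtermap_at_within_compact[OF seg_compact[OF assms(3,4)] _ _ assms(6)] assms(3,4)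
      continuous_on_subset[OF assms(1)] seg_subset[OF assms(3,4)] by simp
  also have "f ` seg x p = seg (f x) (f p)" using seg_image assms by metis
  finally show "filtermap f (dir x p) = dir (f x) (f p)"
    using dir_eq_at_seg assms ne by (metis image_subset_iff)
qed

end

section \<open>Locally injective paths in trees\<close>

lemma simple_loop_restrict:
  fixes h :: "real \<Rightarrow> 'a::t2_space"
  assumes "continuous_on {s..t} h" "s < t" "h s = h t"
    and inj: "\<And>u v. s \<le> u \<Longrightarrow> u < v \<Longrightarrow> v \<le> t \<Longrightarrow> h u = h v \<Longrightarrow> u = s \<and> v = t"
  obtains g where "simple_path g" "pathfinish g = pathstart g" "path_image g \<subseteq> h ` {s..t}"
proof
  define g where "g = (\<lambda>r. h (s + (t - s) * r))"
  have mono: "s + (t - s) * r \<in> {s..t}" if "r \<in> {0..1}" for r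
  proof -
    have "0 \<le> (t - s) * r" "(t - s) * r \<le> t - s" using that assms(2) by (auto intro: mult_left_le)
    then show ?thesis by simp
  qed
  have "continuous_on {0..1} g"
    unfolding g_def
    by (rule continuous_on_compose2[OF assms(1)]) (use mono in \<open>auto intro!: continuous_intros\<close>)
  moreover have key: "u = 0 \<and> v = 1" if uv: "u \<in> {0..1}" "v \<in> {0..1}" "u < v" "g u = g v" for u v
  proof -
    have "s + (t - s) * u < s + (t - s) * v" using uv(3) assms(2) by simp
    then have "s + (t - s) * u = s \<and> s + (t - s) * v = t"
      using inj[of "s + (t - s) * u" "s + (t - s) * v"] mono[OF uv(1)] mono[OF uv(2)] uv(4)
      by (simp add: g_def)
    then have "(t - s) * u = 0" "(t - s) * v = t - s" by linarith+
    then show ?thesis using assms(2) by simp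
  qed
  have "loop_free g"
    unfolding loop_free_def
  proof (intro ballI impI)
    fix x y :: real assume "x \<in> {0..1}" "y \<in> {0..1}" "g x = g y"
    then show "x = y \<or> x = 0 \<and> y = 1 \<or> x = 1 \<and> y = 0"
      using key[of x y] key[of y x] by (metis linorder_neqE_linordered_idom)
  qed
  ultimately show "simple_path g" by (simp add: simple_path_def path_def)
  show "pathfinish g = pathstart g" using assms(3) by (simp add: g_def pathstart_def pathfinish_def)
  show "path_image g \<subseteq> h ` {s..t}" using mono by (auto simp: path_image_def g_def)
qed

text \<open>Otherwise the restriction of \<open>h\<close> to the interval, rescaled, would be a
  simple loop in \<open>T\<close>.\<close>

lemma (in graph_tree) coincidence_subinterval:
  fixes h :: "real \<Rightarrow> 'a"
  assumes "continuous_on {s..t} h" "h ` {s..t} \<subseteq> T" "s < t" "h s = h t"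
  obtains u v where "s \<le> u" "u < v" "v \<le> t" "h u = h v" "\<not> (u = s \<and> v = t)"
proof (rule ccontr)
  assume "\<not> thesis"
  then have "\<And>u v. s \<le> u \<Longrightarrow> u < v \<Longrightarrow> v \<le> t \<Longrightarrow> h u = h v \<Longrightarrow> u = s \<and> v = t"
    using that by metis
  then obtain g where "simple_path g" "pathfinish g = pathstart g" "path_image g \<subseteq> h ` {s..t}"
    using simple_loop_restrict[OF assms(1,3,4)] by metis
  then show False using no_loop assms(2) by (meson subset_trans)
qed

text \<open>Two parameters with the same image and minimal distance would bound a simple loop.\<close>

lemma (in graph_tree) locally_injective_interval:
  fixes h :: "real \<Rightarrow> 'a"
  assumes cont: "continuous_on {a..b} h" and sub: "h ` {a..b} \<subseteq> T"
    and loc: "\<And>t. t \<in> {a..b} \<Longrightarrow> \<exists>A. open A \<and> t \<in> A \<and> inj_on h (A \<inter> {a..b})"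
  shows "inj_on h {a..b}"
proof (rule ccontr)
  assume ninj: "\<not> inj_on h {a..b}"
  obtain A where A: "\<And>t. t \<in> {a..b} \<Longrightarrow> open (A t) \<and> t \<in> A t \<and> inj_on h (A t \<inter> {a..b})"
    using loc by metis
  \<comment> \<open>Pairs of parameters in a common injectivity neighbourhood. Removing this open
    set from the coincidences removes the diagonal and leaves a compact set, on which the distance
    attains its minimum.\<close>
  define B where "B = (\<Union>t\<in>{a..b}. A t \<times> A t)"
  define W where "W = {p \<in> {a..b} \<times> {a..b}. h (fst p) = h (snd p)} \<inter> {p. fst p \<le> snd p} \<inter> - B"
  have "open B" unfolding B_def using A by (intro open_UN ballI open_Times) auto
  have c1: "continuous_on ({a..b} \<times> {a..b}) (\<lambda>p. h (fst p))"
    "continuous_on ({a..b} \<times> {a..b}) (\<lambda>p. h (snd p))"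
    by (rule continuous_on_compose2[OF cont]; auto intro!: continuous_intros)+
  have "closed {p \<in> {a..b} \<times> {a..b}. h (fst p) = h (snd p)}"
  proof -
    have "closed (({a..b} \<times> {a..b}) \<inter> (\<lambda>p. (h (fst p), h (snd p))) -` {y. \<exists>z. y = (z, z)})"
    proof (rule continuous_closed_preimage)
      show "continuous_on ({a..b} \<times> {a..b}) (\<lambda>p. (h (fst p), h (snd p)))"
        using c1 by (rule continuous_on_Pair)
      show "closed ({a..b} \<times> {a..b})" by (intro closed_Times) auto
      show "closed {y :: 'a \<times> 'a. \<exists>z. y = (z, z)}" by (rule closed_diagonal)
    qed
    also have "({a..b} \<times> {a..b}) \<inter> (\<lambda>p. (h (fst p), h (snd p))) -` {y. \<exists>z. y = (z, z)}
      = {p \<in> {a..b} \<times> {a..b}. h (fst p) = h (snd p)}" by auto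
    finally show ?thesis .
  qed
  moreover have "closed {p :: real \<times> real. fst p \<le> snd p}"
    by (intro closed_Collect_le continuous_intros)
  ultimately have "closed W" unfolding W_def using \<open>open B\<close> by (intro closed_Int) auto
  moreover have "W \<subseteq> {a..b} \<times> {a..b}" by (auto simp: W_def)
  ultimately have cW: "compact W"
    by (metis compact_Times compact_Icc compact_Int_closed inf.absorb_iff2)
  have W: "(u, v) \<in> W" if "a \<le> u" "u < v" "v \<le> b" "h u = h v" for u v
  proof -
    have "(u, v) \<notin> B"
    proof
      assume "(u, v) \<in> B"
      then obtain t where t: "t \<in> {a..b}" "u \<in> A t" "v \<in> A t" by (auto simp: B_def)
      then have "inj_on h (A t \<inter> {a..b})" using A by blast
      then have "u = v" using t that by (auto dest: inj_onD)
      then show False using that by simp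
    qed
    then show ?thesis using that by (simp add: W_def)
  qed
  have WD: "a \<le> u \<and> u < v \<and> v \<le> b \<and> h u = h v" if "(u, v) \<in> W" for u v
  proof -
    have "u \<noteq> v"
    proof
      assume "u = v"
      then have "(u, v) \<in> A u \<times> A u" "u \<in> {a..b}" using A that by (auto simp: W_def)
      then have "(u, v) \<in> B" unfolding B_def by blast
      then show False using that by (simp add: W_def)
    qed
    then show ?thesis using that by (auto simp: W_def)
  qed
  obtain u v where "u \<in> {a..b}" "v \<in> {a..b}" "h u = h v" "u \<noteq> v" using ninj by (auto simp: inj_on_def)
  then have "(u, v) \<in> W \<or> (v, u) \<in> W" using W[of u v] W[of v u] by (cases "u < v") auto
  then have "W \<noteq> {}" by auto
  moreover have "continuous_on W (\<lambda>p. snd p - fst p)" by (intro continuous_intros)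
  ultimately obtain p where p: "p \<in> W" "\<And>q. q \<in> W \<Longrightarrow> snd p - fst p \<le> snd q - fst q"
    using continuous_attains_inf[OF cW, of "\<lambda>p. snd p - fst p"] by blast
  obtain s t where st: "p = (s, t)" by (cases p)
  have 1: "a \<le> s" "s < t" "t \<le> b" "h s = h t" using WD p(1) st by auto
  have "{s..t} \<subseteq> {a..b}" using 1 by auto
  then obtain u v where uv: "s \<le> u" "u < v" "v \<le> t" "h u = h v" "\<not> (u = s \<and> v = t)"
    using coincidence_subinterval[OF continuous_on_subset[OF cont] _ 1(2,4)] sub
    by (metis image_mono subset_trans)
  then have "(u, v) \<in> W" using W[of u v] 1 by simp
  then have "t - s \<le> v - u" using p(2)[of "(u, v)"] st by simp
  then show False using uv by auto
qed

text \<open>Local injectivity is asked at interior parameters only, because the critical point may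
  sit at an end. A coincidence of an end with an interior parameter contains a strictly smaller one,
  which again involves that end once interior coincidences are excluded; together they give an
  interior coincidence after all. The two ends are compared last.\<close>

lemma (in graph_tree) locally_injective_path:
  fixes h :: "real \<Rightarrow> 'a"
  assumes cont: "continuous_on {0..1} h" and sub: "h ` {0..1} \<subseteq> T"
    and loc: "\<And>t. t \<in> {0<..<1} \<Longrightarrow> \<exists>A. open A \<and> t \<in> A \<and> inj_on h (A \<inter> {0..1})"
  shows "inj_on h {0..1}"
proof -
  have in1: "h u \<noteq> h v" if uv: "0 < u" "u < v" "v < 1" for u v
  proof -
    have "inj_on h {u..v}"
    proof (rule locally_injective_interval)
      have s: "{u..v} \<subseteq> {0..1}" using uv by auto
      show "continuous_on {u..v} h" using cont s continuous_on_subset by blast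
      show "h ` {u..v} \<subseteq> T" using sub s by blast
      fix t assume "t \<in> {u..v}"
      then obtain A where "open A" "t \<in> A" "inj_on h (A \<inter> {0..1})" using loc[of t] uv by auto
      moreover have "A \<inter> {u..v} \<subseteq> A \<inter> {0..1}" using s by blast
      ultimately show "\<exists>A. open A \<and> t \<in> A \<and> inj_on h (A \<inter> {u..v})" using inj_on_subset by blast
    qed
    then show ?thesis using uv by (auto dest: inj_onD)
  qed
  have co: "\<exists>u v. s \<le> u \<and> u < v \<and> v \<le> t \<and> h u = h v \<and> \<not> (u = s \<and> v = t)"
    if st: "0 \<le> s" "s < t" "t \<le> 1" "h s = h t" for s t
  proof -
    have s: "{s..t} \<subseteq> {0..1}" using st by auto
    then have "continuous_on {s..t} h" "h ` {s..t} \<subseteq> T" using cont sub continuous_on_subset by blast+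
    then show ?thesis using coincidence_subinterval[OF _ _ st(2,4)] by metis
  qed
  have in2: "h u \<noteq> h 1" if u: "0 < u" "u < 1" for u
  proof
    assume eq: "h u = h 1"
    obtain u' v where h: "u \<le> u'" "u' < v" "v \<le> 1" "h u' = h v" "\<not> (u' = u \<and> v = 1)"
      using co[of u 1] u eq by auto
    have "v = 1" using in1[of u' v] h u by (cases "v < 1") auto
    then have "h u = h u'" "u < u'" using h eq by auto
    then show False using in1[of u u'] u h \<open>v = 1\<close> by auto
  qed
  have in3: "h 0 \<noteq> h v" if v: "0 < v" "v < 1" for v
  proof
    assume eq: "h 0 = h v"
    obtain u v' where h: "0 \<le> u" "u < v'" "v' \<le> v" "h u = h v'" "\<not> (u = 0 \<and> v' = v)"
      using co[of 0 v] v eq by auto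
    have "u = 0" using in1[of u v'] h v by (cases "0 < u") auto
    then have "h v' = h v" "v' < v" using h eq by auto
    then show False using in1[of v' v] v h \<open>u = 0\<close> by auto
  qed
  have in4: "h 0 \<noteq> h 1"
  proof
    assume eq: "h 0 = h 1"
    obtain u v where h: "0 \<le> u" "u < v" "v \<le> 1" "h u = h v" "\<not> (u = 0 \<and> v = 1)"
      using co[of 0 1] eq by auto
    show False using in1[of u v] in2[of u] in3[of v] h by (cases "u = 0"; cases "v = 1") auto
  qed
  have "h u \<noteq> h v" if "0 \<le> u" "u < v" "v \<le> 1" for u v
    using in1[of u v] in2[of u] in3[of v] in4 that by (cases "u = 0"; cases "v = 1") auto
  then show ?thesis unfolding inj_on_def by (metis atLeastAtMost_iff linorder_neqE_linordered_idom)
qed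

section \<open>Dynamics on local arms\<close>

locale hubbard_graph = graph_tree T V E for T V :: "'a::t2_space set" and E +
  fixes f :: "'a \<Rightarrow> 'a" and c :: 'a
  assumes cT: "c \<in> T" and contf: "continuous_on T f" and surjf: "f ` T = T"
    and fibre: "\<And>y. y \<in> T \<Longrightarrow> finite {x\<in>T. f x = y} \<and> card {x\<in>T. f x = y} \<le> 2"
    and locinj: "\<And>x. x \<in> T \<Longrightarrow> x \<noteq> c \<Longrightarrow> \<exists>U. open U \<and> x \<in> U \<and> inj_on f (U \<inter> T)"
    and endpoint_orbit: "\<And>x. endpoint T x \<Longrightarrow> x \<in> forward_orbit f c"
    and fc: "f c \<noteq> c"
    and expansive: "\<And>x y. x \<noteq> y \<Longrightarrow> branch_point T x \<Longrightarrow> y \<in> forward_orbit f c \<Longrightarrow>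
      \<exists>n. c \<in> (f ^^ n) ` tree_arc T x y"

lemma hubbard_tree_graph:
  assumes "hubbard_tree T f c" obtains V E where "hubbard_graph T V E f c"
proof -
  have "tree T" using assms by (simp add: hubbard_tree_def)
  then obtain V E where g: "graph_tree T V E" by (rule tree_graph_tree)
  have "hubbard_graph T V E f c"
  proof (rule hubbard_graph.intro[OF g hubbard_graph_axioms.intro])
    show "c \<in> T" "continuous_on T f" "f ` T = T" "f c \<noteq> c"
      using assms by (simp_all add: hubbard_tree_def)
    show "finite {x\<in>T. f x = y} \<and> card {x\<in>T. f x = y} \<le> 2" if "y \<in> T" for y
      using assms that by (simp add: hubbard_tree_def)
    show "x \<in> forward_orbit f c" if "endpoint T x" for x
      using assms that by (simp add: hubbard_tree_def)
    show "\<exists>n. c \<in> (f ^^ n) ` tree_arc T x y"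
      if "x \<noteq> y" "branch_point T x" "y \<in> forward_orbit f c" for x y
      using assms that by (simp add: hubbard_tree_def)
    fix x assume x: "x \<in> T" "x \<noteq> c"
    have "\<forall>x\<in>T - {c}. \<exists>U g. openin (top_of_set T) U \<and> x \<in> U \<and> homeomorphism U (f ` U) f g"
      using assms by (simp add: hubbard_tree_def)
    then obtain U g where U: "openin (top_of_set T) U" "x \<in> U" "homeomorphism U (f ` U) f g"
      using x by blast
    have "inj_on f U" using U(3) by (intro inj_on_inverseI[of _ g]) (simp add: homeomorphism_def)
    moreover obtain W where "open W" "U = T \<inter> W" using U(1) by (auto simp: openin_open)
    ultimately show "\<exists>U. open U \<and> x \<in> U \<and> inj_on f (U \<inter> T)"
      using U(2) by (intro exI[of _ W]) (simp add: Int_commute)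
  qed
  then show ?thesis using that by blast
qed

lemma card_ge_3_obtain:
  assumes "3 \<le> card A"
  obtains a b d where "a \<in> A" "b \<in> A" "d \<in> A" "a \<noteq> b" "a \<noteq> d" "b \<noteq> d"
proof -
  obtain B where "B \<subseteq> A" "card B = 3" using obtain_subset_with_card_n[OF assms] by metis
  then show ?thesis using that unfolding card_3_iff by blast
qed

lemma (in graph_tree) branch_point_T: "branch_point T x \<Longrightarrow> x \<in> T"
  by (simp add: branch_point_def)

lemma (in graph_tree) local_arms_dirE:
  assumes "x \<in> T" "a \<in> local_arms T x"
  obtains p where "p \<in> T" "p \<noteq> x" "a = dir x p"
  using assms local_arms_eq by auto

lemma (in graph_tree) dir_local_arms: "x \<in> T \<Longrightarrow> p \<in> T \<Longrightarrow> p \<noteq> x \<Longrightarrow> dir x p \<in> local_arms T x"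
  using local_arms_eq by auto

lemma (in graph_tree) local_arms_point:
  assumes "x \<in> T" "y \<in> T" "a \<in> local_arms T x" "a \<in> local_arms T y" shows "x = y"
proof -
  obtain p where p: "p \<in> T" "p \<noteq> x" "a = dir x p" using local_arms_dirE[OF assms(1,3)] .
  obtain q where "a = dir y q" using local_arms_dirE[OF assms(2,4)] .
  then show ?thesis using dir_inj_point[OF assms(1) p(1,2)] p(3) by simp
qed

lemma (in graph_tree) branch_three:
  assumes "branch_point T x"
  obtains p q r where "p \<in> T - {x}" "q \<in> T - {x}" "r \<in> T - {x}"
    "q \<notin> arm x p" "r \<notin> arm x p" "r \<notin> arm x q"
proof -
  have x: "x \<in> T" "3 \<le> card (local_arms T x)"
    using assms card_local_arms by (simp_all add: branch_point_def)
  then obtain a b d where a: "a \<in> local_arms T x" "b \<in> local_arms T x" "d \<in> local_arms T x"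
    "a \<noteq> b" "a \<noteq> d" "b \<noteq> d" using card_ge_3_obtain by metis
  obtain p where p: "p \<in> T" "p \<noteq> x" "a = dir x p" using local_arms_dirE[OF x(1) a(1)] .
  obtain q where q: "q \<in> T" "q \<noteq> x" "b = dir x q" using local_arms_dirE[OF x(1) a(2)] .
  obtain r where r: "r \<in> T" "r \<noteq> x" "d = dir x r" using local_arms_dirE[OF x(1) a(3)] .
  show ?thesis
    using that[of p q r] p q r a(4-6) dir_eq_iff[OF x(1) p(1,2) q(1,2)]
      dir_eq_iff[OF x(1) p(1,2) r(1,2)] dir_eq_iff[OF x(1) q(1,2) r(1,2)] by blast
qed

context hubbard_graph
begin

abbreviation "\<tau> \<equiv> filtermap f"

lemma fT: "x \<in> T \<Longrightarrow> f x \<in> T"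
  using surjf by blast

lemma fT_sub: "f ` T \<subseteq> T"
  using surjf by simp

lemma funpow_T: "x \<in> T \<Longrightarrow> (f ^^ k) x \<in> T"
  by (induction k) (auto simp: fT)

lemma c1_T: "f c \<in> T"
  using fT cT .

text \<open>Composing \<open>f\<close> with a parametrisation of the arc gives a path in
  \<open>T\<close> that is locally injective at all interior parameters, since the critical point
  can only be an end.\<close>

lemma inj_on_seg:
  assumes "x \<in> T" "p \<in> T" "c \<notin> seg x p - {x, p}"
  shows "inj_on f (seg x p)"
proof (cases "x = p")
  case False
  obtain g where g: "arc g" "g 0 = x" "g 1 = p" "seg x p = g ` {0..1}"
    using joinsE[OF seg_joins[OF assms(1,2) False]] .
  have gT: "g ` {0..1} \<subseteq> T" using g(4) seg_subset[OF assms(1,2)] by simp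
  have cg: "continuous_on {0..1} g" and inj: "inj_on g {0..1}"
    using g(1) by (auto simp: arc_def path_def)
  have "inj_on (f \<circ> g) {0..1}"
  proof (rule locally_injective_path)
    show "continuous_on {0..1} (f \<circ> g)"
      using continuous_on_compose[OF cg continuous_on_subset[OF contf gT]] .
    show "(f \<circ> g) ` {0..1} \<subseteq> T" using gT fT by auto
    fix t :: real assume t: "t \<in> {0<..<1}"
    then have "g t \<noteq> g 0" "g t \<noteq> g 1" using inj by (auto dest: inj_onD)
    then have "g t \<noteq> x" "g t \<noteq> p" using g(2,3) by simp_all
    moreover have "g t \<in> seg x p" using g(4) t by simp
    ultimately have "g t \<in> seg x p - {x, p}" by simp
    then have "g t \<noteq> c" using assms(3) by metis
    then obtain U where U: "open U" "g t \<in> U" "inj_on f (U \<inter> T)"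
      using locinj[OF subsetD[OF gT imageI] \<open>g t \<noteq> c\<close>] t by auto
    obtain A where A: "open A" "A \<inter> {0..1} = g -` U \<inter> {0..1}"
      using mp[OF spec[OF cg[unfolded continuous_on_open_invariant]] U(1)] by (elim exE conjE)
    have "t \<in> g -` U \<inter> {0..1}" using t U(2) by simp
    then have "t \<in> A" using A(2) by blast
    moreover have "g ` (A \<inter> {0..1}) \<subseteq> U \<inter> T" using A(2) gT by blast
    then have "inj_on (f \<circ> g) (A \<inter> {0..1})"
      by (intro comp_inj_on inj_on_subset[OF inj] inj_on_subset[OF U(3)]) simp_all
    ultimately show "\<exists>A. open A \<and> t \<in> A \<and> inj_on (f \<circ> g) (A \<inter> {0..1})" using A(1) by blast
  qed
  then show ?thesis using g(4) by (simp add: inj_on_imageI)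
qed simp

lemma tau_dir:
  assumes "x \<in> T" "p \<in> T" "p \<noteq> x" "c \<notin> seg x p - {x, p}"
  shows "\<tau> (dir x p) = dir (f x) (f p)" "f p \<noteq> f x" "seg (f x) (f p) = f ` seg x p"
  using filtermap_dir[OF contf fT_sub assms(1-3) inj_on_seg[OF assms(1,2,4)]]
    seg_image[OF contf fT_sub assms(1,2) inj_on_seg[OF assms(1,2,4)]] by simp_all

lemma tau_dir_c:
  assumes "x \<in> T" "x \<noteq> c"
  shows "\<tau> (dir x c) = dir (f x) (f c)" "f c \<noteq> f x"
  using tau_dir[OF assms(1) cT] assms(2) by simp_all

lemma tau_local_arms:
  assumes "x \<in> T" "a \<in> local_arms T x" shows "\<tau> a \<in> local_arms T (f x)"
proof -
  obtain p where p: "p \<in> T" "p \<noteq> x" "a = dir x p" using local_arms_dirE[OF assms] .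
  \<comment> \<open>Shorten the arc until \<open>c\<close> is not inside it; the direction does not
    change. For \<open>x = c\<close> the critical point is already an end.\<close>
  obtain z where z: "z \<in> seg x p" "z \<noteq> x" "c \<notin> seg x z - {x, z}"
  proof (cases "x = c")
    case True
    then show ?thesis using that[of p] p assms(1) by simp
  next
    case False
    then obtain z where "z \<in> seg x p" "z \<noteq> x" "seg x z \<subseteq> - {c}"
      using seg_near[OF assms(1) p(1,2), of "- {c}"] by auto
    then show ?thesis using that[of z] by blast
  qed
  have zT: "z \<in> T" using z(1) seg_subset[OF assms(1) p(1)] by blast
  have "a = dir x z" using dir_eq_iff[OF assms(1) p(1,2) zT z(2)] seg_arm[OF assms(1) p(1) z(1,2)] p(3) by simp
  then show ?thesis using tau_dir[OF assms(1) zT z(2,3)] dir_local_arms[OF fT fT] assms(1) zT by simp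
qed

text \<open>Represent both arms by arcs inside a neighbourhood where \<open>f\<close> is injective.
  If the arms differ, \<open>x\<close> lies between their far ends, so by injectivity
  \<open>f x\<close> lies between the images, and the image directions differ.\<close>

lemma tau_inj:
  assumes x: "x \<in> T" "x \<noteq> c" shows "inj_on \<tau> (local_arms T x)"
proof (rule inj_onI, rule ccontr)
  fix a b assume ab: "a \<in> local_arms T x" "b \<in> local_arms T x" "\<tau> a = \<tau> b" "a \<noteq> b"
  obtain U where U: "open U" "x \<in> U" "inj_on f (U \<inter> T)" using locinj[OF x] by blast
  have near: "\<exists>z. z \<in> T \<and> z \<noteq> x \<and> a = dir x z \<and> seg x z \<subseteq> U" if a: "a \<in> local_arms T x" for a
  proof -
    obtain p where p: "p \<in> T" "p \<noteq> x" "a = dir x p" using local_arms_dirE[OF x(1) a] .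
    obtain z where z: "z \<in> seg x p" "z \<noteq> x" "seg x z \<subseteq> U" using seg_near[OF x(1) p(1,2) U(1,2)] .
    have zT: "z \<in> T" using z(1) seg_subset[OF x(1) p(1)] by blast
    then have "a = dir x z"
      using dir_eq_iff[OF x(1) p(1,2) zT z(2)] seg_arm[OF x(1) p(1) z(1,2)] p(3) by simp
    then show ?thesis using z zT by blast
  qed
  obtain z where z: "z \<in> T" "z \<noteq> x" "a = dir x z" "seg x z \<subseteq> U" using near[OF ab(1)] by blast
  obtain w where w: "w \<in> T" "w \<noteq> x" "b = dir x w" "seg x w \<subseteq> U" using near[OF ab(2)] by blast
  have "w \<notin> arm x z" using dir_eq_iff[OF x(1) z(1,2) w(1,2)] ab(4) z(3) w(3) by simp
  then have xs: "x \<in> seg z w" using w by (simp add: arm_iff)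
  have "seg z w \<subseteq> U \<inter> T"
    using seg_split(1)[OF z(1) w(1) xs] seg_sym[OF x(1) z(1)] z(4) w(4) seg_subset[OF z(1) w(1)] by simp
  then have inj: "inj_on f (seg z w)" using U(3) inj_on_subset by blast
  have sub: "seg x z \<subseteq> U \<inter> T" "seg x w \<subseteq> U \<inter> T"
    using z w seg_subset[OF x(1)] by simp_all
  have d: "\<tau> a = dir (f x) (f z)" "f z \<noteq> f x" "\<tau> b = dir (f x) (f w)" "f w \<noteq> f x"
    using filtermap_dir[OF contf fT_sub x(1) z(1,2) inj_on_subset[OF U(3) sub(1)]]
      filtermap_dir[OF contf fT_sub x(1) w(1,2) inj_on_subset[OF U(3) sub(2)]] z(3) w(3) by simp_all
  have "f x \<in> seg (f z) (f w)" using seg_image[OF contf fT_sub z(1) w(1) inj] xs by simp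
  then have "f w \<notin> arm (f x) (f z)" by (simp add: arm_iff)
  then show False using dir_eq_iff[OF fT[OF x(1)] fT[OF z(1)] d(2) fT[OF w(1)] d(4)] d ab(3) by simp
qed

section \<open>Number of arms along orbits, critical value and critical point\<close>

lemma card_arms_mono:
  assumes "x \<in> T" "x \<noteq> c" shows "card (arms T x) \<le> card (arms T (f x))"
proof -
  have "card (local_arms T x) \<le> card (local_arms T (f x))"
    using tau_local_arms[OF assms(1)] finite_local_arms[OF fT[OF assms(1)]]
    by (intro card_inj_on_le[OF tau_inj[OF assms]]) auto
  then show ?thesis using card_local_arms assms fT by simp
qed

lemma card_arms_pos:
  assumes "x \<in> T" shows "0 < card (arms T x)"
proof -
  have "T - {x} \<noteq> {}" using fc cT c1_T by blast
  then show ?thesis using finite_arms[OF assms] arms_eq[OF assms] by (simp add: card_gt_0_iff)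
qed

text \<open>Some endpoint other than \<open>c\<close> lies on the critical orbit, at a positive
  time. Going back along the orbit the number of arms cannot grow, so the earlier points are
  endpoints too, until \<open>f c\<close> is reached; a passage through \<open>c\<close> only means
  that the next point is \<open>f c\<close> itself.\<close>

lemma critical_value_endpoint: "endpoint T (f c)"
proof -
  have ind: "endpoint T ((f ^^ Suc k) c) \<Longrightarrow> endpoint T (f c)" for k
  proof (induction k)
    case (Suc k)
    define y where "y = (f ^^ Suc k) c"
    have yT: "y \<in> T" using funpow_T[OF cT] by (simp only: y_def)
    have fy: "endpoint T (f y)" using Suc.prems by (simp add: y_def)
    show ?case
    proof (cases "y = c")
      case True
      then show ?thesis using fy by simp
    next
      case False
      then have "card (arms T y) = 1"
        using card_arms_mono[OF yT] card_arms_pos[OF yT] fy by (simp add: endpoint_def)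
      then show ?thesis using Suc.IH yT by (simp add: endpoint_def y_def)
    qed
  qed simp
  obtain v where v: "v \<in> arm c (f c)" "endpoint T v" using arm_has_endpoint[OF cT c1_T fc] .
  then obtain k where k: "v = (f ^^ k) c" using endpoint_orbit by (auto simp: forward_orbit_def)
  have "v \<noteq> c" using v(1) by (simp add: arm_iff)
  then have "k \<noteq> 0" using k by (cases k) simp_all
  then show ?thesis using ind[of "k - 1"] v(2) k by simp
qed

text \<open>All arms at \<open>c\<close> are mapped into the single arm at the endpoint
  \<open>f c\<close>. Three of them would have images that share an initial piece at
  \<open>f c\<close>, so a point of this piece would have three preimages.\<close>

lemma critical_not_branch: "\<not> branch_point T c"
proof
  assume "branch_point T c"
  then obtain p q r where pqr: "p \<in> T - {c}" "q \<in> T - {c}" "r \<in> T - {c}"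
    "q \<notin> arm c p" "r \<notin> arm c p" "r \<notin> arm c q" by (rule branch_three)
  have one: "arms T (f c) = arm (f c) ` (T - {f c})" using arms_eq[OF c1_T] .
  have same: "arm (f c) u = arm (f c) w" if "u \<in> T - {f c}" "w \<in> T - {f c}" for u w
  proof -
    have "card (arms T (f c)) = 1" using critical_value_endpoint by (simp add: endpoint_def)
    then obtain A where "arms T (f c) = {A}" by (auto simp: card_1_singleton_iff)
    then show ?thesis using one that by blast
  qed
  have ne: "f u \<in> T - {f c}" "seg (f c) (f u) = f ` seg c u" if "u \<in> T - {c}" for u
    using tau_dir[OF cT, of u] that fT by auto
  have loc: "\<exists>N. open N \<and> f c \<in> N \<and> N \<inter> arm (f c) (f p) \<subseteq> seg (f c) (f u)" if u: "u \<in> T - {c}" for u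
  proof -
    have fu: "f u \<in> T" "f u \<noteq> f c" using ne(1)[OF u] by auto
    obtain N where "open N" "f c \<in> N" "N \<inter> arm (f c) (f u) \<subseteq> seg (f c) (f u)"
      using arm_local[OF c1_T fu] .
    then show ?thesis using same[OF ne(1)[OF u] ne(1)[OF pqr(1)]] by auto
  qed
  obtain N1 where N1: "open N1" "f c \<in> N1" "N1 \<inter> arm (f c) (f p) \<subseteq> seg (f c) (f p)" using loc[OF pqr(1)] by blast
  obtain N2 where N2: "open N2" "f c \<in> N2" "N2 \<inter> arm (f c) (f p) \<subseteq> seg (f c) (f q)" using loc[OF pqr(2)] by blast
  obtain N3 where N3: "open N3" "f c \<in> N3" "N3 \<inter> arm (f c) (f p) \<subseteq> seg (f c) (f r)" using loc[OF pqr(3)] by blast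
  have fp: "f p \<in> T" "f p \<noteq> f c" using ne(1)[OF pqr(1)] by auto
  have "open (N1 \<inter> N2 \<inter> N3)" "f c \<in> N1 \<inter> N2 \<inter> N3" using N1 N2 N3 by auto
  then obtain z where z: "z \<in> seg (f c) (f p)" "z \<noteq> f c" "seg (f c) z \<subseteq> N1 \<inter> N2 \<inter> N3"
    using seg_near[OF c1_T fp] by blast
  have zT: "z \<in> T" using z(1) seg_subset[OF c1_T fp(1)] by blast
  have za: "z \<in> arm (f c) (f p)" using seg_arm[OF c1_T fp(1) z(1,2)] .
  have "z \<in> N1 \<inter> N2 \<inter> N3" using z(3) seg_ends(2)[OF c1_T zT] by blast
  then have "z \<in> seg (f c) (f p)" "z \<in> seg (f c) (f q)" "z \<in> seg (f c) (f r)"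
    using za N1(3) N2(3) N3(3) by blast+
  then have "z \<in> f ` seg c p" "z \<in> f ` seg c q" "z \<in> f ` seg c r"
    using ne(2)[OF pqr(1)] ne(2)[OF pqr(2)] ne(2)[OF pqr(3)] by simp_all
  then obtain p' q' r' where e: "p' \<in> seg c p" "z = f p'" "q' \<in> seg c q" "z = f q'" "r' \<in> seg c r" "z = f r'"
    by blast
  then have nc: "p' \<noteq> c" "q' \<noteq> c" "r' \<noteq> c" using z(2) by auto
  have a: "p' \<in> arm c p" "q' \<in> arm c q" "r' \<in> arm c r"
    using seg_arm[OF cT _ e(1)] seg_arm[OF cT _ e(3)] seg_arm[OF cT _ e(5)] nc pqr(1-3) by auto
  have "arm c p \<inter> arm c q = {}" "arm c p \<inter> arm c r = {}" "arm c q \<inter> arm c r = {}"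
    using arm_disjoint[of p c q] arm_disjoint[of p c r] arm_disjoint[of q c r] pqr by auto
  then have dist: "p' \<noteq> q'" "p' \<noteq> r'" "q' \<noteq> r'" using a by blast+
  have "{p', q', r'} \<subseteq> {x\<in>T. f x = z}" using a e by (auto simp: arm_iff)
  then have "card {p', q', r'} \<le> 2" using fibre[OF zT] card_mono by (meson le_trans)
  then show False using dist by simp
qed

lemma branch_image:
  assumes "branch_point T x" shows "branch_point T (f x)"
proof -
  have "x \<in> T" "x \<noteq> c" using assms critical_not_branch branch_point_T by auto
  then show ?thesis using card_arms_mono[of x] assms fT by (simp add: branch_point_def)
qed

lemma branch_funpow: "branch_point T x \<Longrightarrow> branch_point T ((f ^^ k) x)"
  by (induction k) (auto simp: branch_image)

lemma branch_facts:
  assumes "branch_point T x" shows "x \<in> T" "x \<noteq> c" "x \<noteq> f c"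
  using assms critical_not_branch critical_value_endpoint by (auto simp: branch_point_def endpoint_def)

lemma tau_pow_local_arms:
  "x \<in> T \<Longrightarrow> a \<in> local_arms T x \<Longrightarrow> (\<tau> ^^ k) a \<in> local_arms T ((f ^^ k) x)"
  by (induction k) (auto simp: tau_local_arms funpow_T)

lemma tau_pow_inj:
  assumes "branch_point T x" shows "inj_on (\<tau> ^^ k) (local_arms T x)"
proof (induction k)
  case (Suc k)
  show ?case
  proof (rule inj_onI)
    fix a b assume ab: "a \<in> local_arms T x" "b \<in> local_arms T x" "(\<tau> ^^ Suc k) a = (\<tau> ^^ Suc k) b"
    have br: "branch_point T ((f ^^ k) x)" using branch_funpow[OF assms] .
    note xT = branch_facts(1)[OF assms]
    have "(\<tau> ^^ k) a = (\<tau> ^^ k) b"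
      using inj_onD[OF tau_inj[OF branch_facts(1,2)[OF br]] _ tau_pow_local_arms[OF xT ab(1)]
          tau_pow_local_arms[OF xT ab(2)]] ab(3) by simp
    then show "a = b" using Suc.IH ab(1,2) by (auto dest: inj_onD)
  qed
qed (simp add: inj_on_def)

end

section \<open>Periodic orbits of branch points\<close>

lemma funpow_fixpoint: "g x = x \<Longrightarrow> (g ^^ k) x = x"
  by (induction k) simp_all

locale branch_cycle = hubbard_graph +
  fixes x0 :: 'a and n :: nat
  assumes n_pos: "0 < n" and per: "(f ^^ n) x0 = x0"
    and n_min: "\<And>m. 0 < m \<Longrightarrow> (f ^^ m) x0 = x0 \<Longrightarrow> n \<le> m"
    and branch0: "branch_point T x0"
begin

definition "Q = forward_orbit f x0"

lemma Q_iff: "z \<in> Q \<longleftrightarrow> (\<exists>k. z = (f ^^ k) x0)"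
  by (auto simp: Q_def forward_orbit_def)

lemma funpow_Q: "z \<in> Q \<Longrightarrow> (f ^^ k) z \<in> Q"
  unfolding Q_iff by (metis funpow_add comp_apply)

lemma f_Q: "z \<in> Q \<Longrightarrow> f z \<in> Q"
  using funpow_Q[of z 1] by simp

lemma Q_branch: "z \<in> Q \<Longrightarrow> branch_point T z"
  using branch_funpow[OF branch0] by (auto simp: Q_iff)

lemmas Q_facts = branch_facts[OF Q_branch]

lemma finite_Q: "finite Q"
  using finite_subset[OF _ finite_branch_points] Q_branch by blast

lemma Q_periodic: "z \<in> Q \<Longrightarrow> (f ^^ n) z = z"
  unfolding Q_iff using per by (metis add.commute comp_apply funpow_add)

lemma x0_mult: "(f ^^ (n * k)) x0 = x0"
  using per by (simp add: funpow_mult [symmetric] funpow_fixpoint)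

lemma Q_back: "z \<in> Q \<Longrightarrow> \<exists>j. (f ^^ j) z = x0"
proof -
  assume "z \<in> Q"
  then obtain k where k: "z = (f ^^ k) x0" by (auto simp: Q_iff)
  have "(f ^^ (n * k - k)) z = (f ^^ (n * k - k + k)) x0" by (simp add: k funpow_add)
  also have "n * k - k + k = n * k" using n_pos by simp
  finally show ?thesis using x0_mult by metis
qed

lemma Q_reach:
  assumes "z \<in> Q" "w \<in> Q" shows "\<exists>j. (f ^^ j) z = w"
proof -
  obtain i where "(f ^^ i) z = x0" using Q_back[OF assms(1)] by blast
  moreover obtain k where "w = (f ^^ k) x0" using assms(2) by (auto simp: Q_iff)
  ultimately have "(f ^^ (k + i)) z = w" by (simp add: funpow_add)
  then show ?thesis by blast
qed

lemma period_dvd: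
  assumes "z \<in> Q" "(f ^^ m) z = z" shows "n dvd m"
proof (rule ccontr)
  assume "\<not> n dvd m"
  then have "0 < m mod n" "m mod n < n" using n_pos by (auto simp: dvd_eq_mod_eq_0)
  obtain j where j: "(f ^^ j) z = x0" using Q_back[OF assms(1)] by blast
  have "(f ^^ m) x0 = x0" using assms(2) j by (metis add.commute comp_apply funpow_add)
  then have "(f ^^ (m mod n + n * (m div n))) x0 = x0" by simp
  then have "(f ^^ (m mod n)) x0 = x0" unfolding funpow_add using x0_mult by simp
  then show False using n_min[OF \<open>0 < m mod n\<close>] \<open>m mod n < n\<close> by simp
qed

text \<open>Otherwise the successive images of the arc from \<open>z\<close> to an endpoint
  \<open>v\<close> of the arm never contain \<open>c\<close>, because \<open>c\<close> on such an
  arc would make its direction the one towards \<open>c\<close>. As \<open>v\<close> is on the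
  critical orbit, this contradicts expansivity.\<close>

lemma orbit_hits_critical:
  assumes z: "z \<in> Q" and p: "p \<in> T" "p \<noteq> z"
  shows "\<exists>k. (\<tau> ^^ k) (dir z p) = dir ((f ^^ k) z) c"
proof (rule ccontr)
  assume no: "\<nexists>k. (\<tau> ^^ k) (dir z p) = dir ((f ^^ k) z) c"
  note zT = Q_facts(1)[OF z]
  obtain v where v: "v \<in> arm z p" "endpoint T v" using arm_has_endpoint[OF zT p] .
  have vT: "v \<in> T" "v \<noteq> z" using v(1) by (auto simp: arm_iff)
  have dv: "dir z p = dir z v" using dir_eq_iff[OF zT p vT] v(1) by simp
  have av: "c \<notin> seg w u" if "w \<in> T" "u \<in> T" "u \<noteq> w" "c \<noteq> w" "dir w u \<noteq> dir w c" for w u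
    using seg_arm[OF that(1,2)] dir_eq_iff[OF that(1-3) cT that(4)] that(4,5) by blast
  have ind: "(\<tau> ^^ k) (dir z v) = dir ((f ^^ k) z) ((f ^^ k) v) \<and> (f ^^ k) v \<noteq> (f ^^ k) z \<and>
     (f ^^ k) ` seg z v = seg ((f ^^ k) z) ((f ^^ k) v)" for k
  proof (induction k)
    case 0
    then show ?case using vT by simp
  next
    case (Suc k)
    define w where "w = (f ^^ k) z"
    define u where "u = (f ^^ k) v"
    have w: "w \<in> Q" unfolding w_def by (rule funpow_Q[OF z])
    have uT: "u \<in> T" unfolding u_def by (rule funpow_T[OF vT(1)])
    have IH: "(\<tau> ^^ k) (dir z v) = dir w u" "u \<noteq> w" "(f ^^ k) ` seg z v = seg w u"
      using Suc.IH by (simp_all add: w_def u_def)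
    have "dir w u \<noteq> dir w c" using no IH(1) dv by (auto simp: w_def)
    then have "c \<notin> seg w u" using av[OF Q_facts(1)[OF w] uT IH(2)] Q_facts(2)[OF w] by blast
    then have "c \<notin> seg w u - {w, u}" by blast
    note t = tau_dir[OF Q_facts(1)[OF w] uT IH(2) this]
    have "(f ^^ Suc k) ` seg z v = f ` seg w u" using IH(3) by (metis funpow.simps(2) image_comp)
    then show ?case using t IH(1) by (simp add: w_def u_def)
  qed
  have "c \<notin> (f ^^ k) ` seg z v" for k
  proof -
    define w where "w = (f ^^ k) z"
    define u where "u = (f ^^ k) v"
    have w: "w \<in> Q" unfolding w_def by (rule funpow_Q[OF z])
    have uT: "u \<in> T" unfolding u_def by (rule funpow_T[OF vT(1)])
    have IH: "(\<tau> ^^ k) (dir z v) = dir w u" "u \<noteq> w" "(f ^^ k) ` seg z v = seg w u"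
      using ind[of k] by (simp_all add: w_def u_def)
    have "dir w u \<noteq> dir w c" using no IH(1) dv by (auto simp: w_def)
    then show ?thesis using av[OF Q_facts(1)[OF w] uT IH(2)] Q_facts(2)[OF w] IH(3) by auto
  qed
  moreover have "\<exists>k. c \<in> (f ^^ k) ` tree_arc T z v"
    using expansive[OF _ Q_branch[OF z] endpoint_orbit[OF v(2)]] vT(2) by metis
  ultimately show False using vT(2) by (auto simp: tree_seg_def)
qed

text \<open>Extremal in the tree order rooted at \<open>c\<close>: by \<open>seg_c_iff\<close>, the
  point \<open>w\<close> does not lie between \<open>c\<close> and another point of the
  orbit.\<close>

definition "minimal_at w \<longleftrightarrow> (\<forall>v\<in>Q - {w}. dir w v = dir w c)"

lemma seg_c_iff:
  assumes "w \<in> Q" "v \<in> T" "v \<noteq> w" shows "dir w v = dir w c \<longleftrightarrow> w \<notin> seg c v"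
  using dir_eq_iff[OF Q_facts(1)[OF assms(1)] assms(2,3) cT] Q_facts(2)[OF assms(1)] cT
    seg_sym[OF cT assms(2)] by (auto simp: arm_iff)

text \<open>The orbit point \<open>w\<close> with the most orbit points on \<open>seg c w\<close>
  works, because an orbit point behind \<open>w\<close> would have more.\<close>

lemma minimal_exists: "\<exists>w\<in>Q. minimal_at w"
proof -
  define F where "F w = card (seg c w \<inter> Q)" for w
  have fin: "finite (F ` Q)" using finite_Q by simp
  have "x0 \<in> Q" unfolding Q_iff by (metis funpow_0)
  then have "Max (F ` Q) \<in> F ` Q" using Max_in[OF fin] by blast
  then obtain w where w: "w \<in> Q" "Max (F ` Q) = F w" by blast
  have max: "F v \<le> F w" if "v \<in> Q" for v using Max_ge[OF fin imageI[OF that]] w(2) by simp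
  note wT = Q_facts(1)[OF w(1)]
  have "dir w v = dir w c" if v: "v \<in> Q" "v \<noteq> w" for v
  proof (rule ccontr)
    assume ne: "dir w v \<noteq> dir w c"
    note vT = Q_facts(1)[OF v(1)]
    have wv: "w \<in> seg c v" using seg_c_iff[OF w(1) vT v(2)] ne by simp
    then have "v \<notin> seg c w" using seg_antisym[OF cT wT vT wv] v(2) by blast
    moreover have "seg c w \<subseteq> seg c v" using seg_subset_seg[OF cT vT seg_ends(1)[OF cT vT] wv] .
    ultimately have "seg c w \<inter> Q \<subset> seg c v \<inter> Q" using v(1) seg_ends(2)[OF cT vT] by blast
    then have "F w < F v" unfolding F_def using finite_Q by (intro psubset_card_mono) auto
    then show False using max[OF v(1)] by simp
  qed
  then show ?thesis using w(1) by (auto simp: minimal_at_def)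
qed

text \<open>An orbit point \<open>v\<close> behind \<open>z\<close> spans an arc
  \<open>seg z v\<close> without \<open>c\<close>, so \<tau> sends its direction to that of
  \<open>f v\<close>. By minimality at \<open>f z\<close> and the hypothesis on \<open>f c\<close>,
  this equals the image of the direction towards \<open>c\<close>, against injectivity of \<tau> at
  \<open>z\<close>.\<close>

lemma minimal_back:
  assumes z: "z \<in> Q" and min: "minimal_at (f z)" and eq: "dir (f z) (f c) = dir (f z) c"
  shows "minimal_at z"
  unfolding minimal_at_def
proof (intro ballI, rule ccontr)
  fix v assume v: "v \<in> Q - {z}" and ne: "dir z v \<noteq> dir z c"
  have vT: "v \<in> T" "v \<noteq> z" using v Q_facts(1) by auto
  note zT = Q_facts(1)[OF z]
  note zc = Q_facts(2)[OF z]
  have "c \<notin> seg z v"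
    using seg_arm[OF zT vT(1)] dir_eq_iff[OF zT vT cT] zc ne by blast
  then have "c \<notin> seg z v - {z, v}" by blast
  note t = tau_dir[OF zT vT this]
  have "f v \<in> Q - {f z}" using f_Q v t(2) by blast
  then have "\<tau> (dir z v) = \<tau> (dir z c)"
    using min t(1) eq tau_dir_c(1)[OF zT zc] by (simp add: minimal_at_def)
  moreover have "c \<noteq> z" using zc by simp
  ultimately show False
    using inj_onD[OF tau_inj[OF zT zc] _ dir_local_arms[OF zT vT] dir_local_arms[OF zT cT]] ne by blast
qed

text \<open>The point found here is known as the characteristic point of the orbit.\<close>

lemma characteristic_exists: "\<exists>z\<in>Q. minimal_at z \<and> dir z (f c) \<noteq> dir z c"
proof (rule ccontr)
  assume "\<not> ?thesis"
  then have no: "dir w (f c) = dir w c" if "w \<in> Q" "minimal_at w" for w using that by blast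
  obtain w0 where w0: "w0 \<in> Q" "minimal_at w0" using minimal_exists by blast
  \<comment> \<open>Pull minimality back around the whole orbit. Then every orbit point sees
    \<open>f c\<close> in the direction of \<open>c\<close>.\<close>
  have all_minimal: "z \<in> Q \<Longrightarrow> (f ^^ j) z = w0 \<Longrightarrow> minimal_at z" for z j
  proof (induction j arbitrary: z)
    case (Suc j)
    have "minimal_at (f z)" using Suc.IH[OF f_Q[OF Suc.prems(1)]] Suc.prems(2) by (simp add: funpow_swap1)
    then show ?case using minimal_back[OF Suc.prems(1)] no[OF f_Q[OF Suc.prems(1)]] by blast
  qed (use w0 in simp)
  have eq: "dir w (f c) = dir w c" if "w \<in> Q" for w using no[OF that] all_minimal[OF that] Q_reach[OF that w0(1)] by blast
  have tc: "(\<tau> ^^ k) (dir w0 c) = dir ((f ^^ k) w0) c" for k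
  proof (induction k)
    case (Suc k)
    have q: "(f ^^ k) w0 \<in> Q" using funpow_Q[OF w0(1)] .
    have "(\<tau> ^^ Suc k) (dir w0 c) = dir (f ((f ^^ k) w0)) (f c)"
      using Suc.IH tau_dir_c(1)[OF Q_facts(1,2)[OF q]] by simp
    also have "\<dots> = dir (f ((f ^^ k) w0)) c" using eq[OF f_Q[OF q]] .
    finally show ?case by simp
  qed simp
  note wT = Q_facts(1)[OF w0(1)]
  have cw: "c \<noteq> w0" using Q_facts(2)[OF w0(1)] by simp
  \<comment> \<open>A direction \<open>r\<close> other than that towards \<open>c\<close> must at
    some time become the direction towards \<open>c\<close>; but by \<open>tc\<close> this place is
    already taken by the image of the direction towards \<open>c\<close> itself.\<close>
  obtain p q where pq: "p \<in> T" "p \<noteq> w0" "q \<in> T" "q \<noteq> w0" "q \<notin> arm w0 p"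
    using branch_three[OF Q_branch[OF w0(1)]] by (metis DiffE singletonI)
  have "dir w0 p \<noteq> dir w0 q" using dir_eq_iff[OF wT pq(1-4)] pq(5) by simp
  then obtain r where r: "r \<in> T" "r \<noteq> w0" "dir w0 r \<noteq> dir w0 c" using pq(1-4) by metis
  obtain k where "(\<tau> ^^ k) (dir w0 r) = dir ((f ^^ k) w0) c" using orbit_hits_critical[OF w0(1) r(1,2)] by blast
  then have "(\<tau> ^^ k) (dir w0 r) = (\<tau> ^^ k) (dir w0 c)" using tc by simp
  then show False
    using inj_onD[OF tau_pow_inj[OF Q_branch[OF w0(1)]] _ dir_local_arms[OF wT r(1,2)] dir_local_arms[OF wT cT cw]] r(3)
    by blast
qed

text \<open>A direction from one orbit point to another is mapped to such a direction, or, if the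
  critical point lies in between, to the direction towards the critical value, which away from the
  characteristic point \<open>z\<close> is again the direction towards \<open>z\<close>. So an arm that has
  pointed at the critical point keeps being of this form until its base point reaches \<open>z\<close>.\<close>

lemma arms_dichotomy:
  "\<exists>z\<in>Q. (\<forall>w\<in>Q. \<forall>a\<in>local_arms T w. \<exists>k. (\<tau> ^^ k) a \<in> {dir z c, dir z (f c)}) \<and>
    (\<tau> ^^ n) (dir z c) \<in> {dir z c, dir z (f c)}"
proof -
  obtain z where z: "z \<in> Q" "minimal_at z" "dir z (f c) \<noteq> dir z c" using characteristic_exists by blast
  note zT = Q_facts(1)[OF z(1)]
  define good where "good g y \<longleftrightarrow> (\<exists>q\<in>Q. q \<noteq> y \<and> g = dir y q) \<or> (y = z \<and> g = dir z (f c))" for g y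
  have good_z: "g \<in> {dir z c, dir z (f c)}" if "good g z" for g
    using that z(2) by (auto simp: good_def minimal_at_def)
  have good_c1: "good (dir w (f c)) w" if w: "w \<in> Q" for w
  proof (cases "w = z")
    case True
    then show ?thesis by (simp add: good_def)
  next
    case False
    note wT = Q_facts(1)[OF w]
    have wf: "f c \<noteq> w" "f c \<noteq> z" using Q_facts(3)[OF w] Q_facts(3)[OF z(1)] by auto
    have "dir z w = dir z c" using z(2) w False by (simp add: minimal_at_def)
    \<comment> \<open>Seen from \<open>z\<close>, the point \<open>w\<close> is on the side of
      \<open>c\<close> and \<open>f c\<close> is not, so \<open>z\<close> separates \<open>w\<close>
      from \<open>f c\<close>.\<close>
    then have "dir z (f c) \<noteq> dir z w" using z(3) by simp
    then have zw: "z \<in> seg (f c) w"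
      using dir_eq_iff[OF zT c1_T wf(2) wT False] wT False by (simp add: arm_iff)
    have "w \<notin> seg (f c) z" using seg_antisym[OF c1_T zT wT zw] False by blast
    then have "dir w (f c) = dir w z"
      using dir_eq_iff[OF wT c1_T wf(1) zT] zT False by (auto simp: arm_iff)
    then show ?thesis using z(1) False by (auto simp: good_def)
  qed
  have good_tau: "good (\<tau> (dir y q)) (f y)" if yq: "y \<in> Q" "q \<in> Q" "q \<noteq> y" for y q
  proof (cases "c \<in> seg y q")
    case True
    note yT = Q_facts(1)[OF yq(1)]
    note qT = Q_facts(1)[OF yq(2)]
    have cy: "c \<noteq> y" using Q_facts(2)[OF yq(1)] by simp
    have "dir y q = dir y c" using dir_eq_iff[OF yT qT yq(3) cT cy] seg_arm[OF yT qT True cy] by simp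
    then show ?thesis using tau_dir_c(1)[OF Q_facts(1,2)[OF yq(1)]] good_c1[OF f_Q[OF yq(1)]] by simp
  next
    case False
    then have "c \<notin> seg y q - {y, q}" by blast
    note t = tau_dir[OF Q_facts(1)[OF yq(1)] Q_facts(1)[OF yq(2)] yq(3) this]
    then show ?thesis using f_Q[OF yq(2)] by (auto simp: good_def)
  qed
  \<comment> \<open>The bound \<open>i \<le> j\<close> keeps track of time; at the end it forces the
    return to be exactly the first one.\<close>
  have hit: "good g y \<Longrightarrow> y \<in> Q \<Longrightarrow> (f ^^ j) y = z \<Longrightarrow>
      \<exists>i\<le>j. (f ^^ i) y = z \<and> (\<tau> ^^ i) g \<in> {dir z c, dir z (f c)}" for g y j
  proof (induction j arbitrary: g y)
    case 0
    then show ?case using good_z by auto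
  next
    case (Suc j)
    show ?case
    proof (cases "y = z")
      case True
      then show ?thesis using good_z Suc.prems(1) by (intro exI[of _ 0]) auto
    next
      case False
      then obtain q where q: "q \<in> Q" "q \<noteq> y" "g = dir y q" using Suc.prems(1) by (auto simp: good_def)
      have "(f ^^ j) (f y) = z" using Suc.prems(3) by (simp add: funpow_swap1)
      then obtain i where i: "i \<le> j" "(f ^^ i) (f y) = z" "(\<tau> ^^ i) (\<tau> g) \<in> {dir z c, dir z (f c)}"
        using Suc.IH[OF _ f_Q[OF Suc.prems(2)]] good_tau[OF Suc.prems(2) q(1,2)] q(3) by blast
      have "(f ^^ Suc i) y = z" "(\<tau> ^^ Suc i) g \<in> {dir z c, dir z (f c)}"
        using i(2,3) by (simp_all add: funpow_Suc_right del: funpow.simps)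
      then show ?thesis using i(1) by (intro exI[of _ "Suc i"]) simp
    qed
  qed
  have all: "\<exists>k. (\<tau> ^^ k) a \<in> {dir z c, dir z (f c)}" if wa: "w \<in> Q" "a \<in> local_arms T w" for w a
  proof -
    obtain p where p: "p \<in> T" "p \<noteq> w" "a = dir w p" using local_arms_dirE[OF Q_facts(1)[OF wa(1)] wa(2)] .
    obtain k where k: "(\<tau> ^^ k) a = dir ((f ^^ k) w) c" using orbit_hits_critical[OF wa(1) p(1,2)] p(3) by blast
    have q: "(f ^^ k) w \<in> Q" using funpow_Q[OF wa(1)] .
    have k': "(\<tau> ^^ Suc k) a = dir (f ((f ^^ k) w)) (f c)" using k tau_dir_c(1)[OF Q_facts(1,2)[OF q]] by simp
    obtain j where "(f ^^ j) (f ((f ^^ k) w)) = z" using Q_reach[OF f_Q[OF q] z(1)] by blast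
    then obtain i where "(\<tau> ^^ i) ((\<tau> ^^ Suc k) a) \<in> {dir z c, dir z (f c)}"
      using hit[OF good_c1[OF f_Q[OF q]] f_Q[OF q]] k' by metis
    then have "(\<tau> ^^ (i + Suc k)) a \<in> {dir z c, dir z (f c)}" unfolding funpow_add comp_apply .
    then show ?thesis by blast
  qed
  \<comment> \<open>From \<open>f z\<close> the point \<open>z\<close> is reached after
    \<open>n - 1\<close> steps. A visit to \<open>z\<close> at time \<open>Suc i \<le> n\<close>
    must be at a multiple of the period, so \<open>Suc i = n\<close>.\<close>
  have "(f ^^ (n - 1)) (f z) = z" using Q_periodic[OF z(1)] n_pos by (cases n) (simp_all add: funpow_swap1)
  then obtain i where i: "i \<le> n - 1" "(f ^^ i) (f z) = z"
    "(\<tau> ^^ i) (dir (f z) (f c)) \<in> {dir z c, dir z (f c)}"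
    using hit[OF good_c1[OF f_Q[OF z(1)]] f_Q[OF z(1)]] by blast
  have "(f ^^ Suc i) z = z" using i(2) by (simp add: funpow_swap1)
  then have "n dvd Suc i" using period_dvd[OF z(1)] by blast
  then have "n \<le> Suc i" by (rule dvd_imp_le) simp
  then have "Suc i = n" using i(1) n_pos by simp
  then have "(\<tau> ^^ n) (dir z c) = (\<tau> ^^ i) (dir (f z) (f c))"
    using tau_dir_c(1)[OF Q_facts(1,2)[OF z(1)]] by (auto simp: funpow_swap1)
  then show ?thesis using z(1) all i(3) by (intro bexI[of _ z] conjI ballI) simp_all
qed

text \<open>Pigeonhole: the return map to \<open>z\<close> acts on finitely many arms, and as it is
  injective, an eventually periodic arm is periodic.\<close>

lemma tau_arm_periodic:
  assumes "z \<in> Q" "b \<in> local_arms T z" obtains m where "0 < m" "(\<tau> ^^ m) b = b"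
proof -
  note zT = Q_facts(1)[OF assms(1)]
  have fz: "(f ^^ (n * i)) z = z" for i using Q_periodic[OF assms(1)] by (simp add: funpow_mult [symmetric] funpow_fixpoint)
  have la: "(\<tau> ^^ (n * i)) b \<in> local_arms T z" for i using tau_pow_local_arms[OF zT assms(2), of "n * i"] fz by simp
  have "finite (range (\<lambda>i. (\<tau> ^^ (n * i)) b))"
    by (rule finite_subset[OF image_subsetI[OF la] finite_local_arms[OF zT]])
  then have "\<not> inj (\<lambda>i. (\<tau> ^^ (n * i)) b)" using finite_imageD infinite_UNIV_nat by metis
  then obtain i j where "i \<noteq> j" "(\<tau> ^^ (n * i)) b = (\<tau> ^^ (n * j)) b" by (auto simp: inj_on_def)
  then obtain i j where ij: "i < j" "(\<tau> ^^ (n * i)) b = (\<tau> ^^ (n * j)) b" by (metis linorder_neqE_nat)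
  have "(\<tau> ^^ (n * i)) ((\<tau> ^^ (n * (j - i))) b) = (\<tau> ^^ (n * i + n * (j - i))) b" by (simp add: funpow_add)
  also have "n * i + n * (j - i) = n * j" using ij(1) by (simp add: distrib_left [symmetric])
  finally have "(\<tau> ^^ (n * (j - i))) b = b"
    using inj_onD[OF tau_pow_inj[OF Q_branch[OF assms(1)]] _ la assms(2)] ij(2) by metis
  then show ?thesis using that[of "n * (j - i)"] ij(1) n_pos by simp
qed

lemma periodic_branch_orbit_Q: "periodic_branch_orbit T f Q"
  unfolding periodic_branch_orbit_def using n_pos per Q_branch by (auto simp: Q_def)

text \<open>All arms over the orbit are periodic, so an arm that reaches \<open>D\<close> also lies
  on the cycle of \<open>D\<close>; a common image leaves only one cycle.\<close>

lemma tame_if_common_image: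
  assumes "\<And>w a. w \<in> Q \<Longrightarrow> a \<in> local_arms T w \<Longrightarrow> \<exists>k. (\<tau> ^^ k) a = D"
  shows "tame_orbit T f Q"
  unfolding tame_orbit_def
proof (intro conjI ballI periodic_branch_orbit_Q)
  fix a b assume "a \<in> (\<Union>x\<in>Q. local_arms T x)" "b \<in> (\<Union>x\<in>Q. local_arms T x)"
  then obtain x y where xy: "x \<in> Q" "a \<in> local_arms T x" "y \<in> Q" "b \<in> local_arms T y" by blast
  obtain i j where ij: "(\<tau> ^^ i) a = D" "(\<tau> ^^ j) b = D" using assms xy by metis
  obtain m where m: "0 < m" "(\<tau> ^^ m) b = b" using tau_arm_periodic[OF xy(3,4)] .
  \<comment> \<open>The arm \<open>b\<close> reaches \<open>D\<close> after \<open>j\<close> steps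
    and is back at itself after \<open>m * j\<close> steps, so \<open>m * j - j\<close> more steps
    lead from \<open>D\<close> to \<open>b\<close>.\<close>
  have "(\<tau> ^^ (m * j - j + i)) a = (\<tau> ^^ (m * j - j)) ((\<tau> ^^ j) b)" using ij by (simp add: funpow_add)
  also have "\<dots> = (\<tau> ^^ (m * j - j + j)) b" by (simp add: funpow_add)
  also have "m * j - j + j = m * j" using m(1) by simp
  also have "(\<tau> ^^ (m * j)) b = b" using m(2) by (simp add: funpow_mult [symmetric] funpow_fixpoint)
  finally show "\<exists>k. (\<tau> ^^ k) a = b" by blast
qed

text \<open>If the return map moved the arm towards \<open>c\<close>, it would send it to the arm
  towards \<open>f c\<close>; then every arm would reach the latter and the orbit would be tame. A
  branch point has a third arm; if the return map fixed it, it could never become one of the other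
  two, against the dichotomy.\<close>

lemma not_tame_return_map:
  assumes "\<not> tame_orbit T f Q"
  obtains z a0 a where "z \<in> Q" "a0 \<in> local_arms T z" "(\<tau> ^^ n) a0 = a0" "a \<in> local_arms T z" "(\<tau> ^^ n) a \<noteq> a"
proof -
  obtain z where z: "z \<in> Q"
    and all: "\<And>w a. w \<in> Q \<Longrightarrow> a \<in> local_arms T w \<Longrightarrow> \<exists>k. (\<tau> ^^ k) a \<in> {dir z c, dir z (f c)}"
    and ret: "(\<tau> ^^ n) (dir z c) \<in> {dir z c, dir z (f c)}"
    using arms_dichotomy by blast
  note zT = Q_facts(1)[OF z]
  have fix0: "(\<tau> ^^ n) (dir z c) = dir z c"
  proof (rule ccontr)
    assume "(\<tau> ^^ n) (dir z c) \<noteq> dir z c"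
    then have r: "(\<tau> ^^ n) (dir z c) = dir z (f c)" using ret by simp
    have "\<exists>k. (\<tau> ^^ k) a = dir z (f c)" if wa: "w \<in> Q" "a \<in> local_arms T w" for w a
    proof -
      obtain k where "(\<tau> ^^ k) a = dir z c \<or> (\<tau> ^^ k) a = dir z (f c)" using all[OF wa] by blast
      then show ?thesis
      proof
        assume "(\<tau> ^^ k) a = dir z c"
        then have "(\<tau> ^^ (n + k)) a = dir z (f c)" using r by (simp add: funpow_add)
        then show ?thesis by blast
      qed blast
    qed
    then show False using tame_if_common_image assms by blast
  qed
  have "card {dir z c, dir z (f c)} < card (local_arms T z)"
    using Q_branch[OF z] card_local_arms[OF zT] card_insert_le_m1[of 2 "{dir z (f c)}" "dir z c"]
    by (simp add: branch_point_def)
  then have "\<not> local_arms T z \<subseteq> {dir z c, dir z (f c)}"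
    using card_mono[of "{dir z c, dir z (f c)}" "local_arms T z"] by auto
  then obtain a where a: "a \<in> local_arms T z" "a \<notin> {dir z c, dir z (f c)}" by blast
  have "(\<tau> ^^ n) a \<noteq> a"
  proof
    assume fa: "(\<tau> ^^ n) a = a"
    obtain k where k: "(\<tau> ^^ k) a \<in> {dir z c, dir z (f c)}" using all[OF z a(1)] by blast
    have cz: "c \<noteq> z" "f c \<noteq> z" using Q_facts(2,3)[OF z] by auto
    have "{dir z c, dir z (f c)} \<subseteq> local_arms T z"
      using dir_local_arms[OF zT cT cz(1)] dir_local_arms[OF zT c1_T cz(2)] by simp
    then have "(\<tau> ^^ k) a \<in> local_arms T z" using k by blast
    then have "(f ^^ k) z = z" using local_arms_point[OF funpow_T[OF zT] zT tau_pow_local_arms[OF zT a(1)]] by blast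
    then obtain m where "k = n * m" using period_dvd[OF z] by blast
    then have "(\<tau> ^^ k) a = a" using fa by (simp add: funpow_mult [symmetric] funpow_fixpoint)
    then show False using k a(2) by simp
  qed
  moreover have "c \<noteq> z" using Q_facts(2)[OF z] by simp
  ultimately show ?thesis using that[OF z dir_local_arms[OF zT cT] fix0 a(1)] by blast
qed

end

section \<open>Arcs in the plane issuing from a common point\<close>

definition hit :: "(real \<Rightarrow> complex) \<Rightarrow> real \<Rightarrow> real \<Rightarrow> bool" where
  "hit \<gamma> r s \<longleftrightarrow> 0 < s \<and> s \<le> 1 \<and> cmod (\<gamma> s) = r \<and> (\<forall>s'. 0 \<le> s' \<and> s' < s \<longrightarrow> cmod (\<gamma> s') < r)"

lemma hit_unique: "hit \<gamma> r s \<Longrightarrow> hit \<gamma> r t \<Longrightarrow> s = t"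
  unfolding hit_def by (metis less_irrefl linorder_neqE_linordered_idom order_less_imp_le)

text \<open>By the intermediate value theorem the least parameter on the circle is preceded only by
  parameters strictly inside the disc.\<close>

lemma hit_exists:
  assumes cont: "continuous_on {0..1} \<gamma>" and "\<gamma> 0 = 0" "0 < r" "r \<le> cmod (\<gamma> 1)"
  obtains s where "hit \<gamma> r s"
proof -
  have cn: "continuous_on {0..1} (\<lambda>s. cmod (\<gamma> s))" using cont by (intro continuous_intros)
  have ivt: "\<exists>s\<ge>0. s \<le> t \<and> cmod (\<gamma> s) = r" if "0 \<le> t" "t \<le> 1" "r \<le> cmod (\<gamma> t)" for t
    using IVT'[of "\<lambda>s. cmod (\<gamma> s)" 0 r t] that assms(2,3) continuous_on_subset[OF cn, of "{0..t}"] by auto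
  define K where "K = {0..1} \<inter> (\<lambda>s. cmod (\<gamma> s)) -` {r}"
  have "closed K" unfolding K_def by (rule continuous_closed_preimage[OF cn]) auto
  then have "compact K" unfolding K_def by (metis Int_lower1 bounded_subset bounded_closed_interval compact_eq_bounded_closed)
  moreover have "K \<noteq> {}" using ivt[of 1] assms(4) by (auto simp: K_def)
  ultimately obtain s where s: "s \<in> K" "\<And>t. t \<in> K \<Longrightarrow> s \<le> t" using compact_attains_inf by metis
  have s01: "0 \<le> s" "s \<le> 1" "cmod (\<gamma> s) = r" using s(1) by (auto simp: K_def)
  then have "s \<noteq> 0" using assms(2,3) by auto
  moreover have "cmod (\<gamma> t) < r" if t: "0 \<le> t" "t < s" for t
  proof (rule ccontr)
    assume "\<not> cmod (\<gamma> t) < r"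
    then obtain t' where "0 \<le> t'" "t' \<le> t" "cmod (\<gamma> t') = r" using ivt[of t] t s01 by auto
    then show False using s(2)[of t'] t s01 by (auto simp: K_def)
  qed
  ultimately have "hit \<gamma> r s" using s01 by (auto simp: hit_def)
  then show ?thesis using that by blast
qed

lemma cos_pos_imp_less_quarter:
  fixes \<psi> :: "real \<Rightarrow> real"
  assumes "0 \<le> t" "continuous_on {0..t} \<psi>" "\<psi> 0 = 0" "\<And>s. 0 \<le> s \<Longrightarrow> s \<le> t \<Longrightarrow> 0 < cos (\<psi> s)"
  shows "\<bar>\<psi> t\<bar> < pi / 2"
proof (rule ccontr)
  assume "\<not> \<bar>\<psi> t\<bar> < pi / 2"
  then have "pi / 2 \<le> \<bar>\<psi> t\<bar>" by simp
  moreover have "continuous_on {0..t} (\<lambda>s. \<bar>\<psi> s\<bar>)" using assms(2) by (intro continuous_intros)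
  ultimately obtain s where s: "0 \<le> s" "s \<le> t" "\<bar>\<psi> s\<bar> = pi / 2"
    using IVT'[of "\<lambda>s. \<bar>\<psi> s\<bar>" 0 "pi / 2" t] assms(1,3) by auto
  then have "cos (\<psi> s) = cos (pi / 2)" by (metis cos_abs_real)
  then show False using assms(4)[OF s(1,2)] by simp
qed

lemma Re_less_one:
  assumes "cmod w \<le> 1" "w \<noteq> 1" shows "Re w < 1"
proof (rule ccontr)
  assume "\<not> Re w < 1"
  then have re: "Re w = 1" using abs_Re_le_cmod[of w] assms(1) by linarith
  have "(cmod w)\<^sup>2 \<le> 1" using assms(1) by (simp add: power_le_one)
  then have "Im w = 0" using re by (simp add: cmod_power2)
  then show False using re assms(2) by (simp add: complex_eq_iff)
qed

text \<open>Dividing by \<open>a\<close> gives \<open>1 - \<delta> s / a\<close>, which stays in the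
  open right half plane since \<open>\<delta> s / a\<close> is in the closed unit disc and not 1. A
  continuous argument that starts at that of \<open>a\<close> hence ends less than a quarter turn
  away.\<close>

lemma arg_of_difference:
  fixes \<Phi> \<delta> :: "real \<Rightarrow> complex"
  assumes "0 \<le> t" "continuous_on {0..t} \<Phi>" "a \<noteq> 0" "\<delta> 0 = 0"
    and e: "\<And>s. 0 \<le> s \<Longrightarrow> s \<le> t \<Longrightarrow> exp (\<Phi> s) = a - \<delta> s"
    and l: "\<And>s. 0 \<le> s \<Longrightarrow> s \<le> t \<Longrightarrow> cmod (\<delta> s) \<le> cmod a"
    and n: "\<And>s. 0 \<le> s \<Longrightarrow> s \<le> t \<Longrightarrow> \<delta> s \<noteq> a"
  shows "\<bar>Im (\<Phi> t) - Im (\<Phi> 0)\<bar> < pi / 2"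
proof (rule cos_pos_imp_less_quarter[of t "\<lambda>s. Im (\<Phi> s) - Im (\<Phi> 0)"])
  show "continuous_on {0..t} (\<lambda>s. Im (\<Phi> s) - Im (\<Phi> 0))" using assms(2) by (intro continuous_intros)
  fix s assume s: "0 \<le> s" "s \<le> t"
  have "exp (\<Phi> s - \<Phi> 0) = (a - \<delta> s) / a" using e[OF s] e[of 0] assms(1,4) by (simp add: exp_diff)
  also have "\<dots> = 1 - \<delta> s / a" using assms(3) by (simp add: diff_divide_distrib)
  finally have eq: "exp (\<Phi> s - \<Phi> 0) = 1 - \<delta> s / a" .
  have "cmod (\<delta> s / a) \<le> 1" "\<delta> s / a \<noteq> 1" using l[OF s] n[OF s] assms(3) by (simp_all add: norm_divide)
  then have "0 < Re (exp (\<Phi> s - \<Phi> 0))" unfolding eq using Re_less_one by simp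
  then show "0 < cos (Im (\<Phi> s) - Im (\<Phi> 0))" by (simp add: Re_exp zero_less_mult_iff)
qed (use assms in auto)

lemma integer_valued_constant:
  fixes h :: "real \<Rightarrow> real"
  assumes "continuous_on S h" "connected S" "\<And>s. s \<in> S \<Longrightarrow> h s \<in> \<int>"
  obtains m :: int where "\<And>s. s \<in> S \<Longrightarrow> h s = of_int m"
proof (cases "S = {}")
  case False
  then obtain s0 where s0: "s0 \<in> S" by blast
  have "h constant_on S"
  proof (rule continuous_discrete_range_constant[OF assms(2,1)])
    fix x assume "x \<in> S"
    have "1 \<le> norm (h y - h x)" if y: "y \<in> S" "h y \<noteq> h x" for y
    proof -
      obtain i j :: int where "h x = of_int i" "h y = of_int j"
        using assms(3)[OF \<open>x \<in> S\<close>] assms(3)[OF y(1)] by (auto elim!: Ints_cases)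
      then show ?thesis using y(2) by auto
    qed
    then show "\<exists>e>0. \<forall>y. y \<in> S \<and> h y \<noteq> h x \<longrightarrow> e \<le> norm (h y - h x)" by (intro exI[of _ 1]) auto
  qed
  then obtain v where v: "\<And>s. s \<in> S \<Longrightarrow> h s = v" by (auto simp: constant_on_def)
  then obtain m :: int where "v = of_int m" using assms(3)[OF s0] s0 by (auto elim: Ints_cases)
  then show ?thesis using that v by blast
qed (use that in blast)

lemma log_turns:
  assumes "exp z = of_real (cmod w) * cis (2 * pi * L)" "w \<noteq> 0"
  shows "Im z / (2 * pi) - L \<in> \<int>"
proof -
  have "cmod (exp z) = cmod w" unfolding assms(1) by (simp add: norm_mult)
  moreover have "exp z = of_real (cmod (exp z)) * cis (Im z)"
    by (subst exp_eq_polar) simp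
  ultimately have "exp z = of_real (cmod w) * cis (Im z)" by simp
  then have "cis (Im z) = cis (2 * pi * L)" using assms by simp
  then have "cis (Im z - 2 * pi * L) = 1" by (simp add: cis_divide [symmetric])
  then have "cos (Im z - 2 * pi * L) = 1" by (simp add: complex_eq_iff)
  then obtain k :: int where "Im z - 2 * pi * L = real_of_int k * 2 * pi" using cos_one_2pi_int by blast
  then have "Im z / (2 * pi) - L = of_int k" by (simp add: field_simps)
  then show ?thesis by simp
qed

text \<open>Star shaped about \<open>(1, 1)\<close>, the corner opposite to the deleted one.
  Contractibility provides a continuous logarithm of the difference of two arcs that meet only at
  their common start.\<close>

lemma punctured_square_contractible: "contractible ({0..1} \<times> {0..1} - {(0::real, 0::real)})"
proof (rule starlike_imp_contractible)
  let ?S = "{0..1} \<times> {0..1} - {(0::real, 0::real)}"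
  have "closed_segment (1, 1) p \<subseteq> ?S" if "p \<in> ?S" for p
  proof
    fix q assume "q \<in> closed_segment (1, 1) p"
    then obtain u where u: "0 \<le> u" "u \<le> 1" "q = (1 - u) *\<^sub>R (1, 1) + u *\<^sub>R p"
      unfolding closed_segment_def by blast
    obtain s t where p: "p = (s, t)" by (cases p)
    have st: "0 \<le> s" "s \<le> 1" "0 \<le> t" "t \<le> 1" "s \<noteq> 0 \<or> t \<noteq> 0" using that p by auto
    have us: "0 \<le> u * s" "u * s \<le> u" "0 \<le> u * t" "u * t \<le> u"
      using st u mult_left_le[OF st(2) u(1)] mult_left_le[OF st(4) u(1)] by simp_all
    have q: "q = (1 - u + u * s, 1 - u + u * t)" using u p by simp
    have "q \<noteq> (0, 0)"
    proof
      assume "q = (0, 0)"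
      then have "1 - u + u * s = 0" "1 - u + u * t = 0" using q by auto
      then have "u = 1" using u(2) us by linarith
      then show False using \<open>1 - u + u * s = 0\<close> \<open>1 - u + u * t = 0\<close> st(5) by simp
    qed
    moreover have "q \<in> {0..1} \<times> {0..1}" using q us u by auto
    ultimately show "q \<in> ?S" by simp
  qed
  then show "starlike ?S" unfolding starlike_def by (intro bexI[of _ "(1, 1)"]) auto
qed

text \<open>The difference of the two arcs has a continuous argument on the punctured square of
  parameters. On a circle of radius \<^term>\<open>r\<close>, the difference of the first hits lies in the
  half plane around either of them (up to sign), which confines the difference of the lifted
  arguments to an interval between consecutive integers that does not depend on \<^term>\<open>r\<close>.\<close>

lemma first_hits_turn_gap:
  fixes \<gamma>1 \<gamma>2 :: "real \<Rightarrow> complex"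
  assumes c1: "continuous_on {0..1} \<gamma>1" and c2: "continuous_on {0..1} \<gamma>2"
    and z1: "\<gamma>1 0 = 0" and z2: "\<gamma>2 0 = 0"
    and ne: "\<And>s t. s \<in> {0..1} \<Longrightarrow> t \<in> {0..1} \<Longrightarrow> (s, t) \<noteq> (0, 0) \<Longrightarrow> \<gamma>1 s \<noteq> \<gamma>2 t"
    and L1: "continuous_on {0<..1} L1" "\<And>s. s \<in> {0<..1} \<Longrightarrow> \<gamma>1 s = of_real (cmod (\<gamma>1 s)) * cis (2 * pi * L1 s)"
    and L2: "continuous_on {0<..1} L2" "\<And>s. s \<in> {0<..1} \<Longrightarrow> \<gamma>2 s = of_real (cmod (\<gamma>2 s)) * cis (2 * pi * L2 s)"
  obtains k :: int where "\<And>r s t. hit \<gamma>1 r s \<Longrightarrow> hit \<gamma>2 r t \<Longrightarrow> of_int k < L1 s - L2 t \<and> L1 s - L2 t < of_int k + 1"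
proof -
  let ?S = "{0..1} \<times> {0..1} - {(0::real, 0::real)}"
  have cF: "continuous_on ?S (\<lambda>p. \<gamma>1 (fst p) - \<gamma>2 (snd p))"
    by (intro continuous_intros continuous_on_compose2[OF c1] continuous_on_compose2[OF c2]) auto
  have nzF: "\<gamma>1 (fst p) - \<gamma>2 (snd p) \<noteq> 0" if "p \<in> ?S" for p
    using that ne[of "fst p" "snd p"] by (cases p) auto
  have "\<exists>\<Phi>. continuous_on ?S \<Phi> \<and> (\<forall>p\<in>?S. \<gamma>1 (fst p) - \<gamma>2 (snd p) = exp (\<Phi> p))"
    by (rule continuous_logarithm_on_contractible[OF cF punctured_square_contractible nzF]) blast+
  then obtain \<Phi> where \<Phi>: "continuous_on ?S \<Phi>" "\<And>p. p \<in> ?S \<Longrightarrow> \<gamma>1 (fst p) - \<gamma>2 (snd p) = exp (\<Phi> p)"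
    by blast
  have nz1: "\<gamma>1 s \<noteq> 0" if "s \<in> {0<..1}" for s using ne[of s 0] that z2 by auto
  have nz2: "\<gamma>2 s \<noteq> 0" if "s \<in> {0<..1}" for s using ne[of 0 s] that z1 by auto
  \<comment> \<open>On the side \<open>t = 0\<close> the difference is \<open>\<gamma>1 s\<close>,
    so its lifted argument and \<open>L1\<close> differ by a constant integer.\<close>
  have "Im (\<Phi> (s, 0)) / (2 * pi) - L1 s \<in> \<int>" if s: "s \<in> {0<..1}" for s
  proof (rule log_turns[OF _ nz1[OF s]])
    have "exp (\<Phi> (s, 0)) = \<gamma>1 s" using \<Phi>(2)[of "(s, 0)"] s z2 by simp
    also have "\<dots> = of_real (cmod (\<gamma>1 s)) * cis (2 * pi * L1 s)" by (rule L1(2)[OF s])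
    finally show "exp (\<Phi> (s, 0)) = of_real (cmod (\<gamma>1 s)) * cis (2 * pi * L1 s)" .
  qed
  moreover have "continuous_on {0<..1} (\<lambda>s. Im (\<Phi> (s, 0)) / (2 * pi) - L1 s)"
    by (intro continuous_intros L1(1) continuous_on_compose2[OF \<Phi>(1)]) auto
  ultimately obtain m1 :: int where m1: "\<And>s. s \<in> {0<..1} \<Longrightarrow> Im (\<Phi> (s, 0)) / (2 * pi) - L1 s = of_int m1"
    using integer_valued_constant[of "{0<..1}" "\<lambda>s. Im (\<Phi> (s, 0)) / (2 * pi) - L1 s"] by auto
  \<comment> \<open>On the side \<open>s = 0\<close> the difference is \<open>- \<gamma>2 t\<close>,
    which accounts for the half turn.\<close>
  have "Im (\<Phi> (0, t)) / (2 * pi) - (L2 t + 1 / 2) \<in> \<int>" if t: "t \<in> {0<..1}" for t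
  proof (rule log_turns[OF _ nz2[OF t]])
    have "of_real (cmod (\<gamma>2 t)) * cis (2 * pi * (L2 t + 1 / 2)) = - (of_real (cmod (\<gamma>2 t)) * cis (2 * pi * L2 t))"
      by (simp add: distrib_left cis_mult [symmetric])
    also have "\<dots> = - \<gamma>2 t" by (simp only: L2(2)[OF t, symmetric])
    finally show "exp (\<Phi> (0, t)) = of_real (cmod (\<gamma>2 t)) * cis (2 * pi * (L2 t + 1 / 2))"
      using \<Phi>(2)[of "(0, t)"] t z1 by simp
  qed
  moreover have "continuous_on {0<..1} (\<lambda>t. Im (\<Phi> (0, t)) / (2 * pi) - (L2 t + 1 / 2))"
    by (intro continuous_intros L2(1) continuous_on_compose2[OF \<Phi>(1)]) auto
  ultimately obtain m2 :: int where m2: "\<And>t. t \<in> {0<..1} \<Longrightarrow> Im (\<Phi> (0, t)) / (2 * pi) - (L2 t + 1 / 2) = of_int m2"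
    using integer_valued_constant[of "{0<..1}" "\<lambda>t. Im (\<Phi> (0, t)) / (2 * pi) - (L2 t + 1 / 2)"] by auto
  show ?thesis
  proof (rule that[of "m2 - m1"])
    fix r s t assume h: "hit \<gamma>1 r s" "hit \<gamma>2 r t"
    then have s: "s \<in> {0<..1}" and t: "t \<in> {0<..1}" by (auto simp: hit_def)
    have le1: "cmod (\<gamma>1 s') \<le> cmod (\<gamma>2 t)" if "0 \<le> s'" "s' \<le> s" for s'
      using h that by (cases "s' = s") (auto simp: hit_def less_imp_le)
    have le2: "cmod (\<gamma>2 t') \<le> cmod (\<gamma>1 s)" if "0 \<le> t'" "t' \<le> t" for t'
      using h that by (cases "t' = t") (auto simp: hit_def less_imp_le)
    \<comment> \<open>At first hits of equal radius, no earlier value of one curve exceeds in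
      modulus the value of the other at its hit. So the argument changes by less than a quarter turn
      along each of the two segments from \<open>(s, t)\<close> to the sides of the square.\<close>
    have "\<bar>Im (\<Phi> (s, t)) - Im (\<Phi> (s, 0))\<bar> < pi / 2"
    proof (rule arg_of_difference[of t "\<lambda>t'. \<Phi> (s, t')" "\<gamma>1 s" \<gamma>2])
      show "continuous_on {0..t} (\<lambda>t'. \<Phi> (s, t'))"
        by (rule continuous_on_compose2[OF \<Phi>(1)]) (use s t in \<open>auto intro!: continuous_intros\<close>)
      show "exp (\<Phi> (s, t')) = \<gamma>1 s - \<gamma>2 t'" if "0 \<le> t'" "t' \<le> t" for t'
        using \<Phi>(2)[of "(s, t')"] s t that by simp
      show "\<gamma>2 t' \<noteq> \<gamma>1 s" if "0 \<le> t'" "t' \<le> t" for t'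
        using ne[of s t'] s t that by auto
    qed (use t nz1[OF s] z2 le2 in auto)
    moreover have "\<bar>Im (\<Phi> (s, t)) - Im (\<Phi> (0, t))\<bar> < pi / 2"
    proof (rule arg_of_difference[of s "\<lambda>s'. \<Phi> (s', t)" "- \<gamma>2 t" "\<lambda>s'. - \<gamma>1 s'"])
      show "continuous_on {0..s} (\<lambda>s'. \<Phi> (s', t))"
        by (rule continuous_on_compose2[OF \<Phi>(1)]) (use s t in \<open>auto intro!: continuous_intros\<close>)
      show "exp (\<Phi> (s', t)) = - \<gamma>2 t - - \<gamma>1 s'" if "0 \<le> s'" "s' \<le> s" for s'
        using \<Phi>(2)[of "(s', t)"] s t that by simp
      show "- \<gamma>1 s' \<noteq> - \<gamma>2 t" if "0 \<le> s'" "s' \<le> s" for s'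
        using ne[of s' t] s t that by auto
    qed (use s nz2[OF t] z1 le1 in auto)
    \<comment> \<open>Less than half a turn in total; together with the half turn built into
      \<open>m2\<close> this confines \<open>L1 s - L2 t\<close> to the open interval between
      \<open>m2 - m1\<close> and its successor.\<close>
    ultimately have "\<bar>Im (\<Phi> (s, 0)) - Im (\<Phi> (0, t))\<bar> < pi" by linarith
    then have "\<bar>Im (\<Phi> (s, 0)) - Im (\<Phi> (0, t))\<bar> / (2 * pi) < pi / (2 * pi)"
      by (intro divide_strict_right_mono) auto
    then have "\<bar>Im (\<Phi> (s, 0)) / (2 * pi) - Im (\<Phi> (0, t)) / (2 * pi)\<bar> < 1 / 2"
      by (simp add: diff_divide_distrib [symmetric])
    moreover have "\<bar>y - y'\<bar> < 1 / 2 \<Longrightarrow> y - l = of_int m1 \<Longrightarrow> y' - (l' + 1 / 2) = of_int m2 \<Longrightarrow>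
      of_int (m2 - m1) < l - l' \<and> l - l' < of_int (m2 - m1) + 1" for y y' l l' :: real
      unfolding abs_less_iff of_int_diff by linarith
    ultimately show "of_int (m2 - m1) < L1 s - L2 t \<and> L1 s - L2 t < of_int (m2 - m1) + 1"
      using m1[OF s] m2[OF t] by blast
  qed
qed

text \<open>Angles are counted in full turns, so only their classes modulo 1 matter. Cutting the
  circle at \<alpha> makes the cyclic order a linear one on fractional parts.\<close>

definition ccw_turns :: "real \<Rightarrow> real \<Rightarrow> real \<Rightarrow> bool" where
  "ccw_turns \<alpha> \<beta> \<gamma> \<longleftrightarrow> 0 < frac (\<beta> - \<alpha>) \<and> frac (\<beta> - \<alpha>) < frac (\<gamma> - \<alpha>)"

lemma ccw_turns_iff:
  "ccw_turns \<alpha> \<beta> \<gamma> \<longleftrightarrow> (\<exists>i j k. \<alpha> + of_int i < \<beta> + of_int j \<and> \<beta> + of_int j < \<gamma> + of_int k \<and> \<gamma> + of_int k < \<alpha> + of_int i + 1)"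
proof
  assume "ccw_turns \<alpha> \<beta> \<gamma>"
  then have "\<alpha> + of_int 0 < \<beta> + of_int (- \<lfloor>\<beta> - \<alpha>\<rfloor>) \<and>
      \<beta> + of_int (- \<lfloor>\<beta> - \<alpha>\<rfloor>) < \<gamma> + of_int (- \<lfloor>\<gamma> - \<alpha>\<rfloor>) \<and> \<gamma> + of_int (- \<lfloor>\<gamma> - \<alpha>\<rfloor>) < \<alpha> + of_int 0 + 1"
    using frac_lt_1[of "\<gamma> - \<alpha>"] unfolding ccw_turns_def frac_def by simp
  then show "\<exists>i j k. \<alpha> + of_int i < \<beta> + of_int j \<and> \<beta> + of_int j < \<gamma> + of_int k \<and> \<gamma> + of_int k < \<alpha> + of_int i + 1" by (intro exI)
next
  assume "\<exists>i j k. \<alpha> + of_int i < \<beta> + of_int j \<and> \<beta> + of_int j < \<gamma> + of_int k \<and> \<gamma> + of_int k < \<alpha> + of_int i + 1"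
  then obtain i j k :: int where h: "\<alpha> + of_int i < \<beta> + of_int j"
    "\<beta> + of_int j < \<gamma> + of_int k" "\<gamma> + of_int k < \<alpha> + of_int i + 1" by blast
  have "\<lfloor>\<beta> - \<alpha>\<rfloor> = i - j" "\<lfloor>\<gamma> - \<alpha>\<rfloor> = i - k" using h by (intro floor_unique; simp)+
  then show "ccw_turns \<alpha> \<beta> \<gamma>" using h by (simp add: ccw_turns_def frac_def)
qed

text \<open>The integer parts of the three differences decide the orientation, so it cannot change
  as long as no difference crosses an integer.\<close>

lemma ccw_turns_gap:
  assumes "of_int k1 < \<beta> - \<alpha>" "\<beta> - \<alpha> < of_int k1 + 1" "of_int k2 < \<gamma> - \<alpha>" "\<gamma> - \<alpha> < of_int k2 + 1"
    "of_int k3 < \<gamma> - \<beta>" "\<gamma> - \<beta> < of_int k3 + 1"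
  shows "ccw_turns \<alpha> \<beta> \<gamma> \<longleftrightarrow> k2 - k1 \<le> k3"
proof -
  have "\<lfloor>\<beta> - \<alpha>\<rfloor> = k1" "\<lfloor>\<gamma> - \<alpha>\<rfloor> = k2" using assms by (intro floor_unique; simp)+
  then have "ccw_turns \<alpha> \<beta> \<gamma> \<longleftrightarrow> of_int (k2 - k1) < \<gamma> - \<beta>" using assms by (auto simp: ccw_turns_def frac_def)
  also have "\<dots> \<longleftrightarrow> k2 - k1 \<le> k3"
  proof
    assume "of_int (k2 - k1) < \<gamma> - \<beta>"
    then have "of_int (k2 - k1) < (of_int (k3 + 1) :: real)" using assms(6) by simp
    then show "k2 - k1 \<le> k3" by simp
  next
    assume "k2 - k1 \<le> k3"
    then have "of_int (k2 - k1) \<le> (of_int k3 :: real)" by (simp only: of_int_le_iff)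
    then show "of_int (k2 - k1) < \<gamma> - \<beta>" using assms(5) by linarith
  qed
  finally show ?thesis .
qed

lemma ccw_turns_distinct: "ccw_turns \<alpha> \<beta> \<gamma> \<Longrightarrow> frac (\<beta> - \<alpha>) \<noteq> 0 \<and> frac (\<gamma> - \<alpha>) \<noteq> 0 \<and> \<beta> \<noteq> \<gamma>"
  unfolding ccw_turns_def by (metis less_irrefl order_less_trans)

lemma ccw_turns_shift:
  "ccw_turns (\<alpha> + of_int i) (\<beta> + of_int j) (\<gamma> + of_int k) \<longleftrightarrow> ccw_turns \<alpha> \<beta> \<gamma>"
proof -
  have sh: "frac (y + of_int l) = frac y" for y :: real and l :: int by (simp add: frac_def)
  have "\<beta> + of_int j - (\<alpha> + of_int i) = \<beta> - \<alpha> + of_int (j - i)"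
    "\<gamma> + of_int k - (\<alpha> + of_int i) = \<gamma> - \<alpha> + of_int (k - i)" by simp_all
  then show ?thesis unfolding ccw_turns_def by (simp only: sh)
qed

lemma rcis_turns_eq_iff:
  assumes "0 < r"
  shows "rcis r \<alpha> = rcis r (2 * pi * A) \<longleftrightarrow> (\<exists>i::int. \<alpha> = 2 * pi * (A + of_int i))"
proof
  assume "rcis r \<alpha> = rcis r (2 * pi * A)"
  then have "cis \<alpha> = cis (2 * pi * A)" using assms by (simp add: rcis_def)
  then have "cis (\<alpha> - 2 * pi * A) = 1" by (simp add: cis_divide [symmetric])
  then have "cos (\<alpha> - 2 * pi * A) = 1" by (simp add: complex_eq_iff)
  then obtain k :: int where "\<alpha> - 2 * pi * A = real_of_int k * 2 * pi" using cos_one_2pi_int by blast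
  then have "\<alpha> = 2 * pi * (A + of_int k)" by (simp add: algebra_simps)
  then show "\<exists>i::int. \<alpha> = 2 * pi * (A + of_int i)" by blast
next
  assume "\<exists>i::int. \<alpha> = 2 * pi * (A + of_int i)"
  then obtain i :: int where "\<alpha> = 2 * pi * A + 2 * pi * of_int i" by (auto simp: algebra_simps)
  then have "cis \<alpha> = cis (2 * pi * A)" by (simp add: cis_mult [symmetric] cis_multiple_2pi)
  then show "rcis r \<alpha> = rcis r (2 * pi * A)" by (simp add: rcis_def)
qed

lemma turns_eq_imp_int:
  assumes "cis (2 * pi * A) = cis (2 * pi * B)" shows "A - B \<in> \<int>"
proof -
  have "rcis 1 (2 * pi * A) = rcis 1 (2 * pi * B)" using assms by (simp add: rcis_def)
  then obtain i :: int where "2 * pi * A = 2 * pi * (B + of_int i)" using rcis_turns_eq_iff[of 1] by auto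
  then have "A = B + of_int i" by simp
  then show ?thesis by simp
qed

lemma ccw_turns_translate: "ccw_turns (\<rho> + \<alpha>) (\<rho> + \<beta>) (\<rho> + \<delta>) \<longleftrightarrow> ccw_turns \<alpha> \<beta> \<delta>"
  by (simp add: ccw_turns_def)

text \<open>The left side is the angle condition of \<open>arms_ccw\<close> with its free choice of
  lifts; dividing by \<open>2 * pi\<close> turns this choice into the integer shifts of
  \<open>ccw_turns_iff\<close>.\<close>

lemma ccw_angles_iff:
  assumes "0 < r"
  shows "(\<exists>\<alpha> \<beta> \<gamma>. rcis r (2 * pi * A) = rcis r \<alpha> \<and> rcis r (2 * pi * B) = rcis r \<beta> \<and>
      rcis r (2 * pi * D) = rcis r \<gamma> \<and> \<alpha> < \<beta> \<and> \<beta> < \<gamma> \<and> \<gamma> < \<alpha> + 2 * pi) \<longleftrightarrow> ccw_turns A B D"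
    (is "?l \<longleftrightarrow> _")
proof -
  have eq: "rcis r (2 * pi * Y) = rcis r \<alpha> \<longleftrightarrow> (\<exists>i::int. \<alpha> = 2 * pi * (Y + of_int i))" for Y \<alpha>
    using rcis_turns_eq_iff[OF assms, of \<alpha> Y] by metis
  have lt: "2 * pi * u < 2 * pi * v \<longleftrightarrow> u < v" for u v :: real by simp
  have lt2: "2 * pi * u < 2 * pi * v + 2 * pi \<longleftrightarrow> u < v + 1" for u v :: real
    using lt[of u "v + 1"] by (simp add: distrib_left)
  have "?l \<longleftrightarrow> (\<exists>i j k. 2 * pi * (A + of_int i) < 2 * pi * (B + of_int j) \<and>
      2 * pi * (B + of_int j) < 2 * pi * (D + of_int k) \<and>
      2 * pi * (D + of_int k) < 2 * pi * (A + of_int i) + 2 * pi)"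
    (is "_ \<longleftrightarrow> ?m")
  proof
    assume ?l
    then obtain \<alpha> \<beta> \<gamma> where h: "rcis r (2 * pi * A) = rcis r \<alpha>" "rcis r (2 * pi * B) = rcis r \<beta>"
      "rcis r (2 * pi * D) = rcis r \<gamma>" "\<alpha> < \<beta>" "\<beta> < \<gamma>" "\<gamma> < \<alpha> + 2 * pi" by (elim exE conjE)
    obtain i j k :: int where "\<alpha> = 2 * pi * (A + of_int i)" "\<beta> = 2 * pi * (B + of_int j)"
      "\<gamma> = 2 * pi * (D + of_int k)"
      using h(1-3)[unfolded eq] by (elim exE)
    then show ?m using h(4-6) by (intro exI[of _ i] exI[of _ j] exI[of _ k]) simp
  next
    assume ?m
    then obtain i j k :: int where h: "2 * pi * (A + of_int i) < 2 * pi * (B + of_int j)"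
      "2 * pi * (B + of_int j) < 2 * pi * (D + of_int k)"
      "2 * pi * (D + of_int k) < 2 * pi * (A + of_int i) + 2 * pi" by (elim exE conjE)
    have "rcis r (2 * pi * Y) = rcis r (2 * pi * (Y + of_int l))" for Y and l :: int
      unfolding eq by (rule exI) (rule refl)
    then show ?l using h by (intro exI[of _ "2 * pi * (A + of_int i)"] exI[of _ "2 * pi * (B + of_int j)"]
        exI[of _ "2 * pi * (D + of_int k)"] conjI)
  qed
  also have "\<dots> \<longleftrightarrow> ccw_turns A B D" unfolding lt lt2 ccw_turns_iff by simp
  finally show ?thesis .
qed

lemma finite_set_turns:
  assumes "finite A" shows "\<exists>h :: 'b \<Rightarrow> real. \<forall>a\<in>A. \<forall>b\<in>A. a \<noteq> b \<longrightarrow> h a - h b \<notin> \<int>"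
proof -
  obtain g :: "'b \<Rightarrow> nat" where g: "bij_betw g A {0..<card A}" using ex_bij_betw_finite_nat[OF assms] by blast
  define h where "h a = real (g a) / real (card A)" for a
  have "h a - h b \<notin> \<int>" if ab: "a \<in> A" "b \<in> A" "a \<noteq> b" for a b
  proof
    assume "h a - h b \<in> \<int>"
    then obtain i where i: "h a - h b = of_int i" by (rule Ints_cases)
    have lt: "g a < card A" "g b < card A" using bij_betwE[OF g] ab by auto
    then have "0 \<le> h a" "h a < 1" "0 \<le> h b" "h b < 1" by (simp_all add: h_def)
    then have "real_of_int i < 1" "- 1 < real_of_int i" using i by linarith+
    then have "i = 0" by simp
    then have "g a = g b" using i lt by (simp add: h_def)
    then show False using bij_betw_imp_inj_on[OF g] ab by (auto dest: inj_onD)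
  qed
  then show ?thesis by blast
qed

lemma turn_lift_exists:
  fixes \<gamma> :: "real \<Rightarrow> complex"
  assumes "continuous_on {0<..1} \<gamma>" "\<And>s. s \<in> {0<..1} \<Longrightarrow> \<gamma> s \<noteq> 0"
  shows "\<exists>L. continuous_on {0<..1} L \<and> (\<forall>s\<in>{0<..1}. \<gamma> s = of_real (cmod (\<gamma> s)) * cis (2 * pi * L s))"
proof -
  have "contractible {0<..1::real}" by (rule convex_imp_contractible) simp
  then have "\<exists>\<Phi>. continuous_on {0<..1} \<Phi> \<and> (\<forall>s\<in>{0<..1}. \<gamma> s = exp (\<Phi> s))"
    by (rule continuous_logarithm_on_contractible[OF assms(1) _ assms(2)]) blast+
  then obtain \<Phi> where \<Phi>: "continuous_on {0<..1} \<Phi>" "\<And>s. s \<in> {0<..1} \<Longrightarrow> \<gamma> s = exp (\<Phi> s)" by blast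
  have "exp (\<Phi> s) = of_real (cmod (exp (\<Phi> s))) * cis (Im (\<Phi> s))" for s
    by (subst exp_eq_polar) simp
  then have "\<gamma> s = of_real (cmod (\<gamma> s)) * cis (Im (\<Phi> s))" if "s \<in> {0<..1}" for s
    using \<Phi>(2)[OF that] by metis
  then have "\<forall>s\<in>{0<..1}. \<gamma> s = of_real (cmod (\<gamma> s)) * cis (2 * pi * (Im (\<Phi> s) / (2 * pi)))"
    by simp
  moreover have "continuous_on {0<..1} (\<lambda>s. Im (\<Phi> s) / (2 * pi))" using \<Phi>(1) by (intro continuous_intros) simp_all
  ultimately show ?thesis by blast
qed

section \<open>Cyclic order of local arms under an embedding\<close>

context graph_tree
begin

text \<open>\<open>T\<close> is compact and the plane is Hausdorff, so continuous injections are
  closed maps.\<close>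

lemma embedding_map_iff:
  fixes e :: "'a \<Rightarrow> complex"
  shows "embedding_map (top_of_set T) euclidean e \<longleftrightarrow> continuous_on T e \<and> inj_on e T"
proof
  assume "embedding_map (top_of_set T) euclidean e"
  then have h: "homeomorphic_map (top_of_set T) (subtopology euclidean (e ` T)) e"
    by (simp add: embedding_map_def)
  then have "continuous_on T e"
    using homeomorphic_imp_continuous_map[OF h] continuous_map_in_subtopology by auto
  moreover have "inj_on e T" using homeomorphic_imp_injective_map[OF h] by simp
  ultimately show "continuous_on T e \<and> inj_on e T" ..
next
  assume e: "continuous_on T e \<and> inj_on e T"
  have "closed_map (top_of_set T) (euclidean :: complex topology) e"
    using e T_compact by (intro continuous_imp_closed_map)
      (auto simp: compact_space_subtopology Hausdorff_space_euclidean)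
  then show "embedding_map (top_of_set T) euclidean e"
    using e by (intro injective_closed_imp_embedding_map) auto
qed

text \<open>The compact image of \<open>T - N\<close> misses \<open>e x\<close> and thus stays away
  from it.\<close>

lemma dist_near:
  fixes e :: "'a \<Rightarrow> complex"
  assumes "continuous_on T e" "inj_on e T" "x \<in> T" "open N" "x \<in> N"
  obtains R where "0 < R" "\<And>z. z \<in> T \<Longrightarrow> dist (e x) (e z) < R \<Longrightarrow> z \<in> N"
proof -
  have "compact (e ` (T - N))"
    using T_compact assms(1,4) by (meson Diff_subset compact_continuous_image compact_diff continuous_on_subset)
  moreover have "e x \<notin> e ` (T - N)" using assms by (auto dest: inj_onD)
  ultimately have "open (- e ` (T - N))" "e x \<in> - e ` (T - N)" using compact_imp_closed by blast+
  then obtain R where R: "0 < R" "ball (e x) R \<subseteq> - e ` (T - N)" using open_contains_ball by metis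
  show ?thesis
  proof (rule that[OF R(1)])
    fix z assume "z \<in> T" "dist (e x) (e z) < R"
    then show "z \<in> N" using R(2) by (metis ComplD DiffI imageI mem_ball subsetD)
  qed
qed

definition arm_path :: "'a \<Rightarrow> 'a filter \<Rightarrow> (real \<Rightarrow> 'a) \<Rightarrow> bool" where
  "arm_path x a g \<longleftrightarrow> arc g \<and> g 0 = x \<and> g ` {0..1} \<subseteq> T \<and> a = dir x (g 1)"

lemma arm_path_exists:
  assumes "x \<in> T" "a \<in> local_arms T x" obtains g where "arm_path x a g"
proof -
  obtain p where p: "p \<in> T" "p \<noteq> x" "a = dir x p" using assms local_arms_eq by auto
  obtain g where g: "arc g" "g 0 = x" "g 1 = p" "seg x p = g ` {0..1}"
    using joinsE[OF seg_joins[OF assms(1) p(1)]] p(2) by metis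
  then have "arm_path x a g" using p(3) seg_subset[OF assms(1) p(1)] by (simp add: arm_path_def)
  then show ?thesis using that by blast
qed

lemma arm_path_seg:
  assumes "arm_path x a g" "0 < s" "s \<le> 1"
  shows "seg x (g s) = g ` {0..s}" "g s \<in> T" "g s \<noteq> x" "dir x (g s) = a"
proof -
  have g: "arc g" "g 0 = x" "g ` {0..1} \<subseteq> T" "a = dir x (g 1)" using assms(1) by (auto simp: arm_path_def)
  have xT: "x \<in> T" and 1: "g 1 \<in> T" and sT: "g s \<in> T" using g(2,3) assms(2,3) by auto
  have sub: "g ` {0..s} \<subseteq> T" using g(3) assms(3) by (meson atLeastatMost_subset_iff image_mono order_refl subset_trans)
  have j: "joins (g ` {0..t}) x (g t)" if "0 < t" "t \<le> 1" for t using joins_subarc[OF g(1), of 0 t] that g(2) by simp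
  show s: "seg x (g s) = g ` {0..s}" using seg_eqI[OF j[OF assms(2,3)] sub] .
  have s1: "seg x (g 1) = g ` {0..1}" using seg_eqI[OF j g(3)] by simp
  show "g s \<in> T" by (rule sT)
  show ne: "g s \<noteq> x" using joins_neq[OF j[OF assms(2,3)]] by simp
  have ne1: "g 1 \<noteq> x" using joins_neq[OF j[of 1]] by simp
  have "g s \<in> seg x (g 1)" using s1 assms(2,3) by simp
  then have "g s \<in> arm x (g 1)" using seg_arm[OF xT 1] ne by blast
  then show "dir x (g s) = a" using dir_eq_iff[OF xT 1 ne1 sT ne] g(4) by simp
qed

text \<open>The radius is bounded twice: by \<open>R1\<close>, so that points of the arm on a
  smaller circle lie on the given arc, and by the distance of the far end, so that the arc does
  reach the circle.\<close>

lemma arm_path_first_exit: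
  fixes e :: "'a \<Rightarrow> complex"
  assumes e: "continuous_on T e" "inj_on e T" and xT: "x \<in> T" and g: "arm_path x a g"
  obtains R where "0 < R" "R \<le> cmod (e (g 1) - e x)"
    "\<And>r u. 0 < r \<Longrightarrow> r < R \<Longrightarrow> first_exit e T x r a u \<longleftrightarrow> (\<exists>s. u = g s \<and> hit (\<lambda>s. e (g s) - e x) r s)"
proof -
  note g1 = arm_path_seg[OF g, of 1]
  have p: "g 1 \<in> T" "g 1 \<noteq> x" "dir x (g 1) = a" "seg x (g 1) = g ` {0..1}" using g1 by simp_all
  have inj: "inj_on g {0..1}" using g by (auto simp: arm_path_def arc_def)
  obtain N where N: "open N" "x \<in> N" "N \<inter> arm x (g 1) \<subseteq> seg x (g 1)" using arm_local[OF xT p(1,2)] .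
  obtain R1 where R1: "0 < R1" "\<And>z. z \<in> T \<Longrightarrow> dist (e x) (e z) < R1 \<Longrightarrow> z \<in> N"
    by (rule dist_near[OF e xT N(1,2)]) blast
  define R where "R = min R1 (cmod (e (g 1) - e x))"
  have "e (g 1) \<noteq> e x" using e(2) p(1,2) xT by (auto dest: inj_onD)
  then have "0 < R" using R1(1) by (simp add: R_def)
  moreover have "R \<le> cmod (e (g 1) - e x)" by (simp add: R_def)
  moreover have "first_exit e T x r a u \<longleftrightarrow> (\<exists>s. u = g s \<and> hit (\<lambda>s. e (g s) - e x) r s)"
    if r: "0 < r" "r < R" for r u
  proof
    assume fe: "first_exit e T x r a u"
    then obtain A where A: "A \<in> arms T x" "a = at x within A" "u \<in> A" "dist (e x) (e u) = r"
      "\<And>z. z \<in> tree_arc T x u - {u} \<Longrightarrow> dist (e x) (e z) < r" by (auto simp: first_exit_def)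
    obtain q where q: "q \<in> T" "q \<noteq> x" "A = arm x q" using A(1) arms_eq[OF xT] by auto
    have "dir x (g 1) = dir x q" using A(2) q(3) p(3) by (simp add: dir_of_def)
    then have "u \<in> arm x (g 1)" using dir_eq_iff[OF xT p(1,2) q(1,2)] arm_eq[OF p(1,2)] A(3) q(3) by simp
    moreover from this have uT: "u \<in> T" "u \<noteq> x" by (auto simp: arm_iff)
    then have "u \<in> N" using R1(2)[of u] A(4) r by (simp add: R_def)
    ultimately have "u \<in> g ` {0..1}" using N(3) p(4) by blast
    then obtain s where s: "s \<in> {0..1}" "u = g s" by blast
    have "g 0 = x" using g by (simp add: arm_path_def)
    then have s01: "0 < s" "s \<le> 1" using s uT(2) by (auto simp: less_le)
    have ta: "tree_arc T x u = g ` {0..s}"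
      using arm_path_seg(1)[OF g s01] s(2) uT(2) by (simp add: tree_seg_def split: if_splits)
    have "cmod (e (g s') - e x) < r" if s': "0 \<le> s'" "s' < s" for s'
    proof -
      have "g s' \<noteq> g s" using inj_onD[OF inj, of s' s] s' s01 by auto
      then have "g s' \<in> tree_arc T x u - {u}" using ta s(2) s' by simp
      then show ?thesis using A(5) by (metis dist_commute dist_norm)
    qed
    moreover have "cmod (e (g s) - e x) = r" using A(4) s(2) by (metis dist_commute dist_norm)
    ultimately show "\<exists>s. u = g s \<and> hit (\<lambda>s. e (g s) - e x) r s" using s01 s(2) by (auto simp: hit_def)
  next
    assume "\<exists>s. u = g s \<and> hit (\<lambda>s. e (g s) - e x) r s"
    then obtain s where s: "u = g s" "0 < s" "s \<le> 1" "cmod (e (g s) - e x) = r"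
      "\<And>s'. 0 \<le> s' \<Longrightarrow> s' < s \<Longrightarrow> cmod (e (g s') - e x) < r" by (auto simp: hit_def)
    note gs = arm_path_seg[OF g s(2,3)]
    have ta: "tree_arc T x u = g ` {0..s}" using gs(1,3) s(1) by (simp add: tree_seg_def split: if_splits)
    have "dist (e x) (e z) < r" if z: "z \<in> tree_arc T x u - {u}" for z
    proof -
      obtain s' where s': "s' \<in> {0..s}" "z = g s'" using z ta by blast
      then have "s' < s" using z s(1) by (cases "s' = s") auto
      then show ?thesis using s(5)[of s'] s' by (metis atLeastAtMost_iff dist_commute dist_norm)
    qed
    moreover have "dist (e x) (e u) = r" using s(1,4) by (metis dist_commute dist_norm)
    moreover have "arm x (g s) \<in> arms T x" using arms_eq[OF xT] gs(2,3) by auto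
    moreover have "a = at x within arm x (g s)" using gs(4) by (simp add: dir_of_def)
    moreover have "u \<in> arm x (g s)" using arm_refl[OF gs(2,3)] s(1) by simp
    ultimately show "first_exit e T x r a u" unfolding first_exit_def by blast
  qed
  ultimately show ?thesis using that by blast
qed

text \<open>Angles read off at one small circle decide \<open>arms_ccw\<close>, which speaks of all
  small circles: the lifted arguments along the arcs have pairwise differences confined between
  integers that are the same for all radii.\<close>

lemma arms_ccw_iff_turns:
  fixes e :: "'a \<Rightarrow> complex"
  assumes e: "continuous_on T e" "inj_on e T" and xT: "x \<in> T"
  shows "\<exists>R>0. (\<forall>r a. 0 < r \<and> r < R \<and> a \<in> local_arms T x \<longrightarrow> (\<exists>u. first_exit e T x r a u)) \<and>
    (\<forall>r ang. 0 < r \<and> r < R \<and>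
      (\<forall>a\<in>local_arms T x. \<exists>u. first_exit e T x r a u \<and> e u = e x + rcis r (2 * pi * ang a)) \<longrightarrow>
      (\<forall>a\<in>local_arms T x. \<forall>b\<in>local_arms T x. \<forall>d\<in>local_arms T x.
         arms_ccw e T x a b d \<longleftrightarrow> ccw_turns (ang a) (ang b) (ang d)))"
proof -
  define LA where "LA = local_arms T x"
  have "\<forall>a\<in>LA. \<exists>g. arm_path x a g" using arm_path_exists[OF xT] unfolding LA_def by metis
  then obtain G where G: "\<And>a. a \<in> LA \<Longrightarrow> arm_path x a (G a)" by metis
  define \<gamma> where "\<gamma> a s = e (G a s) - e x" for a s
  have "\<forall>a\<in>LA. \<exists>R. 0 < R \<and> R \<le> cmod (\<gamma> a 1) \<and>
    (\<forall>r u. 0 < r \<and> r < R \<longrightarrow> (first_exit e T x r a u \<longleftrightarrow> (\<exists>s. u = G a s \<and> hit (\<gamma> a) r s)))"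
  proof
    fix a assume a: "a \<in> LA"
    have "\<gamma> a = (\<lambda>s. e (G a s) - e x)" by (simp add: \<gamma>_def fun_eq_iff)
    then show "\<exists>R. 0 < R \<and> R \<le> cmod (\<gamma> a 1) \<and>
      (\<forall>r u. 0 < r \<and> r < R \<longrightarrow> (first_exit e T x r a u \<longleftrightarrow> (\<exists>s. u = G a s \<and> hit (\<gamma> a) r s)))"
      using arm_path_first_exit[OF e xT G[OF a]] by metis
  qed
  then obtain Rf where Rf: "\<And>a. a \<in> LA \<Longrightarrow> 0 < Rf a" "\<And>a. a \<in> LA \<Longrightarrow> Rf a \<le> cmod (\<gamma> a 1)"
    "\<And>a r u. a \<in> LA \<Longrightarrow> 0 < r \<Longrightarrow> r < Rf a \<Longrightarrow> first_exit e T x r a u \<longleftrightarrow> (\<exists>s. u = G a s \<and> hit (\<gamma> a) r s)"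
    by metis
  define R where "R = Min (insert 1 (Rf ` LA))"
  have finLA: "finite LA" using finite_local_arms[OF xT] by (simp add: LA_def)
  have R0: "0 < R" unfolding R_def using Rf(1) finLA by (subst Min_gr_iff) auto
  have RR: "R \<le> Rf a" if "a \<in> LA" for a unfolding R_def using finLA that by (intro Min_le) auto
  have cont: "continuous_on {0..1} (\<gamma> a)" if a: "a \<in> LA" for a
  proof -
    have "continuous_on {0..1} (G a)" "G a ` {0..1} \<subseteq> T" using G[OF a] by (auto simp: arm_path_def arc_def path_def)
    then have "continuous_on {0..1} (\<lambda>s. e (G a s))" using continuous_on_compose2[OF e(1)] by blast
    then show ?thesis unfolding \<gamma>_def by (intro continuous_intros)
  qed
  have z: "\<gamma> a 0 = 0" if "a \<in> LA" for a using G[OF that] by (simp add: \<gamma>_def arm_path_def)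
  have GT: "G a s \<in> T" if "a \<in> LA" "s \<in> {0..1}" for a s using G[OF that(1)] that(2) by (auto simp: arm_path_def)
  have G0: "G a 0 = x" if "a \<in> LA" for a using G[OF that] by (simp add: arm_path_def)
  have ne: "\<gamma> a s \<noteq> \<gamma> b t"
    if ab: "a \<in> LA" "b \<in> LA" "a \<noteq> b" and st: "s \<in> {0..1}" "t \<in> {0..1}" "(s, t) \<noteq> (0, 0)" for a b s t
  proof
    assume "\<gamma> a s = \<gamma> b t"
    then have "e (G a s) = e (G b t)" by (simp add: \<gamma>_def)
    then have eq: "G a s = G b t" using inj_onD[OF e(2)] GT[OF ab(1) st(1)] GT[OF ab(2) st(2)] by blast
    have A: "G a s \<noteq> x \<and> dir x (G a s) = a" if "s \<noteq> 0"
      using arm_path_seg(3,4)[OF G[OF ab(1)], of s] st(1) that by auto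
    have B: "G b t \<noteq> x \<and> dir x (G b t) = b" if "t \<noteq> 0"
      using arm_path_seg(3,4)[OF G[OF ab(2)], of t] st(2) that by auto
    show False using A B eq G0[OF ab(1)] G0[OF ab(2)] st(3) ab(3) by (cases "s = 0"; cases "t = 0") auto
  qed
  have nz: "\<gamma> a s \<noteq> 0" if a: "a \<in> LA" and s: "s \<in> {0<..1}" for a s
  proof
    assume "\<gamma> a s = 0"
    then have "e (G a s) = e x" by (simp add: \<gamma>_def)
    then have "G a s = x" using inj_onD[OF e(2)] GT[OF a, of s] xT s by auto
    then show False using arm_path_seg(3)[OF G[OF a], of s] s by auto
  qed
  have "\<forall>a\<in>LA. \<exists>L. continuous_on {0<..1} L \<and> (\<forall>s\<in>{0<..1}. \<gamma> a s = of_real (cmod (\<gamma> a s)) * cis (2 * pi * L s))"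
  proof
    fix a assume a: "a \<in> LA"
    have "continuous_on {0<..1} (\<gamma> a)" by (rule continuous_on_subset[OF cont[OF a]]) auto
    then show "\<exists>L. continuous_on {0<..1} L \<and> (\<forall>s\<in>{0<..1}. \<gamma> a s = of_real (cmod (\<gamma> a s)) * cis (2 * pi * L s))"
      using turn_lift_exists nz[OF a] by blast
  qed
  then obtain L where L: "\<And>a. a \<in> LA \<Longrightarrow> continuous_on {0<..1} (L a)"
    "\<And>a s. a \<in> LA \<Longrightarrow> s \<in> {0<..1} \<Longrightarrow> \<gamma> a s = of_real (cmod (\<gamma> a s)) * cis (2 * pi * L a s)" by metis
  have gap: "\<exists>k::int. \<forall>r s t. hit (\<gamma> b) r s \<longrightarrow> hit (\<gamma> a) r t \<longrightarrow> of_int k < L b s - L a t \<and> L b s - L a t < of_int k + 1"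
    if ab: "a \<in> LA" "b \<in> LA" "a \<noteq> b" for a b
  proof -
    have ba: "b \<noteq> a" using ab(3) by simp
    show ?thesis
      by (rule first_hits_turn_gap[OF cont[OF ab(2)] cont[OF ab(1)] z[OF ab(2)] z[OF ab(1)]
          ne[OF ab(2,1) ba] L(1)[OF ab(2)] L(2)[OF ab(2)] L(1)[OF ab(1)] L(2)[OF ab(1)]]) blast+
  qed
  define H where "H a r = (SOME s. hit (\<gamma> a) r s)" for a r
  have H: "hit (\<gamma> a) r (H a r)" if "a \<in> LA" "0 < r" "r < R" for a r
  proof -
    have "r \<le> cmod (\<gamma> a 1)" using that(3) RR[OF that(1)] Rf(2)[OF that(1)] by linarith
    then have "\<exists>s. hit (\<gamma> a) r s" using hit_exists[OF cont[OF that(1)] z[OF that(1)] that(2)] by blast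
    then show ?thesis unfolding H_def by (rule someI_ex)
  qed
  have fe: "first_exit e T x r a u \<longleftrightarrow> u = G a (H a r)" if h: "a \<in> LA" "0 < r" "r < R" for a r u
  proof -
    have "r < Rf a" using h(3) RR[OF h(1)] by linarith
    then show ?thesis using Rf(3)[OF h(1,2), of u] H[OF h] hit_unique by metis
  qed
  define A where "A a r = L a (H a r)" for a r
  have eG: "e (G a (H a r)) = e x + rcis r (2 * pi * A a r)" if h: "a \<in> LA" "0 < r" "r < R" for a r
  proof -
    have "H a r \<in> {0<..1}" "cmod (\<gamma> a (H a r)) = r" using H[OF h] by (auto simp: hit_def)
    then have "\<gamma> a (H a r) = of_real r * cis (2 * pi * A a r)" using L(2)[OF h(1), of "H a r"] by (simp add: A_def)
    then show ?thesis by (simp add: \<gamma>_def rcis_def algebra_simps)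
  qed
  have circ: "(\<exists>u v w \<alpha> \<beta> \<gamma>. first_exit e T x r a u \<and> first_exit e T x r b v \<and> first_exit e T x r d w \<and>
        e u = e x + rcis r \<alpha> \<and> e v = e x + rcis r \<beta> \<and> e w = e x + rcis r \<gamma> \<and>
        \<alpha> < \<beta> \<and> \<beta> < \<gamma> \<and> \<gamma> < \<alpha> + 2 * pi) \<longleftrightarrow> ccw_turns (A a r) (A b r) (A d r)"
    if abd: "a \<in> LA" "b \<in> LA" "d \<in> LA" and r: "0 < r" "r < R" for a b d r
    unfolding ccw_angles_iff[OF r(1), symmetric]
    by (simp add: fe[OF abd(1) r] fe[OF abd(2) r] fe[OF abd(3) r] eG[OF abd(1) r] eG[OF abd(2) r] eG[OF abd(3) r])
  have const: "ccw_turns (A a r) (A b r) (A d r) \<longleftrightarrow> ccw_turns (A a r') (A b r') (A d r')"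
    if abd: "a \<in> LA" "b \<in> LA" "d \<in> LA" and r: "0 < r" "r < R" "0 < r'" "r' < R" for a b d r r'
  \<comment> \<open>With a repeated arm both sides fail; otherwise the three integers
    \<open>k1\<close>, \<open>k2\<close>, \<open>k3\<close> do not depend on the radius.\<close>
  proof (cases "a \<noteq> b \<and> a \<noteq> d \<and> b \<noteq> d")
    case False
    then have "\<not> ccw_turns (A a t) (A b t) (A d t)" for t
      using ccw_turns_distinct[of "A a t" "A b t" "A d t"] by auto
    then show ?thesis by blast
  next
    case True
    obtain k1 :: int where k1: "\<forall>r s t. hit (\<gamma> b) r s \<longrightarrow> hit (\<gamma> a) r t \<longrightarrow> of_int k1 < L b s - L a t \<and> L b s - L a t < of_int k1 + 1"
      using gap[OF abd(1,2)] True by blast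
    obtain k2 :: int where k2: "\<forall>r s t. hit (\<gamma> d) r s \<longrightarrow> hit (\<gamma> a) r t \<longrightarrow> of_int k2 < L d s - L a t \<and> L d s - L a t < of_int k2 + 1"
      using gap[OF abd(1,3)] True by blast
    obtain k3 :: int where k3: "\<forall>r s t. hit (\<gamma> d) r s \<longrightarrow> hit (\<gamma> b) r t \<longrightarrow> of_int k3 < L d s - L b t \<and> L d s - L b t < of_int k3 + 1"
      using gap[OF abd(2,3)] True by blast
    have "ccw_turns (A a t) (A b t) (A d t) \<longleftrightarrow> k2 - k1 \<le> k3" if t: "0 < t" "t < R" for t
      using ccw_turns_gap[of k1 "A b t" "A a t" k2 "A d t" k3] k1 k2 k3
        H[OF abd(1) t] H[OF abd(2) t] H[OF abd(3) t] unfolding A_def by blast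
    then show ?thesis using r by blast
  qed
  have "arms_ccw e T x a b d \<longleftrightarrow> ccw_turns (A a r) (A b r) (A d r)"
    if abd: "a \<in> LA" "b \<in> LA" "d \<in> LA" and r: "0 < r" "r < R" for a b d r
  proof -
    have ev: "\<forall>\<^sub>F t in at_right 0. 0 < t \<and> t < R"
      unfolding eventually_at_right_field using R0 by blast
    define P where "P t \<longleftrightarrow> (\<exists>u v w \<alpha> \<beta> \<gamma>. first_exit e T x t a u \<and> first_exit e T x t b v \<and>
        first_exit e T x t d w \<and> e u = e x + rcis t \<alpha> \<and> e v = e x + rcis t \<beta> \<and> e w = e x + rcis t \<gamma> \<and>
        \<alpha> < \<beta> \<and> \<beta> < \<gamma> \<and> \<gamma> < \<alpha> + 2 * pi)" for t
    have P: "P t \<longleftrightarrow> ccw_turns (A a r) (A b r) (A d r)" if t: "0 < t \<and> t < R" for t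
      unfolding P_def using circ[OF abd, of t] const[OF abd, of t r] t r by blast
    have "arms_ccw e T x a b d \<longleftrightarrow> eventually P (at_right 0)"
      unfolding arms_ccw_def P_def by (rule refl)
    also have "\<dots> \<longleftrightarrow> eventually (\<lambda>t. ccw_turns (A a r) (A b r) (A d r)) (at_right (0::real))"
      by (rule eventually_subst[OF eventually_mono[OF ev P]])
    finally show ?thesis by simp
  qed note turns = this
  \<comment> \<open>Any other choice of angles on the same circle differs from the lifts by
    integers.\<close>
  have sh: "\<exists>i::int. ang a = A a r + of_int i"
    if a: "a \<in> LA" and r: "0 < r" "r < R" and u: "first_exit e T x r a u" "e u = e x + rcis r (2 * pi * ang a)"
    for r ang a u
  proof -
    have "rcis r (2 * pi * ang a) = rcis r (2 * pi * A a r)" using u eG[OF a r] fe[OF a r] by simp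
    then obtain i :: int where "2 * pi * ang a = 2 * pi * (A a r + of_int i)" using rcis_turns_eq_iff[OF r(1)] by blast
    then show ?thesis by auto
  qed
  show ?thesis
    unfolding LA_def[symmetric]
  proof (intro exI[of _ R] conjI allI impI ballI R0)
    fix r a assume "0 < r \<and> r < R \<and> a \<in> LA"
    then show "\<exists>u. first_exit e T x r a u" using fe by blast
  next
    fix r ang a b d
    assume h: "0 < r \<and> r < R \<and> (\<forall>a\<in>LA. \<exists>u. first_exit e T x r a u \<and> e u = e x + rcis r (2 * pi * ang a))"
      and abd: "a \<in> LA" "b \<in> LA" "d \<in> LA"
    have "\<exists>i::int. ang a' = A a' r + of_int i" if "a' \<in> LA" for a' using sh[OF that] h that by metis
    then obtain i j k :: int where "ang a = A a r + of_int i" "ang b = A b r + of_int j" "ang d = A d r + of_int k"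
      using abd by metis
    then have "ccw_turns (ang a) (ang b) (ang d) \<longleftrightarrow> ccw_turns (A a r) (A b r) (A d r)" by (simp add: ccw_turns_shift)
    then show "arms_ccw e T x a b d \<longleftrightarrow> ccw_turns (ang a) (ang b) (ang d)" using turns[OF abd] h by blast
  qed
qed

end

section \<open>Embeddings with straight edges\<close>

context graph_tree
begin

lemma V_nonempty: "V \<noteq> {}"
proof
  assume "V = {}"
  then have "E = {}" using edge_ends(1) by blast
  then show False using \<open>V = {}\<close> T_eq T_nonempty by simp
qed

text \<open>The part of the tree drawn so far. The vertex \<open>v\<close> is the starting point and
  keeps it nonempty while \<open>F\<close> is empty.\<close>

definition edge_union :: "'a \<Rightarrow> (real \<Rightarrow> 'a) set \<Rightarrow> 'a set" where
  "edge_union v F = insert v (\<Union>g\<in>F. path_image g)"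

lemma edge_union_subset: "v \<in> V \<Longrightarrow> F \<subseteq> E \<Longrightarrow> edge_union v F \<subseteq> T"
  using V_subset edge_subset by (auto simp: edge_union_def)

lemma edge_union_closed:
  assumes "F \<subseteq> E" shows "closed (edge_union v F)"
proof -
  have "closed (\<Union>g\<in>F. path_image g)"
    using finite_subset[OF assms finE] edge_closed assms by (intro closed_UN) auto
  then show ?thesis unfolding edge_union_def by (rule closed_insert)
qed

text \<open>If no remaining edge touched the drawn part, this part and the remaining vertices and
  edges would be disjoint closed sets covering the connected \<open>T\<close>.\<close>

lemma edge_union_adjacent:
  assumes v: "v \<in> V" and F: "F \<subseteq> E" and ne: "F \<noteq> E \<or> edge_union v F \<noteq> T"
  shows "\<exists>g\<in>E - F. path_image g \<inter> edge_union v F \<noteq> {}"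
proof (rule ccontr)
  assume no: "\<not> ?thesis"
  define K where "K = (V - edge_union v F) \<union> (\<Union>g\<in>E - F. path_image g)"
  have "closed K"
    unfolding K_def by (rule closed_Un[OF finite_imp_closed closed_UN]) (simp_all add: finV finE edge_closed)
  moreover have disj: "edge_union v F \<inter> K = {}" using no unfolding K_def by blast
  moreover have cov: "T \<subseteq> edge_union v F \<union> K"
  proof
    fix q assume "q \<in> T"
    then consider "q \<in> V" | g where "g \<in> E" "q \<in> path_image g" using T_eq by blast
    then show "q \<in> edge_union v F \<union> K"
    proof cases
      case 2
      then show ?thesis by (cases "g \<in> F") (auto simp: K_def edge_union_def)
    qed (auto simp: K_def)
  qed
  ultimately have "edge_union v F \<inter> T = {} \<or> K \<inter> T = {}"
    using connected_closedD[OF T_connected _ cov edge_union_closed[OF F]] by blast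
  moreover have "v \<in> edge_union v F \<inter> T" using v V_subset by (auto simp: edge_union_def)
  ultimately have KT: "K \<inter> T = {}" by blast
  have "edge_union v F = T" using cov KT edge_union_subset[OF v F] by blast
  then obtain g where g: "g \<in> E - F" using ne F by blast
  have "pathstart g \<in> path_image g" by blast
  then show False using KT g edge_subset[of g] unfolding K_def by blast
qed

text \<open>A common point of \<open>g\<close> and the drawn part is a vertex. If both ends were
  drawn, convexity would put all of \<open>g\<close> into the drawn part, including points that are
  no vertices. So a new edge is attached at exactly one end.\<close>

lemma edge_union_meets:
  assumes v: "v \<in> V" and F: "F \<subseteq> E"
    and conv: "\<forall>p\<in>edge_union v F. \<forall>q\<in>edge_union v F. seg p q \<subseteq> edge_union v F"
    and g: "g \<in> E - F" and w: "w \<in> path_image g \<inter> edge_union v F"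
  shows "w \<in> {pathstart g, pathfinish g}"
    "\<not> (pathstart g \<in> edge_union v F \<and> pathfinish g \<in> edge_union v F)"
proof -
  have inV: "u \<in> V" if u: "u \<in> path_image g" "u \<in> edge_union v F" for u
  proof (rule ccontr)
    assume "u \<notin> V"
    then obtain h where h: "h \<in> F" "u \<in> path_image h" using u(2) v by (auto simp: edge_union_def)
    then have "h \<in> E" "g \<in> E" "g \<noteq> h" using g F by auto
    then show False using edge_edge[of g h] u(1) h(2) \<open>u \<notin> V\<close> by blast
  qed
  have gE: "g \<in> E" using g by simp
  show "w \<in> {pathstart g, pathfinish g}" using inV[of w] w edge_V[OF gE] by blast
  show "\<not> (pathstart g \<in> edge_union v F \<and> pathfinish g \<in> edge_union v F)"
  proof
    assume "pathstart g \<in> edge_union v F \<and> pathfinish g \<in> edge_union v F"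
    then have sub: "path_image g \<subseteq> edge_union v F" using conv edge_seg[OF gE] by metis
    obtain z where z: "z \<in> path_image g" "z \<noteq> pathstart g" "z \<noteq> pathfinish g"
      by (rule arc_interior_point[OF edge_arc[OF gE]])
    then have "z \<in> V" using inV sub by blast
    then show False using z edge_V[OF gE] by blast
  qed
qed

text \<open>A straight edge has a prescribed direction at each of its two ends, so the conditions
  below are imposed on both orientations.\<close>

definition oriented :: "(real \<Rightarrow> 'a) \<Rightarrow> (real \<Rightarrow> 'a) \<Rightarrow> bool" where
  "oriented \<gamma> g \<longleftrightarrow> \<gamma> = g \<or> \<gamma> = reversepath g"

lemma oriented_facts:
  assumes "oriented \<gamma> g" "g \<in> E"
  shows "arc \<gamma>" "path_image \<gamma> = path_image g" "{\<gamma> 0, \<gamma> 1} = {pathstart g, pathfinish g}" "seg (\<gamma> 0) (\<gamma> 1) = path_image g"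
    "\<gamma> 0 \<in> V" "\<gamma> 1 \<in> V" "\<gamma> 0 \<noteq> \<gamma> 1"
proof -
  show a: "arc \<gamma>" using assms edge_arc arc_reversepath unfolding oriented_def by blast
  show i: "path_image \<gamma> = path_image g" using assms(1) by (auto simp: oriented_def)
  show e: "{\<gamma> 0, \<gamma> 1} = {pathstart g, pathfinish g}"
    using assms(1) by (auto simp: oriented_def reversepath_def pathstart_def pathfinish_def)
  have "joins (path_image \<gamma>) (\<gamma> 0) (\<gamma> 1)" using a unfolding joins_def by (auto simp: pathstart_def pathfinish_def)
  then show "seg (\<gamma> 0) (\<gamma> 1) = path_image g" using seg_eqI edge_subset[OF assms(2)] i by simp
  show "\<gamma> 0 \<in> V" "\<gamma> 1 \<in> V" using e edge_ends[OF assms(2)] by (metis insert_iff singletonD)+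
  show "\<gamma> 0 \<noteq> \<gamma> 1" using arc_distinct_ends[OF a] by (simp add: pathstart_def pathfinish_def)
qed

lemma oriented_from:
  assumes "g \<in> E" "w \<in> {pathstart g, pathfinish g}"
  obtains \<gamma> where "oriented \<gamma> g" "\<gamma> 0 = w"
proof (cases "w = pathstart g")
  case True
  then show ?thesis using that[of g] by (simp add: oriented_def pathstart_def)
next
  case False
  then show ?thesis using assms that[of "reversepath g"]
    by (simp add: oriented_def pathfinish_def reversepath_def)
qed

definition turn_assignment :: "('a \<Rightarrow> 'a filter \<Rightarrow> real) \<Rightarrow> bool" where
  "turn_assignment ang \<longleftrightarrow>
     (\<forall>x\<in>V. \<forall>a\<in>local_arms T x. \<forall>b\<in>local_arms T x. a \<noteq> b \<longrightarrow> ang x a - ang x b \<notin> \<int>)"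

definition straight :: "('a \<Rightarrow> 'a filter \<Rightarrow> real) \<Rightarrow> ('a \<Rightarrow> complex) \<Rightarrow> ('a \<Rightarrow> real) \<Rightarrow> (real \<Rightarrow> 'a) \<Rightarrow> bool" where
  "straight ang e \<rho> \<gamma> \<longleftrightarrow> (\<exists>l>0. \<forall>t\<in>{0..1}.
     e (\<gamma> t) = e (\<gamma> 0) + of_real (t * l) * cis (2 * pi * (\<rho> (\<gamma> 0) + ang (\<gamma> 0) (dir (\<gamma> 0) (\<gamma> 1)))))"

text \<open>\<^term>\<open>\<rho>\<close> records by how much the prescribed directions at each vertex have
  been rotated.\<close>

definition partial_embedding ::
    "('a \<Rightarrow> 'a filter \<Rightarrow> real) \<Rightarrow> 'a \<Rightarrow> (real \<Rightarrow> 'a) set \<Rightarrow> ('a \<Rightarrow> complex) \<Rightarrow> ('a \<Rightarrow> real) \<Rightarrow> bool" where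
  "partial_embedding ang v F e \<rho> \<longleftrightarrow>
     (\<forall>p\<in>edge_union v F. \<forall>q\<in>edge_union v F. seg p q \<subseteq> edge_union v F) \<and>
     continuous_on (edge_union v F) e \<and> inj_on e (edge_union v F) \<and>
     (\<forall>g\<in>F. \<forall>\<gamma>. oriented \<gamma> g \<longrightarrow> straight ang e \<rho> \<gamma>)"

text \<open>Near \<open>e p\<close> the drawn part consists of segments in other prescribed
  directions, from the drawn edges at \<open>p\<close>; everything else drawn is compact and stays
  away from \<open>e p\<close>. Finitely many conditions leave a short segment free.\<close>

lemma free_direction:
  assumes ang: "turn_assignment ang"
    and v: "v \<in> V" and F: "F \<subseteq> E" and pe: "partial_embedding ang v F e \<rho>"
    and p: "p \<in> V" "p \<in> edge_union v F" and q: "q \<in> T" "q \<noteq> p" "seg p q \<inter> edge_union v F = {p}"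
  shows "\<forall>\<^sub>F s in at_right 0. e p + of_real s * cis (2 * pi * (\<rho> p + ang p (dir p q))) \<notin> e ` edge_union v F"
proof -
  let ?\<theta> = "2 * pi * (\<rho> p + ang p (dir p q))"
  let ?S = "edge_union v F"
  have cont: "continuous_on ?S e" and inj: "inj_on e ?S" using pe by (simp_all add: partial_embedding_def)
  have pT: "p \<in> T" using p(1) V_subset by blast
  have away: "\<forall>\<^sub>F s in at_right 0. e p + of_real s * cis ?\<theta> \<notin> e ` K" if K: "K \<subseteq> ?S" "p \<notin> K" "compact K" for K
  proof -
    have "compact (e ` K)" using K cont by (meson compact_continuous_image continuous_on_subset)
    then have "open (- e ` K)" using compact_imp_closed by blast
    moreover have "e p \<in> - e ` K" using inj K p(2) by (auto dest: inj_onD)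
    moreover have "((\<lambda>s. e p + of_real s * cis ?\<theta>) \<longlongrightarrow> e p + of_real 0 * cis ?\<theta>) (at_right 0)"
      by (intro tendsto_intros)
    ultimately have "\<forall>\<^sub>F s in at_right 0. e p + of_real s * cis ?\<theta> \<in> - e ` K"
      using topological_tendstoD by fastforce
    then show ?thesis by simp
  qed
  have pos: "\<forall>\<^sub>F s in at_right 0. (0::real) < s" by (simp add: eventually_at_filter)
  have single: "\<forall>\<^sub>F s in at_right 0. e p + of_real s * cis ?\<theta> \<notin> e ` {v}"
  proof (cases "p = v")
    case True
    show ?thesis by (rule eventually_mono[OF pos]) (simp add: True)
  next
    case False
    then show ?thesis by (intro away) (auto simp: edge_union_def)
  qed
  have edge: "\<forall>\<^sub>F s in at_right 0. e p + of_real s * cis ?\<theta> \<notin> e ` path_image h" if h: "h \<in> F" for h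
  proof (cases "p \<in> path_image h")
    case False
    have "h \<in> E" using h F by blast
    then have "compact (path_image h)" using compact_arc_image[OF edge_arc] by blast
    moreover have "path_image h \<subseteq> ?S" using h by (auto simp: edge_union_def)
    ultimately show ?thesis using away False by blast
  next
    case True
    have hE: "h \<in> E" using h F by blast
    then have "p \<in> {pathstart h, pathfinish h}" using edge_V[OF hE] True p(1) by blast
    then obtain \<eta> where \<eta>: "oriented \<eta> h" "\<eta> 0 = p" using oriented_from[OF hE] by metis
    note ori = oriented_facts[OF \<eta>(1) hE]
    have q': "\<eta> 1 \<in> T" "\<eta> 1 \<noteq> p" using ori(6,7) V_subset \<eta>(2) by auto
    \<comment> \<open>The new arc and the drawn edge meet in \<open>p\<close> only, so
      \<open>p\<close> separates their far ends and the directions are different.\<close>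
    have "seg p (\<eta> 1) \<subseteq> ?S" using ori(4) \<eta>(2) h by (auto simp: edge_union_def)
    then have "seg p (\<eta> 1) \<inter> seg p q \<subseteq> {p}" using q(3) by blast
    moreover have "p \<in> seg p (\<eta> 1)" "p \<in> seg p q" using pT q'(1) q(1) by simp_all
    ultimately have "seg (\<eta> 1) p \<inter> seg p q = {p}" unfolding seg_sym[OF pT q'(1)] by blast
    then have "seg (\<eta> 1) q = seg (\<eta> 1) p \<union> seg p q" using seg_concat[OF q'(1) pT q(1)] by simp
    then have "p \<in> seg (\<eta> 1) q" using pT q(1) by simp
    then have "q \<notin> arm p (\<eta> 1)" by (simp add: arm_iff)
    then have dne: "dir p q \<noteq> dir p (\<eta> 1)" using dir_eq_iff[OF pT q' q(1,2)] by simp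
    have "dir p q \<in> local_arms T p" "dir p (\<eta> 1) \<in> local_arms T p" using local_arms_eq[OF pT] q q' by auto
    then have nint: "ang p (dir p q) - ang p (dir p (\<eta> 1)) \<notin> \<int>" using ang p(1) dne unfolding turn_assignment_def by blast
    have "straight ang e \<rho> \<eta>" using pe h \<eta>(1) by (auto simp: partial_embedding_def)
    then obtain l where l: "0 < l" "\<And>t. t \<in> {0..1} \<Longrightarrow>
        e (\<eta> t) = e p + of_real (t * l) * cis (2 * pi * (\<rho> p + ang p (dir p (\<eta> 1))))"
      unfolding straight_def \<eta>(2) by blast
    have "e p + of_real s * cis ?\<theta> \<notin> e ` path_image h" if s: "0 < s" for s
    proof
      assume "e p + of_real s * cis ?\<theta> \<in> e ` path_image h"
      then obtain y where y: "e p + of_real s * cis ?\<theta> = e y" "y \<in> path_image h" by (rule imageE)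
      obtain t where "y = \<eta> t" "t \<in> {0..1}"
        using y(2)[folded ori(2), unfolded path_image_def] by (rule imageE)
      then have t: "t \<in> {0..1}" "e p + of_real s * cis ?\<theta> = e (\<eta> t)" using y(1) by simp_all
      then have eq: "of_real s * cis ?\<theta> = of_real (t * l) * cis (2 * pi * (\<rho> p + ang p (dir p (\<eta> 1))))"
        using l(2)[OF t(1)] by simp
      then have "cmod (of_real s * cis ?\<theta>) = cmod (of_real (t * l) * cis (2 * pi * (\<rho> p + ang p (dir p (\<eta> 1)))))"
        by simp
      then have "s = t * l" using s t(1) l(1) by (simp add: norm_mult abs_mult)
      then have "of_real s * cis ?\<theta> = of_real s * cis (2 * pi * (\<rho> p + ang p (dir p (\<eta> 1))))" using eq by simp
      then have "cis ?\<theta> = cis (2 * pi * (\<rho> p + ang p (dir p (\<eta> 1))))" using s by simp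
      then have "(\<rho> p + ang p (dir p q)) - (\<rho> p + ang p (dir p (\<eta> 1))) \<in> \<int>" by (rule turns_eq_imp_int)
      then show False using nint by simp
    qed
    then show ?thesis by (intro eventually_mono[OF pos])
  qed
  have "finite F" using F finE finite_subset by blast
  then have "\<forall>\<^sub>F s in at_right 0. \<forall>h\<in>F. e p + of_real s * cis ?\<theta> \<notin> e ` path_image h"
    using edge by (simp add: eventually_ball_finite)
  with single show ?thesis by (rule eventually_elim2) (auto simp: edge_union_def)
qed

lemma partial_embedding_extend:
  assumes ang: "turn_assignment ang"
    and v: "v \<in> V" and F: "F \<subseteq> E" and pe: "partial_embedding ang v F e \<rho>"
    and g: "g \<in> E - F" and meets: "path_image g \<inter> edge_union v F \<noteq> {}"
  shows "\<exists>e' \<rho>'. partial_embedding ang v (insert g F) e' \<rho>'"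
proof -
  let ?S = "edge_union v F"
  have gE: "g \<in> E" using g by simp
  have conv0: "\<forall>p\<in>?S. \<forall>q\<in>?S. seg p q \<subseteq> ?S" using pe by (simp add: partial_embedding_def)
  then have conv: "seg p q \<subseteq> ?S" if "p \<in> ?S" "q \<in> ?S" for p q
    using that by blast
  have cont: "continuous_on ?S e" and inj: "inj_on e ?S"
    and str: "\<And>h \<gamma>. h \<in> F \<Longrightarrow> oriented \<gamma> h \<Longrightarrow> straight ang e \<rho> \<gamma>"
    using pe by (simp_all add: partial_embedding_def)
  have ST: "?S \<subseteq> T" by (rule edge_union_subset[OF v F])
  obtain p where p: "p \<in> path_image g \<inter> ?S" using meets by blast
  note em = edge_union_meets[OF v F conv0 g]
  obtain \<gamma> where \<gamma>: "oriented \<gamma> g" "\<gamma> 0 = p" using oriented_from[OF gE em(1)[OF p]] by metis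
  note ori = oriented_facts[OF \<gamma>(1) gE]
  define q where "q = \<gamma> 1"
  have ends: "{p, q} = {pathstart g, pathfinish g}" using ori(3) \<gamma>(2) by (simp add: q_def)
  have pS: "p \<in> ?S" using p by simp
  have qS: "q \<notin> ?S" using em(2)[OF p] ends pS by (metis doubleton_eq_iff)
  have segpq: "seg p q = path_image g" using ori(4) \<gamma>(2) by (simp add: q_def)
  have int: "seg p q \<inter> ?S = {p}"
  proof
    show "seg p q \<inter> ?S \<subseteq> {p}"
    proof
      fix u assume "u \<in> seg p q \<inter> ?S"
      then have "u \<in> {p, q}" "u \<in> ?S" using em(1)[of u] ends segpq by simp_all
      then show "u \<in> {p}" using qS by blast
    qed
  qed (use p segpq in simp)
  have pV: "p \<in> V" and qV: "q \<in> V" and pq: "q \<noteq> p" using ori(5-7) \<gamma>(2) by (simp_all add: q_def)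
  have pT: "p \<in> T" and qT: "q \<in> T" using pV qV V_subset by auto
  define \<theta> where "\<theta> = 2 * pi * (\<rho> p + ang p (dir p q))"
  have "\<forall>\<^sub>F s in at_right 0. e p + of_real s * cis \<theta> \<notin> e ` ?S"
    using free_direction[OF ang v F pe pV pS qT pq int] unfolding \<theta>_def by simp
  then obtain b where b: "0 < b" "\<And>s. 0 < s \<Longrightarrow> s < b \<Longrightarrow> e p + of_real s * cis \<theta> \<notin> e ` ?S"
    unfolding eventually_at_right_field by blast
  \<comment> \<open>Half of the free length, so that the closed segment, with the new vertex at its
    end, is free as well.\<close>
  define l where "l = b / 2"
  have l: "0 < l" "\<And>s. 0 < s \<Longrightarrow> s \<le> l \<Longrightarrow> e p + of_real s * cis \<theta> \<notin> e ` ?S"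
    using b by (auto simp: l_def)
  obtain h where h: "homeomorphism {0..1} (path_image \<gamma>) \<gamma> h" by (rule homeomorphism_arc[OF ori(1)])
  then have hc: "continuous_on (path_image \<gamma>) h" and h\<gamma>: "\<And>t. t \<in> {0..1} \<Longrightarrow> h (\<gamma> t) = t"
    by (auto simp: homeomorphism_def)
  define n where "n y = e p + of_real (h y * l) * cis \<theta>" for y
  define e' where "e' y = (if y \<in> ?S then e y else n y)" for y
  have onS: "e' y = e y" if "y \<in> ?S" for y using that by (simp add: e'_def)
  have h0: "h p = 0" using h\<gamma>[of 0] \<gamma>(2) by simp
  have path: "e' (\<gamma> t) = e p + of_real (t * l) * cis \<theta>" if t: "t \<in> {0..1}" for t
  proof (cases "\<gamma> t \<in> ?S")
    case True
    have "\<gamma> t \<in> path_image \<gamma>" using t by (simp add: path_image_def)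
    then have "\<gamma> t = p" using True int segpq ori(2) by blast
    then show ?thesis using h\<gamma>[OF t] h0 pS by (simp add: e'_def)
  next
    case False
    then show ?thesis using h\<gamma>[OF t] by (simp add: e'_def n_def)
  qed
  have S': "edge_union v (insert g F) = ?S \<union> path_image \<gamma>" using ori(2) by (auto simp: edge_union_def)
  have "continuous_on (?S \<union> path_image \<gamma>) e'"
    unfolding e'_def
  proof (rule continuous_on_cases[OF edge_union_closed[OF F] _ cont])
    show "closed (path_image \<gamma>)" using closed_arc_image[OF ori(1)] .
    show "continuous_on (path_image \<gamma>) n" unfolding n_def by (intro continuous_intros hc)
    show "\<forall>x. (x \<in> ?S \<and> x \<notin> ?S) \<or> (x \<in> path_image \<gamma> \<and> x \<in> ?S) \<longrightarrow> e x = n x"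
    proof (intro allI impI)
      fix x assume "(x \<in> ?S \<and> x \<notin> ?S) \<or> (x \<in> path_image \<gamma> \<and> x \<in> ?S)"
      then have "x = p" using int segpq ori(2) by blast
      then show "e x = n x" using h0 by (simp add: n_def)
    qed
  qed
  then have cont': "continuous_on (edge_union v (insert g F)) e'" by (simp add: S')
  have new: "e' (\<gamma> t) \<notin> e ` ?S" if "0 < t" "t \<le> 1" for t
    using path[of t] l(2)[of "t * l"] that l(1) mult_left_le_one_le[of l t] by simp
  have newS: "y \<in> ?S \<or> (\<exists>t. 0 < t \<and> t \<le> 1 \<and> y = \<gamma> t)" if y: "y \<in> ?S \<union> path_image \<gamma>" for y
  proof (cases "y \<in> ?S")
    case False
    then obtain t where t: "t \<in> {0..1}" "y = \<gamma> t" using y by (auto simp: path_image_def)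
    then have "t \<noteq> 0" using False pS \<gamma>(2) by auto
    then have "0 < t" "t \<le> 1" using t(1) by simp_all
    then show ?thesis using t(2) by blast
  qed simp
  have "inj_on e' (?S \<union> path_image \<gamma>)"
  proof (rule inj_onI)
    fix y z assume yz: "y \<in> ?S \<union> path_image \<gamma>" "z \<in> ?S \<union> path_image \<gamma>" "e' y = e' z"
    consider "y \<in> ?S" "z \<in> ?S" | t where "y \<in> ?S" "0 < t" "t \<le> 1" "z = \<gamma> t"
      | t where "z \<in> ?S" "0 < t" "t \<le> 1" "y = \<gamma> t"
      | s t where "0 < s" "s \<le> 1" "y = \<gamma> s" "0 < t" "t \<le> 1" "z = \<gamma> t"
      using newS[OF yz(1)] newS[OF yz(2)] by blast
    then show "y = z"
    proof cases
      case 1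
      then show ?thesis using yz(3) inj_onD[OF inj] onS by metis
    next
      case (2 t)
      then show ?thesis using new[of t] yz(3) onS[OF 2(1)] by (metis imageI)
    next
      case (3 t)
      then show ?thesis using new[of t] yz(3) onS[OF 3(1)] by (metis imageI)
    next
      case (4 s t)
      then have "of_real (s * l) * cis \<theta> = of_real (t * l) * cis \<theta>" using yz(3) path[of s] path[of t] by simp
      then have "s = t" using l(1) by simp
      then show ?thesis using 4 by simp
    qed
  qed
  then have inj': "inj_on e' (edge_union v (insert g F))" by (simp add: S')
  have conv': "seg u w \<subseteq> edge_union v (insert g F)"
    if uw: "u \<in> edge_union v (insert g F)" "w \<in> edge_union v (insert g F)" for u w
  proof -
    have ST': "edge_union v (insert g F) \<subseteq> T" using edge_union_subset[OF v, of "insert g F"] F gE by blast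
    have toP: "seg u p \<subseteq> edge_union v (insert g F)" if u: "u \<in> edge_union v (insert g F)" for u
    proof (cases "u \<in> ?S")
      case True
      then show ?thesis using conv[OF True pS] S' by blast
    next
      case False
      then have "u \<in> seg p q" using u S' segpq ori(2) by blast
      then have "seg u p \<subseteq> seg p q" using seg_subset_seg[OF pT qT _ seg_ends(1)[OF pT qT]] by blast
      then show ?thesis using S' segpq ori(2) by blast
    qed
    have uT: "u \<in> T" and wT: "w \<in> T" using uw ST' by auto
    have "seg u w \<subseteq> seg u p \<union> seg p w" by (rule seg_triangle[OF uT pT wT])
    also have "seg p w = seg w p" by (rule seg_sym[OF wT pT])
    finally show ?thesis using toP[OF uw(1)] toP[OF uw(2)] by blast
  qed
  \<comment> \<open>At the new vertex \<open>q\<close> the edge must leave in the direction opposite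
    to that at \<open>p\<close>. The half turn reverses it, and the rotation is chosen such that the
    arm towards \<open>p\<close> gets exactly this direction; \<open>q\<close> was not drawn before,
    so earlier edges are unaffected.\<close>
  define \<rho>' where "\<rho>' = \<rho>(q := 1 / 2 + (\<rho> p + ang p (dir p q)) - ang q (dir q p))"
  have "straight ang e' \<rho>' \<gamma>'" if h: "h \<in> insert g F" "oriented \<gamma>' h" for h \<gamma>'
  proof (cases "h \<in> F")
    case True
    have hE: "h \<in> E" using True F by blast
    have sub: "path_image h \<subseteq> ?S" using True by (auto simp: edge_union_def)
    have inS: "\<gamma>' t \<in> ?S" if "t \<in> {0..1}" for t
    proof -
      have "\<gamma>' t \<in> path_image \<gamma>'" using that by (simp add: path_image_def)
      then show ?thesis using oriented_facts(2)[OF h(2) hE] sub by blast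
    qed
    then have "e' (\<gamma>' t) = e (\<gamma>' t)" if "t \<in> {0..1}" for t using onS that by blast
    moreover have "\<rho>' (\<gamma>' 0) = \<rho> (\<gamma>' 0)" using inS[of 0] qS by (auto simp: \<rho>'_def)
    ultimately show ?thesis using str[OF True h(2)] unfolding straight_def by simp
  next
    case False
    then have "\<gamma>' = g \<or> \<gamma>' = reversepath g" using h by (auto simp: oriented_def)
    then consider "\<gamma>' = \<gamma>" | "\<gamma>' = reversepath \<gamma>" using \<gamma>(1) by (auto simp: oriented_def)
    then show ?thesis
    proof cases
      case 1
      have "\<rho>' p = \<rho> p" using pq by (simp add: \<rho>'_def)
      then show ?thesis unfolding straight_def 1 using l(1) path \<gamma>(2) onS[OF pS]
        by (intro exI[of _ l]) (simp add: q_def[symmetric] \<theta>_def)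
    next
      case 2
      have "e' (reversepath \<gamma> t) = e' q + of_real (t * l) * cis (2 * pi * (\<rho>' q + ang q (dir q p)))"
        if t: "t \<in> {0..1}" for t
      proof -
        have "2 * pi * (\<rho>' q + ang q (dir q p)) = pi + \<theta>" by (simp add: \<rho>'_def \<theta>_def algebra_simps)
        then have "cis (2 * pi * (\<rho>' q + ang q (dir q p))) = - cis \<theta>" by (simp add: cis_mult [symmetric])
        moreover have "e' (reversepath \<gamma> t) = e p + of_real ((1 - t) * l) * cis \<theta>"
          using path[of "1 - t"] t by (simp add: reversepath_def)
        moreover have "e' q = e p + of_real l * cis \<theta>" using path[of 1] by (simp add: q_def)
        ultimately show ?thesis by (simp add: algebra_simps)
      qed
      moreover have "reversepath \<gamma> 0 = q" "reversepath \<gamma> 1 = p" using \<gamma>(2) by (simp_all add: reversepath_def q_def)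
      ultimately show ?thesis unfolding straight_def 2 using l(1) by (intro exI[of _ l]) simp
    qed
  qed
  then have "partial_embedding ang v (insert g F) e' \<rho>'"
    unfolding partial_embedding_def using cont' inj' conv' by blast
  then show ?thesis by blast
qed

text \<open>There are finitely many edges, so a maximal drawable set exists; by the extension step
  it is everything.\<close>

lemma straight_embedding_exists:
  assumes ang: "turn_assignment ang"
  shows "\<exists>e \<rho>. continuous_on T e \<and> inj_on e T \<and> (\<forall>g\<in>E. \<forall>\<gamma>. oriented \<gamma> g \<longrightarrow> straight ang e \<rho> \<gamma>)"
proof -
  obtain v where v: "v \<in> V" using V_nonempty by blast
  define \<F> where "\<F> = {F. F \<subseteq> E \<and> (\<exists>e \<rho>. partial_embedding ang v F e \<rho>)}"
  have fin: "finite \<F>" using finE by (auto simp: \<F>_def)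
  have "partial_embedding ang v {} (\<lambda>_. 0) (\<lambda>_. 0)" by (simp add: partial_embedding_def edge_union_def)
  then have "{} \<in> \<F>" by (auto simp: \<F>_def)
  then obtain F where F: "F \<in> \<F>" "\<And>F'. F' \<in> \<F> \<Longrightarrow> F \<subseteq> F' \<Longrightarrow> F = F'"
    using finite_has_maximal[OF fin] by blast
  obtain e \<rho> where pe: "F \<subseteq> E" "partial_embedding ang v F e \<rho>" using F(1) by (auto simp: \<F>_def)
  have "F = E \<and> edge_union v F = T"
  proof (rule ccontr)
    assume "\<not> ?thesis"
    then obtain g where g: "g \<in> E - F" "path_image g \<inter> edge_union v F \<noteq> {}"
      using edge_union_adjacent[OF v pe(1)] by blast
    obtain e' \<rho>' where "partial_embedding ang v (insert g F) e' \<rho>'"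
      using partial_embedding_extend[OF ang v pe g] by blast
    then have "insert g F \<in> \<F>" using g pe(1) unfolding \<F>_def by blast
    then have "F = insert g F" using F(2) by blast
    then show False using g(1) by blast
  qed
  then show ?thesis using pe(2) unfolding partial_embedding_def by auto
qed

text \<open>The other vertices and the edges that miss \<open>x\<close> form a closed set
  \<open>K\<close>, so near \<open>x\<close> a point of the arm lies on an edge through
  \<open>x\<close>, and this edge leads into the arm.\<close>

lemma edge_in_arm:
  assumes x: "x \<in> V" and a: "a \<in> local_arms T x"
  obtains g \<gamma> where "g \<in> E" "oriented \<gamma> g" "\<gamma> 0 = x" "dir x (\<gamma> 1) = a"
proof -
  have xT: "x \<in> T" using x V_subset by blast
  obtain p where p: "p \<in> T" "p \<noteq> x" "a = dir x p" using a local_arms_eq[OF xT] by auto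
  define K where "K = (V - {x}) \<union> (\<Union>h\<in>{h\<in>E. x \<notin> path_image h}. path_image h)"
  have "closed K"
    unfolding K_def by (rule closed_Un[OF finite_imp_closed closed_UN]) (simp_all add: finV finE edge_closed)
  then have "open (- K)" by (rule open_Compl)
  moreover have "x \<in> - K" by (simp add: K_def)
  ultimately obtain z where z: "z \<in> seg x p" "z \<noteq> x" "seg x z \<subseteq> - K" using seg_near[OF xT p(1,2)] by metis
  have zT: "z \<in> T" using z(1) seg_subset[OF xT p(1)] by blast
  have za: "z \<in> arm x p" by (rule seg_arm[OF xT p(1) z(1,2)])
  have "z \<notin> K" using z(3) seg_ends(2)[OF xT zT] by blast
  then obtain g where g: "g \<in> E" "z \<in> path_image g" "x \<in> path_image g"
    using zT z(2) T_eq unfolding K_def by blast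
  then have "x \<in> {pathstart g, pathfinish g}" using edge_V[OF g(1)] x by blast
  then obtain \<gamma> where \<gamma>: "oriented \<gamma> g" "\<gamma> 0 = x" using oriented_from[OF g(1)] by metis
  note ori = oriented_facts[OF \<gamma>(1) g(1)]
  have q: "\<gamma> 1 \<in> T" "\<gamma> 1 \<noteq> x" using ori(6,7) V_subset \<gamma>(2) by auto
  have "z \<in> seg x (\<gamma> 1)" using g(2) ori(4) \<gamma>(2) by simp
  then have "z \<in> arm x (\<gamma> 1)" using seg_arm[OF xT q(1)] z(2) by blast
  then have "dir x (\<gamma> 1) = dir x z" using dir_eq_iff[OF xT q zT z(2)] by simp
  also have "\<dots> = a" using dir_eq_iff[OF xT p(1,2) zT z(2)] za p(3) by simp
  finally show ?thesis using that[OF g(1) \<gamma>] by blast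
qed

lemma embedding_with_cyclic_orders:
  assumes ang: "turn_assignment ang"
  shows "\<exists>e. embedding_map (top_of_set T) euclidean e \<and>
    (\<forall>x\<in>V. \<forall>a\<in>local_arms T x. \<forall>b\<in>local_arms T x. \<forall>d\<in>local_arms T x.
       arms_ccw e T x a b d \<longleftrightarrow> ccw_turns (ang x a) (ang x b) (ang x d))"
proof -
  obtain e \<rho> where e: "continuous_on T e" "inj_on e T"
    and str: "\<And>g \<gamma>. g \<in> E \<Longrightarrow> oriented \<gamma> g \<Longrightarrow> straight ang e \<rho> \<gamma>"
    using straight_embedding_exists[OF ang] by blast
  have "arms_ccw e T x a b d \<longleftrightarrow> ccw_turns (ang x a) (ang x b) (ang x d)"
    if x: "x \<in> V" and abd: "a \<in> local_arms T x" "b \<in> local_arms T x" "d \<in> local_arms T x" for x a b d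
  proof -
    have xT: "x \<in> T" using x V_subset by blast
    have hits: "\<forall>\<^sub>F r in at_right 0. \<exists>u. first_exit e T x r a u \<and> e u = e x + rcis r (2 * pi * (\<rho> x + ang x a))"
      if a: "a \<in> local_arms T x" for a
    proof -
      obtain g \<gamma> where g: "g \<in> E" "oriented \<gamma> g" "\<gamma> 0 = x" "dir x (\<gamma> 1) = a" by (rule edge_in_arm[OF x a])
      note ori = oriented_facts[OF g(2,1)]
      have ap: "arm_path x a \<gamma>"
        using ori(1,2) g edge_subset[OF g(1)] by (simp add: arm_path_def path_image_def)
      obtain l where l: "0 < l" "\<And>t. t \<in> {0..1} \<Longrightarrow> e (\<gamma> t) = e x + of_real (t * l) * cis (2 * pi * (\<rho> x + ang x a))"
        using str[OF g(1,2)] unfolding straight_def g(3,4) by blast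
      obtain R where R: "0 < R" "R \<le> cmod (e (\<gamma> 1) - e x)"
        "\<And>r u. 0 < r \<Longrightarrow> r < R \<Longrightarrow> first_exit e T x r a u \<longleftrightarrow> (\<exists>s. u = \<gamma> s \<and> hit (\<lambda>s. e (\<gamma> s) - e x) r s)"
        by (rule arm_path_first_exit[OF e xT ap]) blast
      have nrm: "cmod (e (\<gamma> t) - e x) = t * l" if "t \<in> {0..1}" for t
        using l(2)[OF that] l(1) that by (simp add: norm_mult)
      have Rl: "R \<le> l" using R(2) nrm[of 1] by simp
      have "\<exists>u. first_exit e T x r a u \<and> e u = e x + rcis r (2 * pi * (\<rho> x + ang x a))" if r: "0 < r" "r < R" for r
      proof -
        \<comment> \<open>On a straight edge the distance to \<open>e x\<close> is
          \<open>t * l\<close>, so the circle of radius \<open>r\<close> is hit exactly at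
          \<open>r / l\<close>.\<close>
        define s where "s = r / l"
        have s: "0 < s" "s \<le> 1" "s * l = r" using r Rl l(1) by (auto simp: s_def)
        have "cmod (e (\<gamma> s') - e x) < r" if "0 \<le> s'" "s' < s" for s'
          using nrm[of s'] that s l(1) mult_strict_right_mono[of s' s l] by simp
        then have "hit (\<lambda>s. e (\<gamma> s) - e x) r s" using s nrm[of s] by (simp add: hit_def)
        then have "first_exit e T x r a (\<gamma> s)" using R(3)[OF r] by blast
        moreover have "e (\<gamma> s) = e x + rcis r (2 * pi * (\<rho> x + ang x a))" using l(2)[of s] s by (simp add: rcis_def)
        ultimately show ?thesis by blast
      qed
      then show ?thesis unfolding eventually_at_right_field using R(1) by blast
    qed
    have "\<forall>\<^sub>F r in at_right 0. \<forall>a\<in>local_arms T x. \<exists>u. first_exit e T x r a u \<and> e u = e x + rcis r (2 * pi * (\<rho> x + ang x a))"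
      using hits finite_local_arms[OF xT] by (simp add: eventually_ball_finite)
    then obtain B where B: "0 < B" "\<And>r. 0 < r \<Longrightarrow> r < B \<Longrightarrow> \<forall>a\<in>local_arms T x. \<exists>u. first_exit e T x r a u \<and>
        e u = e x + rcis r (2 * pi * (\<rho> x + ang x a))"
      unfolding eventually_at_right_field by blast
    obtain R where R: "0 < R" "\<forall>r ang. 0 < r \<and> r < R \<and>
      (\<forall>a\<in>local_arms T x. \<exists>u. first_exit e T x r a u \<and> e u = e x + rcis r (2 * pi * ang a)) \<longrightarrow>
      (\<forall>a\<in>local_arms T x. \<forall>b\<in>local_arms T x. \<forall>d\<in>local_arms T x.
         arms_ccw e T x a b d \<longleftrightarrow> ccw_turns (ang a) (ang b) (ang d))"
      using arms_ccw_iff_turns[OF e xT] by blast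
    define r where "r = min B R / 2"
    have r: "0 < r" "r < B" "r < R" using B(1) R(1) by (auto simp: r_def)
    have "arms_ccw e T x a b d \<longleftrightarrow> ccw_turns (\<rho> x + ang x a) (\<rho> x + ang x b) (\<rho> x + ang x d)"
      using spec[OF spec[OF R(2), of r], of "\<lambda>a. \<rho> x + ang x a"] r B(2)[OF r(1,2)] abd by simp
    \<comment> \<open>A common rotation by \<open>\<rho> x\<close> does not change the cyclic
      order.\<close>
    then show ?thesis by (simp add: ccw_turns_translate)
  qed
  moreover have "embedding_map (top_of_set T) euclidean e" using embedding_map_iff e by blast
  ultimately show ?thesis by blast
qed

end

section \<open>Embeddings respecting the cyclic order exclude evil orbits\<close>

context graph_tree
begin

text \<open>Every small circle yields the same cyclic order, so one circle can be fixed once and for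
  all. Injectivity of \<open>e\<close> keeps its first hits apart, which makes the angles distinct
  modulo full turns.\<close>

lemma turns_at_point:
  fixes e :: "'a \<Rightarrow> complex"
  assumes e: "continuous_on T e" "inj_on e T" and xT: "x \<in> T"
  shows "\<exists>ang. (\<forall>a\<in>local_arms T x. \<forall>b\<in>local_arms T x. a \<noteq> b \<longrightarrow> ang a - ang b \<notin> \<int>) \<and>
    (\<forall>a\<in>local_arms T x. \<forall>b\<in>local_arms T x. \<forall>d\<in>local_arms T x.
         arms_ccw e T x a b d \<longleftrightarrow> ccw_turns (ang a) (ang b) (ang d))"
proof -
  obtain R where R: "0 < R" "\<forall>r a. 0 < r \<and> r < R \<and> a \<in> local_arms T x \<longrightarrow> (\<exists>u. first_exit e T x r a u)"
    and ccw: "\<forall>r ang. 0 < r \<and> r < R \<and>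
      (\<forall>a\<in>local_arms T x. \<exists>u. first_exit e T x r a u \<and> e u = e x + rcis r (2 * pi * ang a)) \<longrightarrow>
      (\<forall>a\<in>local_arms T x. \<forall>b\<in>local_arms T x. \<forall>d\<in>local_arms T x.
         arms_ccw e T x a b d \<longleftrightarrow> ccw_turns (ang a) (ang b) (ang d))"
    using arms_ccw_iff_turns[OF e xT] by blast
  define r where "r = R / 2"
  have r: "0 < r" "r < R" using R(1) by (simp_all add: r_def)
  have "\<forall>a\<in>local_arms T x. \<exists>u. first_exit e T x r a u" using R(2) r by blast
  then obtain u where u: "\<And>a. a \<in> local_arms T x \<Longrightarrow> first_exit e T x r a (u a)" by metis
  define ang where "ang a = Arg (e (u a) - e x) / (2 * pi)" for a
  have eu: "e (u a) = e x + rcis r (2 * pi * ang a)" if a: "a \<in> local_arms T x" for a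
  proof -
    have "dist (e x) (e (u a)) = r" using u[OF a] by (simp add: first_exit_def)
    then have "cmod (e (u a) - e x) = r" by (metis dist_commute dist_norm)
    then have "rcis r (2 * pi * ang a) = e (u a) - e x"
      using rcis_cmod_Arg[of "e (u a) - e x"] by (simp add: ang_def)
    then show ?thesis by simp
  qed
  have arm: "u a \<in> T \<and> u a \<noteq> x \<and> dir x (u a) = a" if a: "a \<in> local_arms T x" for a
  proof -
    obtain A where A: "A \<in> arms T x" "a = at x within A" "u a \<in> A" using u[OF a] by (auto simp: first_exit_def)
    then obtain p where p: "p \<in> T" "p \<noteq> x" "A = arm x p" using arms_eq[OF xT] by auto
    have "u a \<in> T" "u a \<noteq> x" using A(3) p(3) by (auto simp: arm_iff)
    moreover from this have "dir x p = dir x (u a)" using dir_eq_iff[OF xT p(1,2)] A(3) p(3) by blast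
    ultimately show ?thesis using A(2) p(3) by (simp add: dir_of_def)
  qed
  have "ang a - ang b \<notin> \<int>" if ab: "a \<in> local_arms T x" "b \<in> local_arms T x" "a \<noteq> b" for a b
  proof
    assume "ang a - ang b \<in> \<int>"
    then obtain i where "ang a - ang b = of_int i" by (rule Ints_cases)
    then have "2 * pi * ang a = 2 * pi * (ang b + of_int i)" by simp
    then have "rcis r (2 * pi * ang a) = rcis r (2 * pi * ang b)" using rcis_turns_eq_iff[OF r(1)] by blast
    then have "e (u a) = e (u b)" using eu ab by simp
    then have "u a = u b" using inj_onD[OF e(2)] arm ab by blast
    then show False using arm[OF ab(1)] arm[OF ab(2)] ab(3) by simp
  qed
  moreover have "\<forall>a\<in>local_arms T x. \<exists>u. first_exit e T x r a u \<and> e u = e x + rcis r (2 * pi * ang a)"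
    using u eu by blast
  then have "\<forall>a\<in>local_arms T x. \<forall>b\<in>local_arms T x. \<forall>d\<in>local_arms T x.
         arms_ccw e T x a b d \<longleftrightarrow> ccw_turns (ang a) (ang b) (ang d)"
    using spec[OF spec[OF ccw, of r], of ang] r by simp
  ultimately show ?thesis by blast
qed

end

context branch_cycle
begin

text \<open>A return map that fixes one local arm and preserves the cyclic order is monotone with respect
  to the linear order obtained by cutting at the fixed arm. As it has finite order, it is the identity.\<close>

lemma return_map_identity:
  fixes e :: "'a \<Rightarrow> complex"
  assumes e: "continuous_on T e" "inj_on e T"
    and resp: "\<And>x. branch_point T x \<Longrightarrow> respects_cyclic_order e T f x"
    and z: "z \<in> Q" and a0: "a0 \<in> local_arms T z" "(\<tau> ^^ n) a0 = a0" and a: "a \<in> local_arms T z"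
  shows "(\<tau> ^^ n) a = a"
proof (rule ccontr)
  assume neq: "(\<tau> ^^ n) a \<noteq> a"
  let ?LA = "local_arms T z"
  note zT = Q_facts(1)[OF z]
  have step: "arms_ccw e T z u v w \<Longrightarrow> arms_ccw e T ((f ^^ k) z) ((\<tau> ^^ k) u) ((\<tau> ^^ k) v) ((\<tau> ^^ k) w)"
    if uvw: "u \<in> ?LA" "v \<in> ?LA" "w \<in> ?LA" for u v w k
  proof (induction k)
    case (Suc k)
    note br = Q_branch[OF funpow_Q[OF z, of k]]
    show ?case
      using resp[OF br] Suc.IH[OF Suc.prems] tau_pow_local_arms[OF zT uvw(1), of k]
        tau_pow_local_arms[OF zT uvw(2), of k] tau_pow_local_arms[OF zT uvw(3), of k]
      unfolding respects_cyclic_order_def by simp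
  qed simp
  define \<phi> where "\<phi> = \<tau> ^^ n"
  have \<phi>LA: "\<phi> u \<in> ?LA" if "u \<in> ?LA" for u
    using tau_pow_local_arms[OF zT that, of n] Q_periodic[OF z] by (simp add: \<phi>_def)
  have \<phi>inj: "u = v" if "u \<in> ?LA" "v \<in> ?LA" "\<phi> u = \<phi> v" for u v
    using inj_onD[OF tau_pow_inj[OF Q_branch[OF z]] _ that(1,2), of n] that(3) by (simp add: \<phi>_def)
  have \<phi>ccw: "arms_ccw e T z (\<phi> u) (\<phi> v) (\<phi> w)"
    if "u \<in> ?LA" "v \<in> ?LA" "w \<in> ?LA" "arms_ccw e T z u v w" for u v w
    using step[OF that, of n] Q_periodic[OF z] by (simp add: \<phi>_def)
  have \<phi>a0: "\<phi> a0 = a0" using a0(2) by (simp add: \<phi>_def)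
  obtain ang where A1: "\<forall>u\<in>?LA. \<forall>v\<in>?LA. u \<noteq> v \<longrightarrow> ang u - ang v \<notin> \<int>"
    and A2: "\<forall>u\<in>?LA. \<forall>v\<in>?LA. \<forall>w\<in>?LA. arms_ccw e T z u v w \<longleftrightarrow> ccw_turns (ang u) (ang v) (ang w)"
    using turns_at_point[OF e zT] by (elim exE conjE)
  have dist: "ang u - ang v \<notin> \<int>" if "u \<in> ?LA" "v \<in> ?LA" "u \<noteq> v" for u v
    using A1 that by blast
  have ccw: "arms_ccw e T z u v w \<longleftrightarrow> ccw_turns (ang u) (ang v) (ang w)"
    if "u \<in> ?LA" "v \<in> ?LA" "w \<in> ?LA" for u v w
    using A2 that by simp
  \<comment> \<open>Position, in turns, on the circle cut open at the fixed arm
    \<open>a0\<close>.\<close>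
  define \<kappa> where "\<kappa> u = frac (ang u - ang a0)" for u
  have mono: "0 < \<kappa> (\<phi> u) \<and> \<kappa> (\<phi> u) < \<kappa> (\<phi> v)" if uv: "u \<in> ?LA" "v \<in> ?LA" "0 < \<kappa> u" "\<kappa> u < \<kappa> v" for u v
  proof -
    have "arms_ccw e T z a0 u v" using ccw[OF a0(1) uv(1,2)] uv(3,4) by (simp add: ccw_turns_def \<kappa>_def)
    then have "arms_ccw e T z a0 (\<phi> u) (\<phi> v)" using \<phi>ccw[OF a0(1) uv(1,2)] \<phi>a0 by simp
    then have "ccw_turns (ang a0) (ang (\<phi> u)) (ang (\<phi> v))" using ccw[OF a0(1) \<phi>LA[OF uv(1)] \<phi>LA[OF uv(2)]] by simp
    then show ?thesis by (simp add: ccw_turns_def \<kappa>_def)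
  qed
  define s where "s k = (\<phi> ^^ k) a" for k
  have sLA: "s k \<in> ?LA" for k by (induction k) (simp_all add: s_def a \<phi>LA)
  have s_ne: "s k \<noteq> a0" for k
  proof (induction k)
    case 0
    then show ?case using neq \<phi>a0 by (auto simp: s_def \<phi>_def)
  next
    case (Suc k)
    then show ?case using \<phi>inj[OF sLA[of k] a0(1)] \<phi>a0 by (auto simp: s_def)
  qed
  have pos: "0 < \<kappa> (s k)" for k
    using dist[OF sLA a0(1) s_ne, of k] by (simp add: \<kappa>_def frac_gt_0_iff)
  have sS: "s (Suc k) = \<phi> (s k)" for k by (simp add: s_def)
  have s01: "s 0 \<noteq> s 1" using neq by (simp add: s_def \<phi>_def)
  have "\<kappa> (s 0) \<noteq> \<kappa> (s 1)"
  proof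
    assume "\<kappa> (s 0) = \<kappa> (s 1)"
    then have "ang (s 0) - ang (s 1) = of_int (\<lfloor>ang (s 0) - ang a0\<rfloor> - \<lfloor>ang (s 1) - ang a0\<rfloor>)"
      by (simp add: \<kappa>_def frac_def)
    then show False using dist[OF sLA sLA s01] by (metis Ints_of_int)
  qed
  \<comment> \<open>The orbit of \<open>a\<close> under the return map closes up after
    \<open>m\<close> returns, since \<open>n * m\<close> is a multiple of a period of
    \<open>a\<close>.\<close>
  obtain m where m: "0 < m" "(\<tau> ^^ m) a = a" by (rule tau_arm_periodic[OF z a])
  have "s m = (\<tau> ^^ (n * m)) a" by (simp add: s_def \<phi>_def funpow_mult)
  also have "n * m = m * n" by simp
  also have "(\<tau> ^^ (m * n)) a = s 0" using m(2) by (simp add: s_def funpow_mult [symmetric] funpow_fixpoint)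
  finally have sm: "s m = s 0" .
  consider "\<kappa> (s 0) < \<kappa> (s 1)" | "\<kappa> (s 1) < \<kappa> (s 0)" using \<open>\<kappa> (s 0) \<noteq> \<kappa> (s 1)\<close> by linarith
  then show False
  proof cases
    case 1
    have "\<kappa> (s k) < \<kappa> (s (Suc k))" for k
    proof (induction k)
      case (Suc k)
      then show ?case using mono[OF sLA[of k] sLA[of "Suc k"] pos] sS[of k] sS[of "Suc k"] by simp
    qed (use 1 in simp)
    then have "\<kappa> (s 0) < \<kappa> (s m)" using m(1) by (rule lift_Suc_mono_less)
    then show False using sm by simp
  next
    case 2
    have "- \<kappa> (s k) < - \<kappa> (s (Suc k))" for k
    proof (induction k)
      case (Suc k)
      then show ?case using mono[OF sLA[of "Suc k"] sLA[of k] pos] sS[of k] sS[of "Suc k"] by simp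
    qed (use 2 in simp)
    then have "- \<kappa> (s 0) < - \<kappa> (s m)" using m(1) by (rule lift_Suc_mono_less[of "\<lambda>k. - \<kappa> (s k)"])
    then show False using sm by simp
  qed
qed

end

context hubbard_graph
begin

lemma branch_cycle_of_orbit:
  assumes "periodic_branch_orbit T f P"
  obtains x n where "branch_cycle T V E f c x n" "P = forward_orbit f x"
proof -
  obtain x m where x: "0 < m" "(f ^^ m) x = x" "P = forward_orbit f x" "\<forall>y\<in>P. branch_point T y"
    using assms unfolding periodic_branch_orbit_def by blast
  define n where "n = (LEAST n. 0 < n \<and> (f ^^ n) x = x)"
  have n: "0 < n \<and> (f ^^ n) x = x" unfolding n_def by (rule LeastI[of _ m]) (use x in simp)
  have least: "n \<le> k" if "0 < k" "(f ^^ k) x = x" for k unfolding n_def by (rule Least_le) (use that in simp)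
  have "x \<in> forward_orbit f x" unfolding forward_orbit_def by (auto intro: exI[of _ 0])
  then have "branch_point T x" using x(3,4) by blast
  then have "branch_cycle T V E f c x n"
    using n least by unfold_locales auto
  then show ?thesis using that x(3) by blast
qed

lemma respecting_embedding_no_evil:
  fixes e :: "'a \<Rightarrow> complex"
  assumes "embedding_map (top_of_set T) euclidean e"
    and "\<And>x. branch_point T x \<Longrightarrow> respects_cyclic_order e T f x"
  shows "\<not> evil_orbit T f P"
proof
  assume evil: "evil_orbit T f P"
  then obtain x n where bc: "branch_cycle T V E f c x n" and P: "P = forward_orbit f x"
    using branch_cycle_of_orbit unfolding evil_orbit_def by blast
  interpret branch_cycle T V E f c x n by (rule bc)
  have "\<not> tame_orbit T f Q" using evil P by (simp add: evil_orbit_def Q_def)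
  then obtain z a0 a where "z \<in> Q" "a0 \<in> local_arms T z" "(\<tau> ^^ n) a0 = a0" "a \<in> local_arms T z" "(\<tau> ^^ n) a \<noteq> a"
    by (rule not_tame_return_map)
  then show False using return_map_identity[OF _ _ assms(2)] embedding_map_iff assms(1) by blast
qed

end

section \<open>Invariant cyclic orders in the absence of evil orbits\<close>

text \<open>On a cycle, \<^term>\<open>t\<close> advances \<open>cycle_turn t\<close> by a constant modulo one, hence
  preserves the cyclic order that it induces. The base point depends on the cycle only.\<close>

definition cycle_base :: "('b \<Rightarrow> 'b) \<Rightarrow> 'b \<Rightarrow> 'b" where
  "cycle_base t a = (SOME b. b \<in> forward_orbit t a)"

definition cycle_length :: "('b \<Rightarrow> 'b) \<Rightarrow> 'b \<Rightarrow> nat" where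
  "cycle_length t a = (LEAST m. 0 < m \<and> (t ^^ m) a = a)"

definition cycle_turn :: "('b \<Rightarrow> 'b) \<Rightarrow> 'b \<Rightarrow> real" where
  "cycle_turn t a = real (LEAST k. (t ^^ k) (cycle_base t a) = a) / real (cycle_length t (cycle_base t a))"

lemma forward_orbit_funpow:
  assumes "0 < m" "(t ^^ m) a = a" shows "forward_orbit t ((t ^^ k) a) = forward_orbit t a"
proof
  show "forward_orbit t ((t ^^ k) a) \<subseteq> forward_orbit t a"
    unfolding forward_orbit_def by (auto simp: funpow_add [symmetric, THEN fun_cong, unfolded comp_apply])
  show "forward_orbit t a \<subseteq> forward_orbit t ((t ^^ k) a)"
  proof
    fix y assume "y \<in> forward_orbit t a"
    then obtain i where "y = (t ^^ i) a" by (auto simp: forward_orbit_def)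
    also have "a = (t ^^ (m * k)) a" using assms(2) by (simp add: funpow_mult [symmetric] funpow_fixpoint)
    also have "m * k = m * k - k + k" using assms(1) by simp
    finally have "y = (t ^^ (i + (m * k - k))) ((t ^^ k) a)" by (simp add: funpow_add)
    then show "y \<in> forward_orbit t ((t ^^ k) a)" unfolding forward_orbit_def by blast
  qed
qed

lemma cycle_base_funpow:
  "0 < m \<Longrightarrow> (t ^^ m) a = a \<Longrightarrow> cycle_base t ((t ^^ k) a) = cycle_base t a"
  by (simp add: cycle_base_def forward_orbit_funpow)

lemma cycle_base_reaches:
  assumes "0 < m" "(t ^^ m) a = a"
  obtains k where "(t ^^ k) (cycle_base t a) = a" "(t ^^ m) (cycle_base t a) = cycle_base t a"
proof -
  have "a \<in> forward_orbit t a" unfolding forward_orbit_def by (auto intro: exI[of _ 0])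
  then have "cycle_base t a \<in> forward_orbit t a" unfolding cycle_base_def by (rule someI)
  then obtain i where i: "cycle_base t a = (t ^^ i) a" by (auto simp: forward_orbit_def)
  have "(t ^^ (m * i - i)) (cycle_base t a) = (t ^^ (m * i - i + i)) a" by (simp add: i funpow_add)
  also have "m * i - i + i = m * i" using assms(1) by simp
  also have "(t ^^ (m * i)) a = a" using assms(2) by (simp add: funpow_mult [symmetric] funpow_fixpoint)
  finally have 1: "(t ^^ (m * i - i)) (cycle_base t a) = a" .
  have "(t ^^ m) (cycle_base t a) = (t ^^ i) ((t ^^ m) a)"
    unfolding i by (metis add.commute comp_apply funpow_add)
  then have "(t ^^ m) (cycle_base t a) = cycle_base t a" using assms(2) i by simp
  then show ?thesis using that 1 by blast
qed

text \<open>Congruence of \<open>i\<close> and \<open>j\<close> modulo the cycle length, written in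
  the form in which turns are compared.\<close>

lemma funpow_eq_imp_cong:
  assumes "0 < m" "(t ^^ m) b = b" "(t ^^ i) b = (t ^^ j) b"
  shows "(real i - real j) / real (cycle_length t b) \<in> \<int>"
proof -
  define M where "M = cycle_length t b"
  have M: "0 < M \<and> (t ^^ M) b = b" unfolding M_def cycle_length_def by (rule LeastI[of _ m]) (use assms in simp)
  have least: "M \<le> k" if "0 < k" "(t ^^ k) b = b" for k
    unfolding M_def cycle_length_def by (rule Least_le) (use that in simp)
  have fixM: "(t ^^ (M * k)) b = b" for k using M by (simp add: funpow_mult [symmetric] funpow_fixpoint)
  have key: "M dvd l" if l: "(t ^^ l) b = b" for l
  proof (rule ccontr)
    assume "\<not> M dvd l"
    then have lm: "0 < l mod M" "l mod M < M" using M by (auto simp: dvd_eq_mod_eq_0)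
    have "(t ^^ (l mod M + M * (l div M))) b = b" using l by simp
    then have "(t ^^ (l mod M)) b = b" unfolding funpow_add using fixM by simp
    then show False using least[OF lm(1)] lm(2) by simp
  qed
  \<comment> \<open>Padding \<open>i'\<close> to a multiple of the length cancels it without
    injectivity of \<open>t\<close>.\<close>
  have wlog: "int M dvd int j' - int i'" if h: "i' \<le> j'" "(t ^^ i') b = (t ^^ j') b" for i' j'
  proof -
    have "(t ^^ (M * i' - i' + i')) b = (t ^^ (M * i' - i' + j')) b" using h(2) by (simp add: funpow_add)
    moreover have "M * i' - i' + i' = M * i'" using M by simp
    moreover have "M * i' - i' + j' = j' - i' + M * i'" using M h(1) by simp
    ultimately have "(t ^^ (M * i')) b = (t ^^ (j' - i' + M * i')) b" by simp
    then have "(t ^^ (j' - i')) b = b" unfolding funpow_add comp_apply fixM by simp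
    then have "M dvd j' - i'" by (rule key)
    then have "int M dvd int (j' - i')" by simp
    then show ?thesis using h(1) by (simp add: of_nat_diff)
  qed
  have "int M dvd int i - int j"
  proof (cases "i \<le> j")
    case True
    then show ?thesis using wlog[OF True assms(3)] by (metis dvd_minus_iff minus_diff_eq)
  next
    case False
    then show ?thesis using wlog[of j i] assms(3) by simp
  qed
  then obtain q where "int i - int j = int M * q" by blast
  then have "real_of_int (int i - int j) = real M * real_of_int q" by simp
  then have "(real i - real j) / real M = real_of_int q" using M by simp
  then show ?thesis unfolding M_def by simp
qed

text \<open>One step raises the index on the cycle by one, except that the least index may wrap
  around; the wrap is the integer \<open>i\<close>.\<close>

lemma cycle_turn_step:
  assumes "0 < m" "(t ^^ m) a = a"
  obtains i :: int where "cycle_turn t (t a) = cycle_turn t a + 1 / real (cycle_length t (cycle_base t a)) + of_int i"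
proof -
  let ?b = "cycle_base t a"
  define k where "k = (LEAST k. (t ^^ k) ?b = a)"
  define l where "l = (LEAST k. (t ^^ k) ?b = t a)"
  obtain j where j: "(t ^^ j) ?b = a" "(t ^^ m) ?b = ?b" by (rule cycle_base_reaches[OF assms])
  have k: "(t ^^ k) ?b = a" unfolding k_def using j(1) by (rule LeastI)
  have "(t ^^ Suc j) ?b = t a" using j(1) by simp
  then have l: "(t ^^ l) ?b = t a" unfolding l_def by (rule LeastI)
  have ba: "cycle_base t (t a) = ?b" using cycle_base_funpow[OF assms, of 1] by simp
  have "(t ^^ l) ?b = (t ^^ Suc k) ?b" using k l by simp
  then have "(real l - real (Suc k)) / real (cycle_length t ?b) \<in> \<int>" by (rule funpow_eq_imp_cong[OF assms(1) j(2)])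
  then obtain i where "(real l - real (Suc k)) / real (cycle_length t ?b) = of_int i" by (rule Ints_cases)
  then have "cycle_turn t (t a) = cycle_turn t a + 1 / real (cycle_length t ?b) + of_int i"
    unfolding cycle_turn_def ba k_def[symmetric] l_def[symmetric]
    by (simp add: diff_divide_distrib add_divide_distrib)
  then show ?thesis using that by blast
qed

text \<open>On one cycle the turn is the index divided by the length, so turns that agree modulo 1
  come from congruent indices.\<close>

lemma cycle_turn_inj:
  assumes a: "0 < m" "(t ^^ m) a = a" and b: "b = (t ^^ i) a" and int: "cycle_turn t a - cycle_turn t b \<in> \<int>"
  shows "a = b"
proof -
  let ?b = "cycle_base t a"
  have mb: "(t ^^ m) b = b" unfolding b using a(2) by (metis add.commute comp_apply funpow_add)
  have bb: "cycle_base t b = ?b" unfolding b by (rule cycle_base_funpow[OF a])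
  define k where "k = (LEAST k. (t ^^ k) ?b = a)"
  define l where "l = (LEAST k. (t ^^ k) ?b = b)"
  obtain j where j: "(t ^^ j) ?b = a" "(t ^^ m) ?b = ?b" by (rule cycle_base_reaches[OF a])
  obtain j' where j': "(t ^^ j') (cycle_base t b) = b" by (rule cycle_base_reaches[OF a(1) mb])
  have k: "(t ^^ k) ?b = a" unfolding k_def using j(1) by (rule LeastI)
  have l: "(t ^^ l) ?b = b" unfolding l_def using j'[unfolded bb] by (rule LeastI)
  define M where "M = cycle_length t ?b"
  have M: "0 < M \<and> (t ^^ M) ?b = ?b" unfolding M_def cycle_length_def by (rule LeastI[of _ m]) (use a(1) j(2) in simp)
  have "real k / real M - real l / real M \<in> \<int>"
    using int unfolding cycle_turn_def bb k_def[symmetric] l_def[symmetric] M_def .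
  then obtain q where "real k / real M - real l / real M = of_int q" by (rule Ints_cases)
  then have "real k - real l = real M * of_int q" using M by (simp add: field_simps)
  then have "real_of_int (int k - int l) = real_of_int (int M * q)" by simp
  then have q: "int k = int l + int M * q" by linarith
  have fixM: "(t ^^ (M * u)) ?b = ?b" for u using M by (simp add: funpow_mult [symmetric] funpow_fixpoint)
  have "(t ^^ k) ?b = (t ^^ l) ?b"
  proof (cases "0 \<le> q")
    case True
    then have "int k = int (l + M * nat q)" using q by simp
    then have "k = l + M * nat q" by (simp only: of_nat_eq_iff)
    then show ?thesis using fixM by (simp add: funpow_add)
  next
    case False
    then have "int l = int (k + M * nat (- q))" using q by simp
    then have "l = k + M * nat (- q)" by (simp only: of_nat_eq_iff)
    then show ?thesis using fixM by (simp add: funpow_add)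
  qed
  then show ?thesis using k l by simp
qed

context hubbard_graph
begin

section \<open>Turns at periodic and preperiodic branch points\<close>

definition periodic_branch :: "'a \<Rightarrow> bool" where
  "periodic_branch x \<longleftrightarrow> branch_point T x \<and> (\<exists>m>0. (f ^^ m) x = x)"

lemma branch_preperiodic:
  assumes "branch_point T x" shows "\<exists>k. periodic_branch ((f ^^ k) x)"
proof -
  have "range (\<lambda>k. (f ^^ k) x) \<subseteq> {x. branch_point T x}" using branch_funpow[OF assms] by blast
  then have "finite (range (\<lambda>k. (f ^^ k) x))" using finite_branch_points finite_subset by blast
  then have "\<not> inj (\<lambda>k. (f ^^ k) x)" using finite_imageD infinite_UNIV_nat by metis
  then obtain i j where "i \<noteq> j" "(f ^^ i) x = (f ^^ j) x" by (auto simp: inj_on_def)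
  then obtain i j where ij: "i < j" "(f ^^ i) x = (f ^^ j) x" by (metis linorder_neqE_nat)
  have "(f ^^ (j - i)) ((f ^^ i) x) = (f ^^ (j - i + i)) x" by (simp add: funpow_add)
  also have "\<dots> = (f ^^ i) x" using ij by simp
  finally have "periodic_branch ((f ^^ i) x)"
    unfolding periodic_branch_def using branch_funpow[OF assms] ij(1) by (intro conjI exI[of _ "j - i"]) auto
  then show ?thesis by blast
qed

definition preperiod :: "'a \<Rightarrow> nat" where
  "preperiod x = (LEAST k. periodic_branch ((f ^^ k) x))"

lemma preperiod_periodic: "branch_point T x \<Longrightarrow> periodic_branch ((f ^^ preperiod x) x)"
  unfolding preperiod_def by (rule LeastI_ex[OF branch_preperiodic])

lemma preperiod_0: "periodic_branch x \<Longrightarrow> preperiod x = 0"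
  unfolding preperiod_def by (rule Least_eq_0) simp

lemma preperiod_Suc:
  assumes "branch_point T x" "\<not> periodic_branch x" shows "preperiod x = Suc (preperiod (f x))"
proof -
  have "preperiod x = Suc (LEAST k. periodic_branch ((f ^^ Suc k) x))"
    unfolding preperiod_def
    by (rule Least_Suc[of "\<lambda>k. periodic_branch ((f ^^ k) x)" "preperiod x"])
      (use preperiod_periodic[OF assms(1)] assms(2) in simp_all)
  then show ?thesis by (simp add: preperiod_def funpow_swap1)
qed

text \<open>A branch point that is not periodic takes its turns from its first periodic image, so
  \<tau> preserves turns there exactly; on periodic orbits it advances them.\<close>

definition branch_turn :: "'a \<Rightarrow> 'a filter \<Rightarrow> real" where
  "branch_turn x a = cycle_turn \<tau> ((\<tau> ^^ preperiod x) a)"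

text \<open>Tameness puts all arms over the orbit on one cycle. For the second claim, going once
  round the orbit of \<open>x\<close> before returning to \<open>a\<close> makes the return time
  positive.\<close>

lemma periodic_branch_arms:
  assumes noevil: "\<not> (\<exists>P. evil_orbit T f P)" and x: "periodic_branch x"
    and ab: "a \<in> local_arms T x" "b \<in> local_arms T x"
  shows "\<exists>k. (\<tau> ^^ k) a = b" "\<exists>m>0. (\<tau> ^^ m) a = a"
proof -
  have br: "branch_point T x" using x by (simp add: periodic_branch_def)
  have "periodic_branch_orbit T f (forward_orbit f x)"
    using x branch_funpow[OF br] by (auto simp: periodic_branch_orbit_def periodic_branch_def forward_orbit_def)
  then have tame: "tame_orbit T f (forward_orbit f x)" using noevil by (auto simp: evil_orbit_def)
  have xo: "x \<in> forward_orbit f x" unfolding forward_orbit_def by (auto intro: exI[of _ 0])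
  have tr: "\<exists>k. (\<tau> ^^ k) u = v" if "u \<in> local_arms T x" "v \<in> local_arms T x" for u v
    using tame xo that unfolding tame_orbit_def by blast
  show "\<exists>k. (\<tau> ^^ k) a = b" using tr ab by blast
  obtain m where m: "0 < m" "(f ^^ m) x = x" using x by (auto simp: periodic_branch_def)
  have xT: "x \<in> T" by (rule branch_facts(1)[OF br])
  have "(\<tau> ^^ m) a \<in> local_arms T x" using tau_pow_local_arms[OF xT ab(1), of m] m(2) by simp
  then obtain k where "(\<tau> ^^ k) ((\<tau> ^^ m) a) = a" using tr ab(1) by blast
  then have "(\<tau> ^^ (k + m)) a = a" by (simp add: funpow_add)
  then show "\<exists>m>0. (\<tau> ^^ m) a = a" using m(1) by (intro exI[of _ "k + m"]) simp
qed

lemma branch_turn_distinct: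
  assumes noevil: "\<not> (\<exists>P. evil_orbit T f P)" and x: "branch_point T x"
    and ab: "a \<in> local_arms T x" "b \<in> local_arms T x" "a \<noteq> b"
  shows "branch_turn x a - branch_turn x b \<notin> \<int>"
proof
  assume int: "branch_turn x a - branch_turn x b \<in> \<int>"
  let ?k = "preperiod x"
  note xT = branch_facts(1)[OF x]
  note per = preperiod_periodic[OF x]
  note la = tau_pow_local_arms[OF xT ab(1), of ?k]
  note lb = tau_pow_local_arms[OF xT ab(2), of ?k]
  obtain i where i: "(\<tau> ^^ ?k) b = (\<tau> ^^ i) ((\<tau> ^^ ?k) a)" using periodic_branch_arms(1)[OF noevil per la lb] by metis
  obtain m where m: "0 < m" "(\<tau> ^^ m) ((\<tau> ^^ ?k) a) = (\<tau> ^^ ?k) a" using periodic_branch_arms(2)[OF noevil per la la] by blast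
  have "(\<tau> ^^ ?k) a = (\<tau> ^^ ?k) b" using cycle_turn_inj[OF m i] int by (simp add: branch_turn_def)
  then show False using inj_onD[OF tau_pow_inj[OF x] _ ab(1,2)] ab(3) by blast
qed

text \<open>At a periodic branch point all arms lie on one cycle, hence share base and length, and
  \<tau> rotates all turns by the same \<open>h\<close> modulo 1. With several cycles the rotations
  could differ; this is where evil orbits would interfere.\<close>

lemma branch_turn_ccw:
  assumes noevil: "\<not> (\<exists>P. evil_orbit T f P)" and x: "branch_point T x"
    and abd: "a \<in> local_arms T x" "b \<in> local_arms T x" "d \<in> local_arms T x"
    and ccw: "ccw_turns (branch_turn x a) (branch_turn x b) (branch_turn x d)"
  shows "ccw_turns (branch_turn (f x) (\<tau> a)) (branch_turn (f x) (\<tau> b)) (branch_turn (f x) (\<tau> d))"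
proof (cases "periodic_branch x")
  case False
  have "branch_turn (f x) (\<tau> u) = branch_turn x u" for u
    using preperiod_Suc[OF x False] by (simp add: branch_turn_def funpow_swap1)
  then show ?thesis using ccw by simp
next
  case True
  obtain m where m: "0 < m" "(f ^^ m) x = x" using True by (auto simp: periodic_branch_def)
  have "(f ^^ m) (f x) = f x" using m(2) by (simp add: funpow_swap1 [symmetric])
  then have "periodic_branch (f x)" using branch_image[OF x] m(1) by (auto simp: periodic_branch_def)
  then have turn: "branch_turn x u = cycle_turn \<tau> u" "branch_turn (f x) (\<tau> u) = cycle_turn \<tau> (\<tau> u)" for u
    using preperiod_0[OF True] preperiod_0[of "f x"] by (simp_all add: branch_turn_def)
  obtain M where M: "0 < M" "(\<tau> ^^ M) a = a" using periodic_branch_arms(2)[OF noevil True abd(1,1)] by blast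
  define h where "h = 1 / real (cycle_length \<tau> (cycle_base \<tau> a))"
  have step: "\<exists>i::int. cycle_turn \<tau> (\<tau> u) = h + cycle_turn \<tau> u + of_int i" if u: "u \<in> local_arms T x" for u
  proof -
    obtain k where k: "u = (\<tau> ^^ k) a" using periodic_branch_arms(1)[OF noevil True abd(1) u] by metis
    have "cycle_base \<tau> u = cycle_base \<tau> a" unfolding k by (rule cycle_base_funpow[OF M])
    moreover obtain m' where "0 < m'" "(\<tau> ^^ m') u = u" using periodic_branch_arms(2)[OF noevil True u u] by blast
    then obtain i :: int where
      "cycle_turn \<tau> (\<tau> u) = cycle_turn \<tau> u + 1 / real (cycle_length \<tau> (cycle_base \<tau> u)) + of_int i"
      by (rule cycle_turn_step)
    ultimately show ?thesis by (simp add: h_def)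
  qed
  obtain i j k :: int where "cycle_turn \<tau> (\<tau> a) = h + cycle_turn \<tau> a + of_int i"
    "cycle_turn \<tau> (\<tau> b) = h + cycle_turn \<tau> b + of_int j" "cycle_turn \<tau> (\<tau> d) = h + cycle_turn \<tau> d + of_int k"
    using step abd by metis
  then show ?thesis using ccw unfolding turn by (simp add: ccw_turns_shift ccw_turns_translate)
qed

lemma no_evil_respecting_embedding:
  assumes noevil: "\<not> (\<exists>P. evil_orbit T f P)"
  shows "\<exists>e :: 'a \<Rightarrow> complex. embedding_map (top_of_set T) euclidean e \<and>
    (\<forall>x. branch_point T x \<longrightarrow> respects_cyclic_order e T f x)"
proof -
  have "\<forall>x\<in>T. \<exists>h :: 'a filter \<Rightarrow> real. \<forall>a\<in>local_arms T x. \<forall>b\<in>local_arms T x. a \<noteq> b \<longrightarrow> h a - h b \<notin> \<int>"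
    using finite_set_turns[OF finite_local_arms] by blast
  then obtain h :: "'a \<Rightarrow> 'a filter \<Rightarrow> real" where h: "\<And>x a b. x \<in> T \<Longrightarrow> a \<in> local_arms T x \<Longrightarrow>
      b \<in> local_arms T x \<Longrightarrow> a \<noteq> b \<Longrightarrow> h x a - h x b \<notin> \<int>" by metis
  \<comment> \<open>Vertices that are not branch points carry no order condition, but their arms
    still get distinct directions for the drawing.\<close>
  define ang where "ang x = (if branch_point T x then branch_turn x else h x)" for x
  have "turn_assignment ang"
    unfolding turn_assignment_def
  proof (intro ballI impI)
    fix x a b assume "x \<in> V" "a \<in> local_arms T x" "b \<in> local_arms T x" "a \<noteq> b"
    moreover from this have "x \<in> T" using V_subset by blast
    ultimately show "ang x a - ang x b \<notin> \<int>"
      using branch_turn_distinct[OF noevil, of x a b] h[of x a b] by (auto simp: ang_def)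
  qed
  obtain e :: "'a \<Rightarrow> complex" where e: "embedding_map (top_of_set T) euclidean e"
    and A: "\<forall>x\<in>V. \<forall>a\<in>local_arms T x. \<forall>b\<in>local_arms T x. \<forall>d\<in>local_arms T x.
       arms_ccw e T x a b d \<longleftrightarrow> ccw_turns (ang x a) (ang x b) (ang x d)"
    using embedding_with_cyclic_orders[OF \<open>turn_assignment ang\<close>] by (elim exE conjE)
  have ccw: "arms_ccw e T x a b d \<longleftrightarrow> ccw_turns (ang x a) (ang x b) (ang x d)"
    if "x \<in> V" "a \<in> local_arms T x" "b \<in> local_arms T x" "d \<in> local_arms T x" for x a b d
    using A that by simp
  have "respects_cyclic_order e T f x" if x: "branch_point T x" for x
    unfolding respects_cyclic_order_def
  proof (intro ballI impI)
    fix a b d assume abd: "a \<in> local_arms T x" "b \<in> local_arms T x" "d \<in> local_arms T x" "arms_ccw e T x a b d"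
    note fx = branch_image[OF x]
    note xT = branch_facts(1)[OF x]
    have "ccw_turns (branch_turn x a) (branch_turn x b) (branch_turn x d)"
      using ccw[OF branch_point_vertex[OF x] abd(1-3)] abd(4) x by (simp add: ang_def)
    then have "ccw_turns (branch_turn (f x) (\<tau> a)) (branch_turn (f x) (\<tau> b)) (branch_turn (f x) (\<tau> d))"
      by (rule branch_turn_ccw[OF noevil x abd(1-3)])
    then show "arms_ccw e T (f x) (\<tau> a) (\<tau> b) (\<tau> d)"
      using ccw[OF branch_point_vertex[OF fx] tau_local_arms[OF xT abd(1)] tau_local_arms[OF xT abd(2)]
          tau_local_arms[OF xT abd(3)]] fx by (simp add: ang_def)
  qed
  then show ?thesis using e by blast
qed

end

theorem proposition3p10:
  fixes T :: "'a::t2_space set" and f :: "'a \<Rightarrow> 'a" and c :: 'a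
  assumes "hubbard_tree T f c"
  shows "(\<exists>e :: 'a \<Rightarrow> complex. embedding_map (top_of_set T) euclidean e \<and>
            (\<forall>x. branch_point T x \<longrightarrow> respects_cyclic_order e T f x)) \<longleftrightarrow>
         \<not> (\<exists>Q. evil_orbit T f Q)"
proof -
  obtain V E where "hubbard_graph T V E f c" by (rule hubbard_tree_graph[OF assms])
  then interpret hubbard_graph T V E f c .
  show ?thesis using respecting_embedding_no_evil no_evil_respecting_embedding by blast
qed

end
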